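(* Let $p$ be a prime number and let $A\subseteq\mathbb Z_{p^2}\times\mathbb Z_{p^2}$ be a nonempty subset. Then $A$ is spectral in $\mathbb Z_{p^2}\times\mathbb Z_{p^2}$ if and only if $A$ is a tile in $\mathbb Z_{p^2}\times\mathbb Z_{p^2}$.
   Context: $\mathbb Z_n$ denotes the additive cyclic group of order $n$. For subsets $A,B$ of a finite abelian group $G$, $A\oplus B=G$ means that every element of $G$ can be written in exactly one way as $a+b$ with $a\in A$, $b\in B$; then $(A,B)$ is called a tiling pair in $G$. $A$ is a tile (tiling set) in $G$ if there is $B\subseteq G$ with $A\oplus B=G$. For $x=(x_1,x_2)$, $s=(s_1,s_2)$ in $\mathbb Z_n\times\mathbb Z_n$ put $\langle x,s\rangle=x_1s_1+x_2s_2$ (mod $n$). A subset $A\subseteq\mathbb Z_n\times\mathbb Z_n$ is spectral if there is $S\subseteq\mathbb Z_n\times\mathbb Z_n$ such that the family of functions $x\mapsto e^{2\pi i\langle x,s\rangle/n}$ on $A$, indexed by $s\in S$, is an orthogonal basis of $L^2(A)$ with respect to the counting measure on $A$. *)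

theory Defs
  imports Complex_Main "HOL-Computational_Algebra.Primes" "HOL-Algebra.Elementary_Groups"
begin

text \<open>The group law is written multiplicatively, as everywhere in HOL-Algebra, so the sum of
  \<open>a\<close> and \<open>b\<close> in the abelian group \<open>G\<close> is \<open>a \<otimes>\<^bsub>G\<^esub> b\<close>.\<close>

definition tiling_pair :: "('a, 'b) monoid_scheme \<Rightarrow> 'a set \<Rightarrow> 'a set \<Rightarrow> bool" where
  "tiling_pair G A B \<longleftrightarrow>
     A \<subseteq> carrier G \<and> B \<subseteq> carrier G \<and>
     (\<forall>g\<in>carrier G. \<exists>!ab. ab \<in> A \<times> B \<and> g = fst ab \<otimes>\<^bsub>G\<^esub> snd ab)"

definition tile :: "('a, 'b) monoid_scheme \<Rightarrow> 'a set \<Rightarrow> bool" where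
  "tile G A \<longleftrightarrow> (\<exists>B. tiling_pair G A B)"

text \<open>For \<open>n > 0\<close> the carrier consists of the pairs of integers in \<open>{0..<n}\<close>.\<close>

abbreviation Zn_sq :: "nat \<Rightarrow> (int \<times> int) monoid" where
  "Zn_sq n \<equiv> integer_mod_group n \<times>\<times> integer_mod_group n"

definition pairing :: "nat \<Rightarrow> int \<times> int \<Rightarrow> int \<times> int \<Rightarrow> int" where
  "pairing n x s = (fst x * fst s + snd x * snd s) mod int n"

definition exp_char :: "nat \<Rightarrow> int \<times> int \<Rightarrow> int \<times> int \<Rightarrow> complex" where
  "exp_char n s x = exp (2 * of_real pi * \<i> * of_int (pairing n x s) / of_nat n)"

definition l2_inner :: "'a set \<Rightarrow> ('a \<Rightarrow> complex) \<Rightarrow> ('a \<Rightarrow> complex) \<Rightarrow> complex" where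
  "l2_inner A f g = (\<Sum>x\<in>A. f x * cnj (g x))"

text \<open>For finite \<open>A\<close>, the space \<open>L\<^sup>2(A)\<close> for the counting measure consists of all functions
  \<open>A \<rightarrow> \<complex>\<close>, given here by total functions of which only the values on \<open>A\<close> matter.
  A family \<open>(\<phi> s)\<close> indexed by a finite set \<open>S\<close> is a basis if every function on \<open>A\<close> is a linear
  combination of the family with a unique coefficient family \<open>c\<close>; extensionality
  of \<open>c\<close> fixes its irrelevant values outside \<open>S\<close>.\<close>

definition l2_basis :: "'a set \<Rightarrow> 's set \<Rightarrow> ('s \<Rightarrow> 'a \<Rightarrow> complex) \<Rightarrow> bool" where
  "l2_basis A S \<phi> \<longleftrightarrow>
     (\<forall>f. \<exists>!c. c \<in> extensional S \<and> (\<forall>x\<in>A. f x = (\<Sum>s\<in>S. c s * \<phi> s x)))"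

definition l2_orthogonal_basis :: "'a set \<Rightarrow> 's set \<Rightarrow> ('s \<Rightarrow> 'a \<Rightarrow> complex) \<Rightarrow> bool" where
  "l2_orthogonal_basis A S \<phi> \<longleftrightarrow>
     (\<forall>s\<in>S. \<forall>t\<in>S. s \<noteq> t \<longrightarrow> l2_inner A (\<phi> s) (\<phi> t) = 0) \<and> l2_basis A S \<phi>"

definition spectral :: "nat \<Rightarrow> (int \<times> int) set \<Rightarrow> bool" where
  "spectral n A \<longleftrightarrow>
     A \<subseteq> carrier (Zn_sq n) \<and>
     (\<exists>S \<subseteq> carrier (Zn_sq n). l2_orthogonal_basis A S (exp_char n))"

end

theory Submission
  imports Defs "HOL-Computational_Algebra.Computational_Algebra" "HOL-Library.Product_Plus"
begin

text \<open>
  Fourier coefficients are indexed through a symplectic form, so that an element \<open>t\<close> of order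
  \<open>p\<^sup>2\<close> annihilates exactly the cyclic group that it generates. As the cyclotomic polynomials of
  orders \<open>p\<close> and \<open>p\<^sup>2\<close> are irreducible (Eisenstein), the vanishing of a coefficient of the indicator
  function of \<open>A\<close> is an equidistribution property: at \<open>p u\<close> it means that all lines modulo \<open>p\<close>
  parallel to \<open>u\<close> contain equally many points of \<open>A\<close>, and at \<open>t\<close> that the cosets of the group
  generated by \<open>t\<close> which lie over a common line do so.

  The differences of a spectrum, or the non-vanishing coefficients of a tiling complement, force
  many such properties. Counting the incidences of points with the \<open>p + 1\<close> directions modulo \<open>p\<close>,
  at both levels of the group, shows that \<open>|A|\<close> is a power of \<open>p\<close> and that, with one
  exception, \<open>A\<close> has one of a few patterns (\<open>good\<close>), each of which admits an
  explicit spectrum and an explicit tiling complement of the form \<open>{i u + j v}\<close> with \<open>i\<close>, \<open>j\<close>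
  in intervals. In the exceptional case \<open>|A| = p\<^sup>2\<close> and no coefficient at any \<open>p u\<close> vanishes; there a
  spectrum is itself (in symplectic coordinates) a tiling complement, and a tiling complement is
  itself a spectrum.
\<close>

section \<open>Prime-power cyclotomic polynomials\<close>

text \<open>For a tiling pair the size of \<open>A\<close> divides p^4 at no cost. A spectral pair
  gives no such divisibility, so the sizes strictly between powers of \<open>p\<close> have to be
  refuted. There the symmetry between a set and its spectrum is essential: orthogonality of the
  characters on \<open>A\<close> makes the points of \<open>A\<close>, read as characters,
  orthogonal on the spectrum.

  The other obstacle is that a direction modulo \<open>p\<close> has \<open>p\<close> lifts to
  cyclic groups of order p^2. Vanishing at \<open>p u\<close> depends on the direction only,
  vanishing at \<open>t\<close> concerns a single lift. If all lifts of a direction vanish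
  (\<open>full\<close>), every residue class modulo \<open>p\<close> is spread evenly over its
  segments in that direction. If some lift fails, the partner has no difference generating that
  lift, so within each coset of it the points of the partner lie in one residue class. The case
  distinctions turn on which of the two happens.\<close>

abbreviation eval_int_poly :: "int poly \<Rightarrow> complex \<Rightarrow> complex" where
  "eval_int_poly f z \<equiv> poly (map_poly of_int f) z"

lemma eval_int_poly_add: "eval_int_poly (f + g) z = eval_int_poly f z + eval_int_poly g z"
proof -
  have "map_poly of_int (f + g) = map_poly of_int f + (map_poly of_int g :: complex poly)"
    by (intro poly_eqI) (simp add: coeff_map_poly)
  then show ?thesis by simp
qed

lemma eval_int_poly_smult: "eval_int_poly (smult c f) z = of_int c * eval_int_poly f z"
proof -
  have "map_poly of_int (smult c f) = smult (of_int c) (map_poly of_int f :: complex poly)"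
    by (intro poly_eqI) (simp add: coeff_map_poly)
  then show ?thesis by simp
qed

lemma eval_int_poly_mult: "eval_int_poly (f * g) z = eval_int_poly f z * eval_int_poly g z"
proof (induction f)
  case (pCons a f)
  have "eval_int_poly (pCons 0 (f * g)) z = z * eval_int_poly (f * g) z"
    by (simp add: map_poly_pCons)
  with pCons show ?case
    by (simp add: eval_int_poly_add eval_int_poly_smult map_poly_pCons algebra_simps)
qed simp

lemma eval_int_poly_power: "eval_int_poly (f ^ k) z = eval_int_poly f z ^ k"
  by (induction k) (simp_all add: eval_int_poly_mult)

lemma eval_int_poly_sum:
  "eval_int_poly (\<Sum>i\<in>I. f i) z = (\<Sum>i\<in>I. eval_int_poly (f i) z)"
  by (induction I rule: infinite_finite_induct) (simp_all add: eval_int_poly_add)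

lemma eval_int_poly_pcompose: "eval_int_poly (pcompose f g) z = eval_int_poly f (eval_int_poly g z)"
  by (induction f)
    (simp_all add: pcompose_pCons map_poly_pCons eval_int_poly_add eval_int_poly_mult)

lemma const_poly_dvd_coeff: "[:c:] dvd f \<Longrightarrow> c dvd coeff f k" for c :: int
  by (auto simp: const_poly_dvd_iff)

text \<open>The inner binomial coefficients are multiples of \<open>p\<close>. Congruence modulo
  \<open>p\<close> is kept as divisibility by the constant polynomial \<open>[:int p:]\<close>,
  which avoids changing the coefficient ring.\<close>

lemma prime_dvd_binomial_expansion:
  fixes a b :: "int poly"
  assumes "prime p"
  shows "[:int p:] dvd (a + b) ^ p - (a ^ p + b ^ p)"
proof -
  have p: "p > 0" using assms prime_gt_0_nat by blast
  have "(a + b) ^ p = (\<Sum>k\<le>p. of_nat (p choose k) * a ^ k * b ^ (p - k))"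
    by (rule binomial_ring)
  also have "{..p} = insert 0 (insert p {1..<p})" using p by auto
  also have "(\<Sum>k\<in>insert 0 (insert p {1..<p}). of_nat (p choose k) * a ^ k * b ^ (p - k)) =
      b ^ p + (a ^ p + (\<Sum>k\<in>{1..<p}. of_nat (p choose k) * a ^ k * b ^ (p - k)))"
    using p by (subst sum.insert) (auto simp: sum.insert)
  finally have "(a + b) ^ p - (a ^ p + b ^ p) =
      (\<Sum>k\<in>{1..<p}. of_nat (p choose k) * a ^ k * b ^ (p - k))" by simp
  also have "[:int p:] dvd \<dots>"
  proof (intro dvd_sum dvd_mult2)
    fix k assume k: "k \<in> {1..<p}"
    have "p dvd p choose k" by (rule dvd_choose_prime) (use k assms in auto)
    then obtain m where "p choose k = p * m" by (elim dvdE)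
    then have "of_nat (p choose k) = [:int p:] * (of_nat m :: int poly)"
      by (simp add: of_nat_poly)
    then show "[:int p:] dvd (of_nat (p choose k) :: int poly)" by (rule dvdI)
  qed
  finally show ?thesis .
qed

lemma dvd_power_diff: "c dvd a - b \<Longrightarrow> c dvd a ^ k - b ^ k" for a b c :: "'a :: comm_ring_1"
  by (simp add: power_diff_sumr2)

lemma prime_dvd_one_plus_X_power:
  assumes "prime p"
  shows "[:int p:] dvd [:1, 1:] ^ (p ^ m) - (1 + monom 1 (p ^ m))"
proof (induction m)
  case 0
  have "[:1, 1:] = 1 + monom (1::int) 1" by (simp add: monom_altdef one_pCons)
  then show ?case by simp
next
  case (Suc m)
  have 1: "[:int p:] dvd ([:1, 1:] ^ (p ^ m)) ^ p - (1 + monom 1 (p ^ m)) ^ p"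
    by (rule dvd_power_diff[OF Suc])
  have 2: "[:int p:] dvd (1 + monom 1 (p ^ m)) ^ p - (1 ^ p + monom 1 (p ^ m) ^ p)"
    by (rule prime_dvd_binomial_expansion[OF assms])
  have "[:int p:] dvd ([:1, 1:] ^ (p ^ m)) ^ p - (1 ^ p + monom 1 (p ^ m) ^ p)"
    using dvd_add[OF 1 2] by (metis diff_add_cancel add_diff_eq)
  then show ?case
    by (simp add: monom_power mult.commute flip: power_mult)
qed

text \<open>The minimal polynomial of a root of a monic Eisenstein polynomial, taken primitive, divides
  every integer polynomial with that root (Gauss), in particular the Eisenstein polynomial.\<close>

lemma primitive_minimal_dvd:
  fixes f g :: "int poly"
  assumes g: "g \<noteq> 0" "content g = 1" "eval_int_poly g z = 0"
    and min: "\<And>h. h \<noteq> 0 \<Longrightarrow> eval_int_poly h z = 0 \<Longrightarrow> degree g \<le> degree h"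
    and f: "eval_int_poly f z = 0"
  shows "g dvd f"
proof -
  from pseudo_mod[OF g(1), of f] obtain a q where aq: "a \<noteq> 0"
    "smult a f = g * q + pseudo_mod f g" "pseudo_mod f g = 0 \<or> degree (pseudo_mod f g) < degree g"
    by blast
  have "eval_int_poly (smult a f) z = 0" using f by (simp add: eval_int_poly_smult)
  then have "eval_int_poly (pseudo_mod f g) z = 0"
    unfolding aq(2) by (simp add: eval_int_poly_add eval_int_poly_mult g)
  with min aq(3) have "pseudo_mod f g = 0" by force
  then have eq: "smult a f = g * q" using aq(2) by simp
  have "a dvd content (smult a f)" by simp
  then have "a dvd content q" unfolding eq by (simp add: content_mult g)
  then have "[:a:] dvd q" by (simp add: const_poly_dvd_iff_dvd_content)
  then obtain r where "q = [:a:] * r" by (elim dvdE)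
  then have "smult a f = smult a (g * r)" using eq by simp
  then have "f = g * r" using aq(1) by (simp only: smult_cancel)
  then show ?thesis by simp
qed

text \<open>Let \<open>i\<close> be the lowest index at which \<open>p\<close> does not divide the
  coefficient of \<open>g\<close>. Coefficient \<open>i\<close> of \<open>g * h\<close> is congruent
  to \<open>coeff g i * coeff h 0\<close> modulo \<open>p\<close>, hence not divisible by
  \<open>p\<close>, so \<open>i\<close> cannot lie below \<open>n\<close>.\<close>

lemma eisenstein_factor_degree:
  fixes g h :: "int poly"
  assumes p: "prime (p :: int)" and "p dvd coeff g 0" and "\<not> p dvd coeff h 0"
    and g: "\<not> p dvd coeff g k" and low: "\<And>i. i < n \<Longrightarrow> p dvd coeff (g * h) i"
  shows "n \<le> degree g"
proof -
  define i where "i = (LEAST i. \<not> p dvd coeff g i)"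
  have i: "\<not> p dvd coeff g i" unfolding i_def by (rule LeastI[of _ k]) (fact g)
  have lt: "p dvd coeff g j" if "j < i" for j
    using not_less_Least[OF that[unfolded i_def]] by blast
  have "coeff (g * h) i = (\<Sum>j\<in>insert i {..<i}. coeff g j * coeff h (i - j))"
    by (simp add: coeff_mult lessThan_Suc_atMost[symmetric] lessThan_Suc)
  also have "\<dots> = coeff g i * coeff h 0 + (\<Sum>j<i. coeff g j * coeff h (i - j))"
    by (subst sum.insert) auto
  finally have eq: "coeff (g * h) i = coeff g i * coeff h 0 + (\<Sum>j<i. coeff g j * coeff h (i - j))" .
  have "p dvd (\<Sum>j<i. coeff g j * coeff h (i - j))"
    by (intro dvd_sum dvd_mult2 lt) auto
  moreover have "\<not> p dvd coeff g i * coeff h 0"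
    using i assms(3) p by (simp add: prime_dvd_mult_iff)
  ultimately have "\<not> p dvd coeff (g * h) i"
    unfolding eq by (simp add: dvd_add_left_iff)
  then have "n \<le> i" using low not_le_imp_less by blast
  also have "i \<le> degree g" using i by (intro le_degree) auto
  finally show ?thesis .
qed

text \<open>This is the form of Eisenstein's criterion used later: a degree bound for every
  polynomial vanishing at the root. The primitive vanishing polynomial \<open>g\<close> of least
  degree divides \<open>E\<close>, and exactly one of the two factors has constant term divisible by
  \<open>p\<close>. That factor has degree at least \<open>n\<close>; if it were the cofactor,
  \<open>g\<close> would be a nonzero constant with a root.\<close>

lemma eisenstein_root_degree:
  fixes f E :: "int poly"
  assumes p: "prime (p :: int)" and lead: "\<not> p dvd coeff E n" and deg: "degree E \<le> n"
    and low: "\<And>i. i < n \<Longrightarrow> p dvd coeff E i" and sq: "\<not> p * p dvd coeff E 0"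
    and E: "eval_int_poly E z = 0" and f: "eval_int_poly f z = 0" "f \<noteq> 0" and n: "n > 0"
  shows "n \<le> degree f"
proof -
  define d where "d = (LEAST d. \<exists>g. g \<noteq> 0 \<and> eval_int_poly g z = 0 \<and> degree g = d)"
  have "\<exists>g. g \<noteq> 0 \<and> eval_int_poly g z = 0 \<and> degree g = d"
    unfolding d_def by (rule LeastI_ex) (use f in blast)
  then obtain g0 where g0: "g0 \<noteq> 0" "eval_int_poly g0 z = 0" "degree g0 = d" by blast
  have min: "d \<le> degree h" if "h \<noteq> 0" "eval_int_poly h z = 0" for h
    unfolding d_def by (rule Least_le) (use that in blast)
  define g where "g = primitive_part g0"
  have "eval_int_poly (smult (content g0) g) z = 0" unfolding g_def using g0 by simp
  then have "eval_int_poly g z = 0" using g0 by (simp add: eval_int_poly_smult)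
  then have g: "g \<noteq> 0" "content g = 1" "eval_int_poly g z = 0" "degree g = d"
    using g0 by (simp_all add: g_def)
  have "g dvd E" by (rule primitive_minimal_dvd[OF g(1-3)]) (use min g(4) E in auto)
  then obtain h where h: "E = g * h" by (elim dvdE)
  have k: "\<exists>k. \<not> p dvd coeff g k" "\<exists>k. \<not> p dvd coeff h k"
  proof -
    show "\<exists>k. \<not> p dvd coeff g k"
    proof (rule ccontr)
      assume "\<nexists>k. \<not> p dvd coeff g k"
      then have "[:p:] dvd g" by (simp add: const_poly_dvd_iff)
      then have "[:p:] dvd E" unfolding h by simp
      with lead show False by (simp add: const_poly_dvd_coeff)
    qed
    show "\<exists>k. \<not> p dvd coeff h k"
    proof (rule ccontr)
      assume "\<nexists>k. \<not> p dvd coeff h k"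
      then have "[:p:] dvd h" by (simp add: const_poly_dvd_iff)
      then have "[:p:] dvd E" unfolding h by simp
      with lead show False by (simp add: const_poly_dvd_coeff)
    qed
  qed
  have c0: "coeff E 0 = coeff g 0 * coeff h 0" unfolding h by (rule coeff_mult_0)
  have "p dvd coeff E 0" by (rule low[OF n])
  then consider "p dvd coeff g 0" "\<not> p dvd coeff h 0" | "p dvd coeff h 0" "\<not> p dvd coeff g 0"
    using sq p unfolding c0 by (auto simp: prime_dvd_mult_iff intro: mult_dvd_mono)
  then show ?thesis
  proof cases
    case 1
    obtain k where "\<not> p dvd coeff g k" using k by blast
    then have "n \<le> degree g"
      by (rule eisenstein_factor_degree[OF p 1]) (use low h in auto)
    with min[of f] f g show ?thesis by simp
  next
    case 2
    obtain k where "\<not> p dvd coeff h k" using k by blast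
    then have "n \<le> degree h"
      by (rule eisenstein_factor_degree[OF p 2]) (use low h in \<open>auto simp: mult.commute\<close>)
    moreover have "h \<noteq> 0" using k by auto
    moreover have "degree g \<noteq> 0"
    proof
      assume "degree g = 0"
      then obtain c where "g = [:c:]" by (rule degree_eq_zeroE)
      with g show False by (simp add: map_poly_pCons)
    qed
    moreover have "degree E = degree g + degree h"
      unfolding h using g \<open>h \<noteq> 0\<close> by (simp add: degree_mult_eq)
    ultimately show ?thesis using deg by simp
  qed
qed

text \<open>The polynomial \<open>E\<close> is the cyclotomic polynomial of order p^(m+1) at X + 1,
  and \<open>z - 1\<close> is a root of it. Substituting X + 1 into \<open>f\<close> moves its root
  in the same way and preserves the degree.\<close>

lemma cyclotomic_root_degree:
  fixes f :: "int poly"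
  assumes p: "prime p" and z: "(z ^ (p ^ m)) ^ p = 1" "z ^ (p ^ m) \<noteq> 1"
    and f: "eval_int_poly f z = 0" "f \<noteq> 0"
  shows "(p - 1) * p ^ m \<le> degree f"
proof -
  define q where "q = p ^ m"
  have p2: "p \<ge> 2" using p prime_ge_2_nat by blast
  have q: "q > 0" using p2 by (simp add: q_def)
  define L :: "int poly" where "L = [:1, 1:]"
  define B where "B k = L ^ k - (1 + monom 1 k)" for k
  define E where "E = (\<Sum>i<p. (L ^ q) ^ i)"
  have "(L ^ q) ^ p - 1 = (L ^ q - 1) * E"
    unfolding E_def by (rule power_diff_1_eq)
  then have eq: "(L ^ q - 1) * E = L ^ (q * p) - 1" by (simp add: power_mult)
  \<comment> \<open>Modulo \<open>p\<close> the power (1 + X)^q is 1 + X^q, so the product identity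
    turns into X^q E = X^(q p). Comparing coefficients gives E = X^((p - 1) q) modulo
    \<open>p\<close>.\<close>
  have "monom 1 q * E - monom 1 (q * p) = B (q * p) - B q * E"
    using eq unfolding B_def by (simp add: algebra_simps)
  moreover have "[:int p:] dvd B q" "[:int p:] dvd B (q * p)"
    using prime_dvd_one_plus_X_power[OF p, of m] prime_dvd_one_plus_X_power[OF p, of "Suc m"]
    unfolding B_def L_def q_def by (simp_all add: mult.commute)
  then have "[:int p:] dvd B (q * p) - B q * E" by (intro dvd_diff dvd_mult2)
  ultimately have "[:int p:] dvd monom 1 q * E - monom 1 (q * p)" by metis
  then have dvd: "int p dvd coeff (monom 1 q * E - monom 1 (q * p)) k" for k
    by (rule const_poly_dvd_coeff)
  have coeffE: "int p dvd coeff E k - (if k + q = q * p then 1 else 0)" for k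
    using dvd[of "k + q"] by (simp add: coeff_monom_mult coeff_monom eq_commute[of "q * p"])
  have n: "(p - 1) * q + q = q * p" using p2 by (simp add: algebra_simps)
  have "eval_int_poly L (z - 1) = z" by (simp add: L_def map_poly_pCons)
  then have "(z ^ q - 1) * eval_int_poly E (z - 1) = (z ^ q) ^ p - 1"
    unfolding E_def by (simp add: eval_int_poly_sum eval_int_poly_power power_diff_1_eq)
  then have root: "eval_int_poly E (z - 1) = 0" using z by (simp add: q_def)
  have degL: "degree (L ^ k) \<le> k" for k
    using degree_power_le[of L k] by (simp add: L_def)
  have "(p - 1) * q \<le> degree (pcompose f L)"
  proof (rule eisenstein_root_degree[where p = "int p" and E = E])
    show "prime (int p)" using p by simp
    show "\<not> int p dvd coeff E ((p - 1) * q)"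
    proof
      assume "int p dvd coeff E ((p - 1) * q)"
      moreover have "int p dvd coeff E ((p - 1) * q) - 1" using coeffE[of "(p - 1) * q"] n by simp
      ultimately have "int p dvd coeff E ((p - 1) * q) - (coeff E ((p - 1) * q) - 1)"
        by (rule dvd_diff)
      with p2 show False by simp
    qed
    show "degree E \<le> (p - 1) * q"
      unfolding E_def
    proof (rule degree_sum_le)
      fix i assume "i \<in> {..<p}"
      then have "i \<le> p - 1" by auto
      then have "q * i \<le> (p - 1) * q" by (metis mult.commute mult_le_mono2)
      with degL[of "q * i"] show "degree ((L ^ q) ^ i) \<le> (p - 1) * q"
        unfolding power_mult by (rule le_trans)
    qed simp
    show "int p dvd coeff E i" if "i < (p - 1) * q" for i
      using coeffE[of i] that n by simp
    have "coeff E 0 = int p"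
      by (simp add: E_def L_def coeff_sum coeff_0_power)
    then show "\<not> int p * int p dvd coeff E 0" using p2 by simp
    show "eval_int_poly E (z - 1) = 0" by (fact root)
    show "eval_int_poly (pcompose f L) (z - 1) = 0"
      using f by (simp add: eval_int_poly_pcompose L_def map_poly_pCons)
    show "pcompose f L \<noteq> 0" using f by (simp add: pcompose_eq_0_iff L_def)
    show "0 < (p - 1) * q" using p2 q by simp
  qed
  then show ?thesis by (simp add: degree_pcompose L_def q_def)
qed

text \<open>Subtracting the last block of \<open>q = p ^ m\<close> coefficients from each of the \<open>p\<close> blocks uses the
  relation given by the cyclotomic polynomial and leaves a polynomial of smaller degree.\<close>

lemma prime_power_root_vanishing_sum:
  fixes c :: "nat \<Rightarrow> int"
  assumes p: "prime p" and z: "(z ^ (p ^ m)) ^ p = 1" "z ^ (p ^ m) \<noteq> (1 :: complex)"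
  shows "(\<Sum>k<p * p ^ m. of_int (c k) * z ^ k) = 0 \<longleftrightarrow>
    (\<forall>k<p * p ^ m. \<forall>l<p * p ^ m. k mod p ^ m = l mod p ^ m \<longrightarrow> c k = c l)"
proof -
  define q where "q = p ^ m"
  have p2: "p \<ge> 2" using p prime_ge_2_nat by blast
  have q: "q > 0" using p2 by (simp add: q_def)
  have blocks: "(\<Sum>k<p * q. g k) = (\<Sum>i<p. \<Sum>r<q. g (i * q + r))" for g :: "nat \<Rightarrow> complex"
  proof -
    have "(\<Sum>k<p * q. g k) = (\<Sum>i<p. sum g {i * q..<i * q + q})"
      by (rule sum.nat_group[symmetric])
    also have "\<dots> = (\<Sum>i<p. \<Sum>r<q. g (i * q + r))"
    proof (rule sum.cong[OF refl])
      fix i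
      show "sum g {i * q..<i * q + q} = (\<Sum>r<q. g (i * q + r))"
        using sum.shift_bounds_nat_ivl[of g 0 "i * q" q]
        by (simp only: lessThan_atLeast0 add.commute add_0_left)
    qed
    finally show ?thesis .
  qed
  have geo: "(\<Sum>i<p. (z ^ q) ^ i) = 0"
    using power_diff_1_eq[of "z ^ q" p] z by (simp add: q_def)
  have vanish: "(\<Sum>k<p * q. b (k mod q) * z ^ k) = 0" for b :: "nat \<Rightarrow> complex"
  proof -
    have "(\<Sum>k<p * q. b (k mod q) * z ^ k) = (\<Sum>i<p. (z ^ q) ^ i * (\<Sum>r<q. b r * z ^ r))"
      unfolding blocks sum_distrib_left
    proof (intro sum.cong refl)
      fix i r assume "r \<in> {..<q}"
      then have "(i * q + r) mod q = r" by simp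
      moreover have "z ^ (i * q + r) = (z ^ q) ^ i * z ^ r"
        by (simp add: power_add mult.commute[of i] power_mult)
      ultimately show "b ((i * q + r) mod q) * z ^ (i * q + r) = (z ^ q) ^ i * (b r * z ^ r)"
        by simp
    qed
    then show ?thesis by (simp add: geo flip: sum_distrib_right)
  qed
  show ?thesis unfolding q_def[symmetric]
  proof
    assume per: "\<forall>k<p * q. \<forall>l<p * q. k mod q = l mod q \<longrightarrow> c k = c l"
    have "c k = c (k mod q)" if "k < p * q" for k
    proof -
      have "k mod q < p * q" using that mod_less_eq_dividend le_less_trans by blast
      with per that show ?thesis by (metis mod_mod_trivial)
    qed
    then have "(\<Sum>k<p * q. of_int (c k) * z ^ k) = (\<Sum>k<p * q. of_int (c (k mod q)) * z ^ k)"
      by (intro sum.cong) auto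
    then show "(\<Sum>k<p * q. of_int (c k) * z ^ k) = 0" by (simp add: vanish[of "\<lambda>r. of_int (c r)"])
  next
    assume zero: "(\<Sum>k<p * q. of_int (c k) * z ^ k) = 0"
    define d where "d k = c k - c ((p - 1) * q + k mod q)" for k
    define f where "f = (\<Sum>k<p * q. monom (d k) k)"
    have "eval_int_poly f z = (\<Sum>k<p * q. of_int (d k) * z ^ k)"
      by (simp add: f_def eval_int_poly_sum map_poly_monom poly_monom)
    also have "\<dots> = 0"
      using zero vanish[of "\<lambda>r. of_int (c ((p - 1) * q + r))"]
      by (simp add: d_def left_diff_distrib sum_subtractf)
    finally have root: "eval_int_poly f z = 0" .
    have coeff: "coeff f k = (if k < p * q then d k else 0)" for k
      by (simp add: f_def coeff_sum coeff_monom)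
    have pq: "p * q = (p - 1) * q + q" using p2 by (simp add: algebra_simps)
    have "coeff f k = 0" if "(p - 1) * q \<le> k" for k
    proof (cases "k < p * q")
      case True
      then have "(k - (p - 1) * q) < q" using that pq by simp
      then have "(k - (p - 1) * q + (p - 1) * q) mod q = k - (p - 1) * q"
        by (subst mod_mult_self1) simp
      then have "k mod q = k - (p - 1) * q" by (simp only: le_add_diff_inverse2[OF that])
      then show ?thesis using that by (simp add: coeff d_def)
    qed (simp add: coeff)
    then have "f = 0 \<or> degree f < (p - 1) * q"
      by (metis leading_coeff_0_iff linorder_not_le)
    with cyclotomic_root_degree[OF p z root] have "f = 0" by (metis linorder_not_le q_def)
    then have "d k = 0" if "k < p * q" for k using coeff[of k] that by simp
    then have "c k = c ((p - 1) * q + k mod q)" if "k < p * q" for k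
      using that by (simp add: d_def)
    then show "\<forall>k<p * q. \<forall>l<p * q. k mod q = l mod q \<longrightarrow> c k = c l" by metis
  qed
qed

section \<open>Vanishing Fourier coefficients as equidistribution\<close>

text \<open>Grouping the sum by the residue of \<open>f a\<close> modulo p^(m+1) leaves a
  combination of powers of one root of unity whose integer coefficients are the counts. The counts
  are indexed by all integers \<open>k\<close>, so that no reduction of residues is needed
  later.\<close>

lemma vanishing_exponential_sum_iff:
  fixes f :: "'a \<Rightarrow> int"
  assumes p: "prime p" and A: "finite A"
  shows "(\<Sum>a\<in>A. cis (2 * pi * f a / real (p ^ Suc m))) = 0 \<longleftrightarrow>
    (\<forall>k l. int p ^ m dvd k - l \<longrightarrow>
      card {a\<in>A. int p ^ Suc m dvd f a - k} = card {a\<in>A. int p ^ Suc m dvd f a - l})"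
proof -
  define N where "N = p * p ^ m"
  define z where "z = cis (2 * pi / N)"
  define c where "c k = int (card {a\<in>A. nat (f a mod int N) = k})" for k
  have p2: "p \<ge> 2" using p prime_ge_2_nat by blast
  then have N: "N > 0" by (simp add: N_def)
  have zN: "z ^ N = 1" using N by (simp add: z_def DeMoivre)
  have zq: "z ^ (p ^ m) = cis (2 * pi / p)"
    using p2 by (simp add: z_def DeMoivre N_def)
  have z1: "z ^ (p ^ m) \<noteq> 1"
  proof
    assume "z ^ (p ^ m) = 1"
    then have "cos (2 * pi / p) = 1" unfolding zq by (metis cis.sel(1) one_complex.sel(1))
    then obtain k :: int where "2 * pi / p = k * 2 * pi" by (auto simp: cos_one_2pi_int)
    then have "pi * 2 = pi * 2 * (k * real p)" using p2 by (simp add: field_simps)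
    then have "k * real p = 1" using pi_gt_zero by (metis mult_cancel_left1 mult_eq_0_iff less_irrefl zero_neq_numeral)
    then have "real_of_int (k * int p) = 1" by simp
    then have "k * int p = 1" by linarith
    then have "int p dvd 1" by (metis dvd_triv_right)
    then show False using p2 by simp
  qed
  have summand: "cis (2 * pi * f a / real (p ^ Suc m)) = z ^ nat (f a mod int N)" for a
  proof -
    have "int (nat (f a mod int N)) = f a mod int N" using N by simp
    also have "\<dots> = f a - f a div int N * int N" by (rule minus_div_mult_eq_mod[symmetric])
    finally have "real_of_int (int (nat (f a mod int N))) = of_int (f a - f a div int N * int N)"
      by (rule arg_cong)
    then have r: "real (nat (f a mod int N)) = real_of_int (f a) - real_of_int (f a div int N) * real N"
      by (simp only: of_int_of_nat_eq of_int_diff of_int_mult)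
    have "z ^ nat (f a mod int N) = cis (real (nat (f a mod int N)) * (2 * pi / N))"
      by (simp add: z_def DeMoivre)
    also have "real (nat (f a mod int N)) * (2 * pi / N) =
        2 * pi * f a / N + 2 * pi * of_int (- (f a div int N))"
      unfolding r using N by (simp add: field_simps)
    also have "cis \<dots> = cis (2 * pi * f a / N)"
      by (subst cis_mult[symmetric]) (simp only: cis_multiple_2pi Ints_of_int mult_1_right)
    finally show ?thesis by (simp add: N_def)
  qed
  have "(\<Sum>a\<in>A. cis (2 * pi * f a / real (p ^ Suc m))) = (\<Sum>a\<in>A. z ^ nat (f a mod int N))"
    by (simp only: summand)
  also have "\<dots> = (\<Sum>k<N. \<Sum>a\<in>{a\<in>A. nat (f a mod int N) = k}. z ^ nat (f a mod int N))"
    by (rule sum.group[symmetric]) (use A N in \<open>auto simp: nat_less_iff\<close>)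
  also have "\<dots> = (\<Sum>k<N. of_int (c k) * z ^ k)"
    by (intro sum.cong refl) (simp add: c_def)
  finally have "(\<Sum>a\<in>A. cis (2 * pi * f a / real (p ^ Suc m))) = 0 \<longleftrightarrow>
      (\<Sum>k<N. of_int (c k) * z ^ k) = 0" by simp
  also have "\<dots> \<longleftrightarrow> (\<forall>k<N. \<forall>l<N. k mod p ^ m = l mod p ^ m \<longrightarrow> c k = c l)"
    unfolding N_def
    by (rule prime_power_root_vanishing_sum[OF p]) (use zN z1 in \<open>simp_all add: N_def mult.commute flip: power_mult\<close>)
  also have "\<dots> \<longleftrightarrow> (\<forall>k l. int p ^ m dvd k - l \<longrightarrow>
      card {a\<in>A. int p ^ Suc m dvd f a - k} = card {a\<in>A. int p ^ Suc m dvd f a - l})"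
  proof -
    have cc: "int (card {a\<in>A. int p ^ Suc m dvd f a - k}) = c (nat (k mod int N))" for k
    proof -
      have "int p ^ Suc m dvd x - k \<longleftrightarrow> nat (x mod int N) = nat (k mod int N)" for x
        using N by (simp add: mod_eq_dvd_iff[symmetric] N_def eq_nat_nat_iff)
      then show ?thesis by (simp add: c_def)
    qed
    have cn: "c k = int (card {a\<in>A. int p ^ Suc m dvd f a - int k})" if "k < N" for k
      using cc[of "int k"] that by (simp flip: of_nat_mod)
    have md: "nat (k mod int N) mod p ^ m = nat (l mod int N) mod p ^ m"
      if "int p ^ m dvd k - l" for k l
    proof -
      have "int p ^ m dvd int N" by (simp add: N_def)
      then have "(k mod int N) mod int p ^ m = (l mod int N) mod int p ^ m"
        using that by (simp add: mod_mod_cancel mod_eq_dvd_iff)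
      then have "int (nat (k mod int N) mod p ^ m) = int (nat (l mod int N) mod p ^ m)"
        using N by (simp add: of_nat_mod)
      then show ?thesis by (simp only: of_nat_eq_iff)
    qed
    show ?thesis (is "?L \<longleftrightarrow> ?R")
    proof
      assume L: ?L
      show ?R
      proof (intro allI impI)
        fix k l assume "int p ^ m dvd k - l"
        then have "c (nat (k mod int N)) = c (nat (l mod int N))"
          using L md N by (simp add: nat_less_iff)
        then show "card {a\<in>A. int p ^ Suc m dvd f a - k} = card {a\<in>A. int p ^ Suc m dvd f a - l}"
          by (simp only: cc[symmetric] of_nat_eq_iff)
      qed
    next
      assume R: ?R
      show ?L
      proof (intro allI impI)
        fix k l assume kl: "k < N" "l < N" "k mod p ^ m = l mod p ^ m"
        then have "int k mod int (p ^ m) = int l mod int (p ^ m)" by (metis of_nat_mod)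
        then have "int p ^ m dvd int k - int l" by (simp add: mod_eq_dvd_iff)
        with R kl show "c k = c l" by (simp only: cn)
      qed
    qed
  qed
  finally show ?thesis .
qed

text \<open>The symplectic pairing is used in place of the bilinear pairing of the definition: then the
  annihilator of a cyclic group of order \<open>p\<^sup>2\<close> is that group itself.\<close>

definition wedge :: "int \<times> int \<Rightarrow> int \<times> int \<Rightarrow> int" where
  "wedge a b = fst a * snd b - snd a * fst b"

definition smul :: "int \<Rightarrow> int \<times> int \<Rightarrow> int \<times> int" where
  "smul k a = (k * fst a, k * snd a)"

definition dvd_pair :: "int \<Rightarrow> int \<times> int \<Rightarrow> bool" where
  "dvd_pair m a \<longleftrightarrow> m dvd fst a \<and> m dvd snd a"

lemma wedge_add_left: "wedge (a + b) c = wedge a c + wedge b c"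
  and wedge_add_right: "wedge c (a + b) = wedge c a + wedge c b"
  and wedge_diff_left: "wedge (a - b) c = wedge a c - wedge b c"
  and wedge_diff_right: "wedge c (a - b) = wedge c a - wedge c b"
  and wedge_smul_left: "wedge (smul k a) c = k * wedge a c"
  and wedge_smul_right: "wedge c (smul k a) = k * wedge c a"
  and wedge_self: "wedge a a = 0"
  by (simp_all add: wedge_def smul_def algebra_simps)

lemma wedge_minus: "wedge a b = - wedge b a"
  by (simp add: wedge_def)

lemmas wedge_linear = wedge_add_left wedge_add_right wedge_diff_left wedge_diff_right
  wedge_smul_left wedge_smul_right wedge_self

lemma smul_simps: "smul 0 a = 0" "smul 1 a = a" "smul k 0 = 0" "smul k a + smul l a = smul (k + l) a"
  "smul k a - smul l a = smul (k - l) a" "smul k (smul l a) = smul (k * l) a"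
  by (simp_all add: smul_def zero_prod_def algebra_simps)

lemma dvd_wedge_left: "dvd_pair m a \<Longrightarrow> m dvd wedge a b"
  by (simp add: dvd_pair_def wedge_def)

lemma dvd_pair_minus_commute: "dvd_pair m (a - b) \<longleftrightarrow> dvd_pair m (b - a)"
  by (simp add: dvd_pair_def dvd_diff_commute)

lemma dvd_pair_diff_trans: "dvd_pair m (a - b) \<Longrightarrow> dvd_pair m (b - c) \<Longrightarrow> dvd_pair m (a - c)"
  using dvd_add[of m "fst a - fst b" "fst b - fst c"] dvd_add[of m "snd a - snd b" "snd b - snd c"]
  by (simp add: dvd_pair_def)

lemma dvd_pair_diff_cong: "dvd_pair m (b - c) \<Longrightarrow> dvd_pair m (a - b) \<longleftrightarrow> dvd_pair m (a - c)"
  using dvd_pair_diff_trans dvd_pair_minus_commute by blast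

lemma dvd_pair_zero [simp]: "dvd_pair m 0"
  by (simp add: dvd_pair_def)

lemma dvd_pair_smul: "dvd_pair m (smul m a)"
  by (simp add: dvd_pair_def smul_def)

lemma dvd_pairE:
  assumes "dvd_pair m a" obtains b where "a = smul m b"
proof -
  from assms obtain x y where "fst a = m * x" "snd a = m * y"
    by (auto simp: dvd_pair_def elim!: dvdE)
  then have "a = smul m (x, y)" by (simp add: smul_def prod_eq_iff)
  then show thesis by (rule that)
qed

locale prime_square =
  fixes p :: nat
  assumes prime_p: "prime p"
begin

abbreviation "P \<equiv> int p"

lemma p_ge_2: "p \<ge> 2" using prime_p prime_ge_2_nat by blast
lemma P_prime: "prime P" using prime_p by simp
lemma P_pos: "P > 0" using p_ge_2 by simp

section \<open>Line, coset, class and segment counts\<close>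

definition prim :: "int \<times> int \<Rightarrow> bool" where
  "prim x \<longleftrightarrow> \<not> dvd_pair P x"

text \<open>For primitive \<open>u\<close>, four pieces of the group around \<open>c\<close> are
  counted: the line through \<open>c\<close> modulo \<open>p\<close>, the coset of the cyclic group
  of order p^2, the residue class modulo \<open>p\<close>, and the segment, which is a coset of the
  group of order \<open>p\<close> generated by \<open>p u\<close>. The segment is the intersection
  of coset and class, and both of these lie in the line.\<close>

definition line_card :: "(int \<times> int) set \<Rightarrow> int \<times> int \<Rightarrow> int \<times> int \<Rightarrow> nat" where
  "line_card A u c = card {a\<in>A. P dvd wedge (a - c) u}"

definition coset_card :: "(int \<times> int) set \<Rightarrow> int \<times> int \<Rightarrow> int \<times> int \<Rightarrow> nat" where
  "coset_card A t c = card {a\<in>A. P\<^sup>2 dvd wedge (a - c) t}"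

definition class_card :: "(int \<times> int) set \<Rightarrow> int \<times> int \<Rightarrow> nat" where
  "class_card A c = card {a\<in>A. dvd_pair P (a - c)}"

definition seg_card :: "(int \<times> int) set \<Rightarrow> int \<times> int \<Rightarrow> int \<times> int \<Rightarrow> nat" where
  "seg_card A u c = card {a\<in>A. dvd_pair P (a - c) \<and> P\<^sup>2 dvd wedge (a - c) u}"

definition z1 :: "(int \<times> int) set \<Rightarrow> int \<times> int \<Rightarrow> bool" where
  "z1 A u \<longleftrightarrow> (\<forall>c c'. line_card A u c = line_card A u c')"

text \<open>Two cosets of the group of \<open>t\<close> over the same line modulo \<open>p\<close>
  have representatives that agree modulo \<open>p\<close>. Comparing congruent base points therefore
  compares exactly the cosets over a common line.\<close>

definition z2 :: "(int \<times> int) set \<Rightarrow> int \<times> int \<Rightarrow> bool" where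
  "z2 A t \<longleftrightarrow> (\<forall>c c'. dvd_pair P (c - c') \<longrightarrow> coset_card A t c = coset_card A t c')"

definition fourier :: "(int \<times> int) set \<Rightarrow> int \<times> int \<Rightarrow> complex" where
  "fourier A s = (\<Sum>a\<in>A. cis (2 * pi * wedge a s / real (p\<^sup>2)))"

text \<open>Sets of integer pairs stand for subsets of the group, and this condition makes the
  passage to residues injective. A spectrum can thus be used without moving it into the
  carrier.\<close>

definition reduced :: "(int \<times> int) set \<Rightarrow> bool" where
  "reduced A \<longleftrightarrow> finite A \<and> (\<forall>a\<in>A. \<forall>b\<in>A. dvd_pair (P\<^sup>2) (a - b) \<longrightarrow> a = b)"

lemma prim_cases: "prim x \<Longrightarrow> coprime (fst x) (P ^ k) \<or> coprime (snd x) (P ^ k)"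
  unfolding prim_def dvd_pair_def
  using prime_imp_coprime[OF P_prime] by (metis coprime_commute coprime_power_right_iff)

lemma prim_mult_dvd:
  assumes "prim u" "P ^ k dvd x * fst u" "P ^ k dvd x * snd u"
  shows "P ^ k dvd x"
  using prim_cases[OF assms(1), of k] assms(2,3) coprime_commute coprime_dvd_mult_left_iff by blast

text \<open>The three vectors satisfy (x,t) u = (x,u) t - (t,u) x, where (.,.) is the symplectic
  form. So parallelism is transitive as long as the middle vector is primitive.\<close>

lemma wedge_dvd_trans:
  assumes "prim u" "P ^ k dvd wedge x u" "P ^ k dvd wedge t u"
  shows "P ^ k dvd wedge x t"
proof (rule prim_mult_dvd[OF assms(1)])
  have "wedge x t * fst u = wedge x u * fst t - wedge t u * fst x"
    and "wedge x t * snd u = wedge x u * snd t - wedge t u * snd x"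
    by (simp_all add: wedge_def algebra_simps)
  then show "P ^ k dvd wedge x t * fst u" "P ^ k dvd wedge x t * snd u" using assms by auto
qed

lemma wedge_dvd_iff:
  assumes "prim u" "prim t" "P ^ k dvd wedge t u"
  shows "P ^ k dvd wedge x u \<longleftrightarrow> P ^ k dvd wedge x t"
  using wedge_dvd_trans[OF assms(1), of k x t] wedge_dvd_trans[OF assms(2), of k x u] assms(3)
  by (auto simp: wedge_minus[of t u])

text \<open>One coordinate of \<open>t\<close> is invertible modulo P^k, and \<open>y\<close> is
  supported on the other coordinate. Together \<open>t\<close> and \<open>y\<close> form a
  symplectic basis modulo P^k.\<close>

lemma dual_vector_exists:
  assumes "prim t"
  obtains y where "P ^ k dvd wedge y t - 1"
proof -
  have inv: "\<exists>i. P ^ k dvd i * x - 1" if "coprime x (P ^ k)" for x :: int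
  proof -
    obtain i j where "i * x + j * P ^ k = 1" using bezout_int[of x "P ^ k"] \<open>coprime x (P ^ k)\<close>
      by (metis coprime_iff_gcd_eq_1)
    then have "i * x - 1 = P ^ k * (- j)" by (simp add: algebra_simps)
    then show ?thesis by (metis dvd_triv_left)
  qed
  from prim_cases[OF assms] show thesis
  proof
    assume "coprime (fst t) (P ^ k)"
    then obtain i where "P ^ k dvd i * fst t - 1" using inv by blast
    then show thesis by (intro that[of "(0, - i)"]) (simp add: wedge_def)
  next
    assume "coprime (snd t) (P ^ k)"
    then obtain i where "P ^ k dvd i * snd t - 1" using inv by blast
    then show thesis by (intro that[of "(i, 0)"]) (simp add: wedge_def)
  qed
qed

text \<open>The solutions of \<open>wedge a t\<close> = k modulo p^2 form the coset through
  \<open>smul k y\<close> for a dual vector \<open>y\<close>. This translates between residues,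
  which index the counts in the exponential sum criterion, and base points.\<close>

lemma fourier_zero_iff_z2:
  assumes A: "finite A" and t: "prim t"
  shows "fourier A t = 0 \<longleftrightarrow> z2 A t"
proof -
  obtain y where y: "P ^ 2 dvd wedge y t - 1" using dual_vector_exists[OF t] by blast
  have "fourier A t = 0 \<longleftrightarrow> (\<forall>k l. P ^ 1 dvd k - l \<longrightarrow>
      card {a\<in>A. P ^ Suc 1 dvd wedge a t - k} = card {a\<in>A. P ^ Suc 1 dvd wedge a t - l})"
    using vanishing_exponential_sum_iff[OF prime_p A, of "\<lambda>a. wedge a t" 1]
    by (simp add: fourier_def numeral_2_eq_2)
  also have "\<dots> \<longleftrightarrow> (\<forall>k l. P dvd k - l \<longrightarrow>
      card {a\<in>A. P\<^sup>2 dvd wedge a t - k} = card {a\<in>A. P\<^sup>2 dvd wedge a t - l})"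
    by (simp add: numeral_2_eq_2)
  also have "\<dots> \<longleftrightarrow> z2 A t"
  proof
    assume L: "\<forall>k l. P dvd k - l \<longrightarrow>
      card {a\<in>A. P\<^sup>2 dvd wedge a t - k} = card {a\<in>A. P\<^sup>2 dvd wedge a t - l}"
    show "z2 A t" unfolding z2_def coset_card_def
    proof (intro allI impI)
      fix c c' assume "dvd_pair P (c - c')"
      then have "P dvd wedge c t - wedge c' t" using dvd_wedge_left by (simp add: wedge_linear flip: wedge_diff_left)
      then show "card {a\<in>A. P\<^sup>2 dvd wedge (a - c) t} = card {a\<in>A. P\<^sup>2 dvd wedge (a - c') t}"
        using L by (simp add: wedge_linear)
    qed
  next
    assume R: "z2 A t"
    have eq: "P\<^sup>2 dvd x - k \<longleftrightarrow> P\<^sup>2 dvd x - k * wedge y t" for x k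
    proof -
      have "x - k * wedge y t = (x - k) - k * (wedge y t - 1)" by (simp add: algebra_simps)
      then show ?thesis using y by (metis dvd_add_left_iff dvd_mult diff_conv_add_uminus dvd_minus_iff)
    qed
    have cc: "card {a\<in>A. P\<^sup>2 dvd wedge a t - k} = coset_card A t (smul k y)" for k
      unfolding coset_card_def wedge_linear by (subst eq) (rule refl)
    show "\<forall>k l. P dvd k - l \<longrightarrow>
      card {a\<in>A. P\<^sup>2 dvd wedge a t - k} = card {a\<in>A. P\<^sup>2 dvd wedge a t - l}"
    proof (intro allI impI)
      fix k l assume "P dvd k - l"
      then have "dvd_pair P (smul k y - smul l y)"
        unfolding smul_simps by (simp add: dvd_pair_def smul_def)
      then show "card {a\<in>A. P\<^sup>2 dvd wedge a t - k} = card {a\<in>A. P\<^sup>2 dvd wedge a t - l}"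
        unfolding cc using R unfolding z2_def by blast
    qed
  qed
  finally show ?thesis .
qed

lemma fourier_zero_iff_z1:
  assumes A: "finite A" and u: "prim u"
  shows "fourier A (smul P u) = 0 \<longleftrightarrow> z1 A u"
proof -
  obtain y where y: "P ^ 1 dvd wedge y u - 1" using dual_vector_exists[OF u] by blast
  have "2 * pi * real_of_int (wedge a (smul P u)) / real (p\<^sup>2) = 2 * pi * real_of_int (wedge a u) / p" for a
    using p_ge_2 by (simp add: wedge_linear power2_eq_square)
  then have "fourier A (smul P u) = 0 \<longleftrightarrow> (\<forall>k l. P ^ 0 dvd k - l \<longrightarrow>
      card {a\<in>A. P ^ Suc 0 dvd wedge a u - k} = card {a\<in>A. P ^ Suc 0 dvd wedge a u - l})"
    using vanishing_exponential_sum_iff[OF prime_p A, of "\<lambda>a. wedge a u" 0]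
    by (simp add: fourier_def)
  also have "\<dots> \<longleftrightarrow> (\<forall>k l. card {a\<in>A. P dvd wedge a u - k} = card {a\<in>A. P dvd wedge a u - l})"
    by simp
  also have "\<dots> \<longleftrightarrow> z1 A u"
  proof
    assume "\<forall>k l. card {a\<in>A. P dvd wedge a u - k} = card {a\<in>A. P dvd wedge a u - l}"
    then show "z1 A u" unfolding z1_def line_card_def wedge_linear by blast
  next
    assume R: "z1 A u"
    have eq: "P dvd x - k \<longleftrightarrow> P dvd x - k * wedge y u" for x k
    proof -
      have "x - k * wedge y u = (x - k) - k * (wedge y u - 1)" by (simp add: algebra_simps)
      then show ?thesis using y by (metis dvd_add_left_iff dvd_mult diff_conv_add_uminus dvd_minus_iff power_one_right)
    qed
    have cc: "card {a\<in>A. P dvd wedge a u - k} = line_card A u (smul k y)" for k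
      unfolding line_card_def wedge_linear by (subst eq) (rule refl)
    show "\<forall>k l. card {a\<in>A. P dvd wedge a u - k} = card {a\<in>A. P dvd wedge a u - l}"
      unfolding cc using R unfolding z1_def by blast
  qed
  finally show ?thesis .
qed

end

section \<open>Orthogonal bases of unimodular functions\<close>

text \<open>The rows of a square unimodular matrix are orthogonal only if its columns are. With n =
  \<open>card A\<close>, summing the squared moduli of all column products \<open>K x y\<close>
  gives the same as summing \<open>I s t * I t s\<close>, namely n^3. The diagonal terms contribute
  n^3 already, so all others vanish.\<close>

lemma unimodular_square_dual:
  fixes \<phi> :: "'s \<Rightarrow> 'a \<Rightarrow> complex"
  assumes fin: "finite A" "finite S" and card: "card S = card A"
    and uni: "\<And>s x. \<phi> s x * cnj (\<phi> s x) = 1"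
    and orth: "\<And>s t. s \<in> S \<Longrightarrow> t \<in> S \<Longrightarrow> s \<noteq> t \<Longrightarrow> (\<Sum>x\<in>A. \<phi> s x * cnj (\<phi> t x)) = 0"
    and xy: "x \<in> A" "y \<in> A" "x \<noteq> y"
  shows "(\<Sum>s\<in>S. \<phi> s x * cnj (\<phi> s y)) = 0"
proof -
  define K where "K x y = (\<Sum>s\<in>S. \<phi> s x * cnj (\<phi> s y))" for x y
  define I where "I s t = (\<Sum>x\<in>A. \<phi> s x * cnj (\<phi> t x))" for s t
  let ?n = "of_nat (card A) :: complex"
  have II: "I s t * I t s = (if s = t then ?n * ?n else 0)" if "s \<in> S" "t \<in> S" for s t
    using that orth[of s t] by (simp add: I_def uni)
  have "K x y * cnj (K x y) = (\<Sum>s\<in>S. \<Sum>t\<in>S. (\<phi> s x * cnj (\<phi> t x)) * (\<phi> t y * cnj (\<phi> s y)))" for x y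
    unfolding K_def cnj_sum sum_product by (intro sum.cong refl) (simp add: algebra_simps)
  then have "(\<Sum>x\<in>A. \<Sum>y\<in>A. K x y * cnj (K x y)) =
      (\<Sum>x\<in>A. \<Sum>y\<in>A. \<Sum>s\<in>S. \<Sum>t\<in>S. (\<phi> s x * cnj (\<phi> t x)) * (\<phi> t y * cnj (\<phi> s y)))"
    by simp
  also have "\<dots> = (\<Sum>x\<in>A. \<Sum>s\<in>S. \<Sum>t\<in>S. \<Sum>y\<in>A. (\<phi> s x * cnj (\<phi> t x)) * (\<phi> t y * cnj (\<phi> s y)))"
    by (subst sum.swap, subst (2) sum.swap) (rule refl)
  also have "\<dots> = (\<Sum>s\<in>S. \<Sum>t\<in>S. \<Sum>x\<in>A. \<Sum>y\<in>A. (\<phi> s x * cnj (\<phi> t x)) * (\<phi> t y * cnj (\<phi> s y)))"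
    by (subst sum.swap, subst (2) sum.swap) (rule refl)
  also have "\<dots> = (\<Sum>s\<in>S. \<Sum>t\<in>S. I s t * I t s)"
    unfolding I_def sum_product ..
  also have "\<dots> = (\<Sum>s\<in>S. \<Sum>t\<in>S. if s = t then ?n * ?n else 0)"
    by (intro sum.cong refl II)
  also have "\<dots> = ?n * (?n * ?n)" using fin by (simp add: card)
  finally have "(\<Sum>x\<in>A. \<Sum>y\<in>A. K x y * cnj (K x y)) = ?n * (?n * ?n)" .
  moreover have "(\<Sum>y\<in>A. K x y * cnj (K x y)) = ?n * ?n + (\<Sum>y\<in>A - {x}. K x y * cnj (K x y))"
    if "x \<in> A" for x
    using sum.remove[OF fin(1) that, of "\<lambda>y. K x y * cnj (K x y)"]
    by (simp add: K_def uni card)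
  then have "(\<Sum>x\<in>A. \<Sum>y\<in>A. K x y * cnj (K x y)) =
      (\<Sum>x\<in>A. ?n * ?n + (\<Sum>y\<in>A - {x}. K x y * cnj (K x y)))"
    by (intro sum.cong refl)
  ultimately have "(\<Sum>x\<in>A. \<Sum>y\<in>A - {x}. K x y * cnj (K x y)) = 0"
    by (simp add: sum.distrib)
  moreover have "K x y * cnj (K x y) = of_real ((cmod (K x y))\<^sup>2)" for x y
    by (rule complex_norm_square[symmetric])
  ultimately have "of_real (\<Sum>x\<in>A. \<Sum>y\<in>A - {x}. (cmod (K x y))\<^sup>2) = (0 :: complex)"
    by (simp only: of_real_sum)
  then have "(\<Sum>x\<in>A. \<Sum>y\<in>A - {x}. (cmod (K x y))\<^sup>2) = 0"
    by (simp only: of_real_eq_0_iff)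
  then have "\<forall>x\<in>A. \<forall>y\<in>A - {x}. (cmod (K x y))\<^sup>2 = 0"
    using fin by (simp add: sum_nonneg_eq_0_iff sum_nonneg)
  with xy show ?thesis by (simp add: K_def)
qed

text \<open>No dimension theory is involved. Orthogonality determines the coefficients of the
  indicator function of a point \<open>y\<close>, and evaluating its expansion at \<open>y\<close>
  gives \<open>card S\<close> / \<open>card A\<close> = 1. For the converse, orthogonality of the
  columns is the inversion formula.\<close>

lemma l2_orthogonal_basis_unimodular_iff:
  fixes \<phi> :: "'s \<Rightarrow> 'a \<Rightarrow> complex"
  assumes fin: "finite A" "finite S" and ne: "A \<noteq> {}"
    and uni: "\<And>s x. \<phi> s x * cnj (\<phi> s x) = 1"
  shows "l2_orthogonal_basis A S \<phi> \<longleftrightarrow>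
    card S = card A \<and> (\<forall>s\<in>S. \<forall>t\<in>S. s \<noteq> t \<longrightarrow> l2_inner A (\<phi> s) (\<phi> t) = 0)"
proof -
  let ?n = "of_nat (card A) :: complex"
  have n: "?n \<noteq> 0" using fin ne by simp
  have coeff: "c t = (\<Sum>x\<in>A. f x * cnj (\<phi> t x)) / ?n"
    if orth: "\<And>s t. s \<in> S \<Longrightarrow> t \<in> S \<Longrightarrow> s \<noteq> t \<Longrightarrow> (\<Sum>x\<in>A. \<phi> s x * cnj (\<phi> t x)) = 0"
      and f: "\<And>x. x \<in> A \<Longrightarrow> f x = (\<Sum>s\<in>S. c s * \<phi> s x)" and t: "t \<in> S" for c f t
  proof -
    have "(\<Sum>x\<in>A. f x * cnj (\<phi> t x)) = (\<Sum>x\<in>A. \<Sum>s\<in>S. c s * (\<phi> s x * cnj (\<phi> t x)))"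
      by (intro sum.cong refl) (simp add: f sum_distrib_right mult.assoc)
    also have "\<dots> = (\<Sum>s\<in>S. c s * (\<Sum>x\<in>A. \<phi> s x * cnj (\<phi> t x)))"
      by (subst sum.swap) (simp add: sum_distrib_left)
    also have "\<dots> = (\<Sum>s\<in>S. if s = t then c t * ?n else 0)"
      using orth t by (intro sum.cong refl) (auto simp: uni)
    also have "\<dots> = c t * ?n" using fin t by simp
    finally show ?thesis using n by simp
  qed
  show ?thesis
  proof (intro iffI conjI)
    assume B: "l2_orthogonal_basis A S \<phi>"
    then show "\<forall>s\<in>S. \<forall>t\<in>S. s \<noteq> t \<longrightarrow> l2_inner A (\<phi> s) (\<phi> t) = 0"
      by (simp add: l2_orthogonal_basis_def)
    obtain y where y: "y \<in> A" using ne by blast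
    define \<delta> :: "'a \<Rightarrow> complex" where "\<delta> x = (if x = y then 1 else 0)" for x
    from B have "\<exists>!c. c \<in> extensional S \<and> (\<forall>x\<in>A. \<delta> x = (\<Sum>s\<in>S. c s * \<phi> s x))"
      unfolding l2_orthogonal_basis_def l2_basis_def by blast
    then obtain c where c: "\<And>x. x \<in> A \<Longrightarrow> \<delta> x = (\<Sum>s\<in>S. c s * \<phi> s x)"
      by blast
    have "c t = cnj (\<phi> t y) / ?n" if "t \<in> S" for t
    proof -
      have "c t = (\<Sum>x\<in>A. \<delta> x * cnj (\<phi> t x)) / ?n"
        by (rule coeff[OF _ c that]) (use B in \<open>auto simp: l2_orthogonal_basis_def l2_inner_def\<close>)
      also have "(\<Sum>x\<in>A. \<delta> x * cnj (\<phi> t x)) = (\<Sum>x\<in>A. if x = y then cnj (\<phi> t y) else 0)"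
        by (intro sum.cong refl) (simp add: \<delta>_def)
      finally show ?thesis using fin y by simp
    qed
    then have "(\<Sum>s\<in>S. c s * \<phi> s y) = (\<Sum>s\<in>S. 1 / ?n)"
      using uni by (intro sum.cong refl) (simp add: mult.commute)
    then have "1 = of_nat (card S) / ?n" using c[OF y] by (simp add: \<delta>_def)
    then have "of_nat (card S) = ?n" using n by (simp add: field_simps)
    then show "card S = card A" by (simp only: of_nat_eq_iff)
  next
    assume R: "card S = card A \<and> (\<forall>s\<in>S. \<forall>t\<in>S. s \<noteq> t \<longrightarrow> l2_inner A (\<phi> s) (\<phi> t) = 0)"
    then have orth: "\<And>s t. s \<in> S \<Longrightarrow> t \<in> S \<Longrightarrow> s \<noteq> t \<Longrightarrow> (\<Sum>x\<in>A. \<phi> s x * cnj (\<phi> t x)) = 0"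
      by (simp add: l2_inner_def)
    have dual: "(\<Sum>s\<in>S. \<phi> s x * cnj (\<phi> s y)) = (if x = y then ?n else 0)"
      if "x \<in> A" "y \<in> A" for x y
      using unimodular_square_dual[OF fin _ uni orth that] R by (simp add: uni)
    show "l2_orthogonal_basis A S \<phi>"
      unfolding l2_orthogonal_basis_def l2_basis_def
    proof (intro conjI allI)
      show "\<forall>s\<in>S. \<forall>t\<in>S. s \<noteq> t \<longrightarrow> l2_inner A (\<phi> s) (\<phi> t) = 0" using R by blast
      fix f :: "'a \<Rightarrow> complex"
      define c where "c = restrict (\<lambda>s. (\<Sum>y\<in>A. f y * cnj (\<phi> s y)) / ?n) S"
      show "\<exists>!c. c \<in> extensional S \<and> (\<forall>x\<in>A. f x = (\<Sum>s\<in>S. c s * \<phi> s x))"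
      proof (rule ex1I[of _ c])
        have "f x = (\<Sum>s\<in>S. c s * \<phi> s x)" if x: "x \<in> A" for x
        proof -
          have "(\<Sum>s\<in>S. c s * \<phi> s x) = (\<Sum>s\<in>S. \<Sum>y\<in>A. f y / ?n * (\<phi> s x * cnj (\<phi> s y)))"
            by (intro sum.cong refl)
              (simp add: c_def sum_distrib_left sum_distrib_right sum_divide_distrib algebra_simps)
          also have "\<dots> = (\<Sum>y\<in>A. f y / ?n * (\<Sum>s\<in>S. \<phi> s x * cnj (\<phi> s y)))"
            by (subst sum.swap) (simp add: sum_distrib_left)
          also have "\<dots> = (\<Sum>y\<in>A. if x = y then f x else 0)"
            using dual[OF x] n by (intro sum.cong refl) auto
          also have "\<dots> = f x" using fin x by simp
          finally show ?thesis by simp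
        qed
        then show "c \<in> extensional S \<and> (\<forall>x\<in>A. f x = (\<Sum>s\<in>S. c s * \<phi> s x))"
          by (simp add: c_def)
      next
        fix c' assume c': "c' \<in> extensional S \<and> (\<forall>x\<in>A. f x = (\<Sum>s\<in>S. c' s * \<phi> s x))"
        show "c' = c"
        proof (rule extensionalityI[of _ S])
          fix s assume s: "s \<in> S"
          show "c' s = c s"
            using coeff[OF orth _ s, of f c'] c' s by (simp add: c_def)
        qed (use c' in \<open>auto simp: c_def\<close>)
      qed
    qed
  qed
qed

section \<open>Spectral sets and tiles in terms of the symplectic Fourier transform\<close>

context prime_square
begin

definition chr :: "int \<times> int \<Rightarrow> int \<times> int \<Rightarrow> complex" where
  "chr a s = cis (2 * pi * wedge a s / real (p\<^sup>2))"

lemma fourier_chr: "fourier A s = (\<Sum>a\<in>A. chr a s)"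
  by (simp add: fourier_def chr_def)

lemma chr_add: "chr (a + b) s = chr a s * chr b s"
  by (simp add: chr_def wedge_linear cis_mult ring_distribs add_divide_distrib)

lemma chr_diff_right: "chr a (s - t) = chr a s * cnj (chr a t)"
  by (simp add: chr_def wedge_linear cis_mult cis_cnj ring_distribs diff_divide_distrib)

lemma chr_unimodular: "chr a s * cnj (chr a s) = 1"
  using chr_diff_right[of a s s] by (simp add: chr_def wedge_def)

lemma chr_eqI:
  assumes "P\<^sup>2 dvd wedge a s - wedge b t"
  shows "chr a s = chr b t"
proof -
  obtain k where k: "wedge a s - wedge b t = P\<^sup>2 * k" using assms by (elim dvdE)
  then have "wedge a s = wedge b t + P\<^sup>2 * k" by simp
  then have "2 * pi * wedge a s / real (p\<^sup>2) = 2 * pi * wedge b t / real (p\<^sup>2) + 2 * pi * of_int k"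
    using p_ge_2 by (simp add: field_simps)
  then have "chr a s = chr b t * cis (2 * pi * of_int k)"
    by (simp only: chr_def cis_mult)
  also have "cis (2 * pi * of_int k) = 1" by (intro cis_multiple_2pi) simp
  finally show ?thesis by simp
qed

lemma wedge_diff_cong_left: "dvd_pair m (a - b) \<Longrightarrow> m dvd wedge a s - wedge b s"
  using dvd_wedge_left[of m "a - b" s] by (simp add: wedge_linear)

lemma wedge_diff_cong_right: "dvd_pair m (a - b) \<Longrightarrow> m dvd wedge s a - wedge s b"
  using wedge_diff_cong_left[of m a b s] by (simp add: wedge_minus[of s] dvd_diff_commute)

lemma fourier_cong: "dvd_pair (P\<^sup>2) (s - t) \<Longrightarrow> fourier A s = fourier A t"
  unfolding fourier_chr by (intro sum.cong refl chr_eqI wedge_diff_cong_right)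

lemma fourier_zero: "fourier A 0 = of_nat (card A)"
  by (simp add: fourier_def wedge_def)

definition grid :: "(int \<times> int) set" where
  "grid = {0..<P\<^sup>2} \<times> {0..<P\<^sup>2}"

lemma carrier_grid: "carrier (Zn_sq (p\<^sup>2)) = grid"
  using p_ge_2 by (simp add: carrier_integer_mod_group grid_def)

lemma finite_grid: "finite grid" by (simp add: grid_def)

lemma card_grid: "card grid = p ^ 4"
  by (simp add: grid_def card_cartesian_product nat_power_eq flip: power_add)

lemma reduced_grid:
  assumes "A \<subseteq> grid" shows "reduced A"
proof -
  have "x = y" if "x \<in> {0..<P\<^sup>2}" "y \<in> {0..<P\<^sup>2}" "P\<^sup>2 dvd x - y" for x y
    using that by (metis atLeastLessThan_iff mod_eq_dvd_iff mod_pos_pos_trivial)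
  then show ?thesis
    using assms finite_subset[OF assms finite_grid]
    by (auto simp: reduced_def dvd_pair_def grid_def prod_eq_iff subset_iff)
qed

definition red :: "int \<times> int \<Rightarrow> int \<times> int" where
  "red a = (fst a mod P\<^sup>2, snd a mod P\<^sup>2)"

lemma red_grid: "red a \<in> grid"
  using P_pos by (simp add: red_def grid_def)

lemma red_eq_iff: "red a = red b \<longleftrightarrow> dvd_pair (P\<^sup>2) (a - b)"
  by (simp add: red_def dvd_pair_def mod_eq_dvd_iff)

lemma dvd_pair_red: "dvd_pair (P\<^sup>2) (red a - a)"
  using red_eq_iff[of "red a" a] by (simp add: red_def)

lemma mult_Zn_sq: "a \<otimes>\<^bsub>Zn_sq (p\<^sup>2)\<^esub> b = red (a + b)"
  by (cases a; cases b) (simp add: red_def)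

text \<open>A quarter turn of the frequency turns the bilinear pairing into the symplectic form. It
  permutes the candidate spectra and so does not affect spectrality.\<close>

lemma exp_char_chr: "exp_char (p\<^sup>2) s x = chr x (- snd s, fst s)"
proof -
  have "exp_char (p\<^sup>2) s x = cis (2 * pi * pairing (p\<^sup>2) x s / real (p\<^sup>2))"
    by (simp add: exp_char_def cis_conv_exp algebra_simps)
  also have "\<dots> = chr (pairing (p\<^sup>2) x s, 0) (0, 1)" by (simp add: chr_def wedge_def)
  also have "\<dots> = chr x (- snd s, fst s)"
    by (rule chr_eqI) (simp add: wedge_def pairing_def mod_eq_dvd_iff[symmetric])
  finally show ?thesis .
qed

text \<open>The right-hand side allows any integer pairs in \<open>S\<close>. It speaks only of
  differences, on which the transform depends modulo p^2.\<close>

lemma spectral_iff: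
  assumes A: "A \<subseteq> grid" "A \<noteq> {}"
  shows "spectral (p\<^sup>2) A \<longleftrightarrow>
    (\<exists>S. finite S \<and> card S = card A \<and> (\<forall>s\<in>S. \<forall>t\<in>S. s \<noteq> t \<longrightarrow> fourier A (s - t) = 0))"
proof -
  have finA: "finite A" using A finite_grid finite_subset by blast
  have inner: "l2_inner A (exp_char (p\<^sup>2) s) (exp_char (p\<^sup>2) t) =
      fourier A ((- snd s, fst s) - (- snd t, fst t))" for s t
    by (simp only: l2_inner_def exp_char_chr fourier_chr chr_diff_right)
  have "spectral (p\<^sup>2) A \<longleftrightarrow> (\<exists>S\<subseteq>grid. l2_orthogonal_basis A S (exp_char (p\<^sup>2)))"
    using A unfolding spectral_def carrier_grid by blast
  also have "\<dots> \<longleftrightarrow> (\<exists>S\<subseteq>grid. card S = card A \<and>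
      (\<forall>s\<in>S. \<forall>t\<in>S. s \<noteq> t \<longrightarrow> fourier A ((- snd s, fst s) - (- snd t, fst t)) = 0))"
  proof (intro ex_cong1 conj_cong refl)
    fix S assume "S \<subseteq> grid"
    then have "finite S" using finite_grid finite_subset by blast
    then show "l2_orthogonal_basis A S (exp_char (p\<^sup>2)) \<longleftrightarrow> card S = card A \<and>
        (\<forall>s\<in>S. \<forall>t\<in>S. s \<noteq> t \<longrightarrow> fourier A ((- snd s, fst s) - (- snd t, fst t)) = 0)"
      by (subst l2_orthogonal_basis_unimodular_iff[OF finA _ A(2)])
        (simp_all add: inner exp_char_chr chr_unimodular)
  qed
  also have "\<dots> \<longleftrightarrow>
    (\<exists>S. finite S \<and> card S = card A \<and> (\<forall>s\<in>S. \<forall>t\<in>S. s \<noteq> t \<longrightarrow> fourier A (s - t) = 0))"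
    (is "?L \<longleftrightarrow> ?R")
  proof
    assume ?L
    then obtain S where S: "S \<subseteq> grid" "card S = card A"
      "\<forall>s\<in>S. \<forall>t\<in>S. s \<noteq> t \<longrightarrow> fourier A ((- snd s, fst s) - (- snd t, fst t)) = 0" by blast
    have "inj_on (\<lambda>s. (- snd s, fst s)) S" by (auto simp: inj_on_def prod_eq_iff)
    then have "card ((\<lambda>s. (- snd s, fst s)) ` S) = card A" using S by (simp add: card_image)
    moreover have "finite S" using S finite_grid finite_subset by blast
    ultimately show ?R using S by (intro exI[of _ "(\<lambda>s. (- snd s, fst s)) ` S"]) auto
  next
    assume ?R
    then obtain S where S: "finite S" "card S = card A"
      "\<And>s t. s \<in> S \<Longrightarrow> t \<in> S \<Longrightarrow> s \<noteq> t \<Longrightarrow> fourier A (s - t) = 0" by blast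
    define r where "r s = red (snd s, - fst s)" for s
    have r: "dvd_pair (P\<^sup>2) ((- snd (r s), fst (r s)) - s)" for s
      using dvd_pair_red[of "(snd s, - fst s)"] unfolding r_def dvd_pair_def
      by (simp add: dvd_diff_commute) (metis add.commute diff_minus_eq_add dvd_minus_iff minus_diff_eq)
    have f: "fourier A ((- snd (r s), fst (r s)) - (- snd (r t), fst (r t))) = fourier A (s - t)" for s t
    proof (rule fourier_cong)
      have "(- snd (r s), fst (r s)) - (- snd (r t), fst (r t)) - (s - t) =
          ((- snd (r s), fst (r s)) - s) - ((- snd (r t), fst (r t)) - t)" by simp
      then show "dvd_pair (P\<^sup>2) ((- snd (r s), fst (r s)) - (- snd (r t), fst (r t)) - (s - t))"
        using r[of s] r[of t] unfolding dvd_pair_def by (metis dvd_diff fst_diff snd_diff)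
    qed
    \<comment> \<open>Elements with equal reductions would make the transform vanish at 0, where its
      value is the size of the nonempty set \<open>A\<close>.\<close>
    have inj: "inj_on r S"
    proof (rule inj_onI, rule ccontr)
      fix s t assume st: "s \<in> S" "t \<in> S" "r s = r t" "s \<noteq> t"
      then have "fourier A (s - t) = fourier A 0" using f[of s t] by (simp add: zero_prod_def)
      with S(3)[OF st(1,2,4)] show False using A finA by (simp add: fourier_zero)
    qed
    show ?L
    proof (intro exI[of _ "r ` S"] conjI ballI impI)
      show "r ` S \<subseteq> grid" unfolding r_def using red_grid by blast
      show "card (r ` S) = card A" using S inj by (simp add: card_image)
      fix s t assume "s \<in> r ` S" "t \<in> r ` S" "s \<noteq> t"
      then show "fourier A ((- snd s, fst s) - (- snd t, fst t)) = 0"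
        using f S(3) by fastforce
    qed
  qed
  finally show ?thesis .
qed

lemma fourier_dual:
  assumes "finite A" "finite S" "card S = card A"
    and "\<And>s t. s \<in> S \<Longrightarrow> t \<in> S \<Longrightarrow> s \<noteq> t \<Longrightarrow> fourier A (s - t) = 0"
    and "a \<in> A" "b \<in> A" "a \<noteq> b"
  shows "fourier S (a - b) = 0"
proof -
  have "(\<Sum>s\<in>S. chr a s * cnj (chr b s)) = 0"
    by (rule unimodular_square_dual[OF assms(1-3)])
      (use assms(4-) in \<open>simp_all add: chr_unimodular fourier_chr chr_diff_right\<close>)
  moreover have "chr a s * cnj (chr b s) = cnj (chr s (a - b))" for s
    by (simp add: chr_def wedge_linear cis_mult cis_cnj wedge_minus[of s] diff_divide_distrib ring_distribs)
  ultimately have "cnj (fourier S (a - b)) = 0" by (simp add: fourier_chr)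
  then show ?thesis by simp
qed

lemma fourier_grid:
  assumes "\<not> dvd_pair (P\<^sup>2) s"
  shows "fourier grid s = 0"
proof -
  define g where "g k = (\<Sum>x\<in>{0..<P\<^sup>2}. cis (2 * pi * (x * k) / real (p\<^sup>2)))" for k :: int
  have g0: "g k = 0" if "\<not> P\<^sup>2 dvd k" for k
  proof -
    define z where "z = cis (2 * pi * k / real (p\<^sup>2))"
    have "g k = (\<Sum>x<p\<^sup>2. z ^ x)"
      unfolding g_def
      by (rule sum.reindex_bij_witness[of _ int nat])
        (auto simp: z_def DeMoivre nat_less_iff algebra_simps)
    moreover have "z ^ p\<^sup>2 = 1"
    proof -
      have "z ^ p\<^sup>2 = cis (2 * pi * of_int k)" using p_ge_2 by (simp add: z_def DeMoivre)
      then show ?thesis using cis_multiple_2pi[of "of_int k"] by simp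
    qed
    moreover have "z \<noteq> 1"
    proof
      assume "z = 1"
      then have "cos (2 * pi * k / real (p\<^sup>2)) = 1" unfolding z_def by (metis cis.sel(1) one_complex.sel(1))
      then obtain j :: int where "2 * pi * k / real (p\<^sup>2) = j * 2 * pi" by (auto simp: cos_one_2pi_int)
      then have "2 * pi * real_of_int k = 2 * pi * real_of_int (j * P\<^sup>2)" using p_ge_2 by (simp add: field_simps)
      then have "real_of_int k = real_of_int (j * P\<^sup>2)" by (subst (asm) mult_cancel_left) simp
      then have "k = j * P\<^sup>2" by (simp only: of_int_eq_iff)
      with that show False by simp
    qed
    ultimately show ?thesis using power_diff_1_eq[of z "p\<^sup>2"] by simp
  qed
  have "fourier grid s = (\<Sum>x\<in>{0..<P\<^sup>2}. \<Sum>y\<in>{0..<P\<^sup>2}.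
      cis (2 * pi * (x * snd s) / real (p\<^sup>2)) * cis (2 * pi * (y * - fst s) / real (p\<^sup>2)))"
    unfolding fourier_def grid_def sum.cartesian_product
    by (intro sum.cong refl) (auto simp: wedge_def cis_mult ring_distribs diff_divide_distrib)
  also have "\<dots> = g (snd s) * g (- fst s)" by (simp add: g_def sum_product)
  also have "\<dots> = 0" using assms g0 by (auto simp: dvd_pair_def)
  finally show ?thesis .
qed

text \<open>The product of the two transforms is the transform of the whole group, which vanishes
  off zero.\<close>

lemma tile_fourier:
  assumes A: "A \<subseteq> grid" and "tile (Zn_sq (p\<^sup>2)) A"
  obtains B where "B \<subseteq> grid" "card A * card B = p ^ 4"
    "\<And>s. \<not> dvd_pair (P\<^sup>2) s \<Longrightarrow> fourier A s = 0 \<or> fourier B s = 0"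
proof -
  obtain B where "tiling_pair (Zn_sq (p\<^sup>2)) A B" using assms(2) by (auto simp: tile_def)
  then have AB: "A \<subseteq> grid \<and> B \<subseteq> grid \<and>
      (\<forall>g\<in>grid. \<exists>!ab. ab \<in> A \<times> B \<and> g = red (fst ab + snd ab))"
    unfolding tiling_pair_def carrier_grid mult_Zn_sq .
  then have B: "B \<subseteq> grid"
    "\<And>g. g \<in> grid \<Longrightarrow> \<exists>!ab. ab \<in> A \<times> B \<and> g = red (fst ab + snd ab)"
    using AB[THEN conjunct2, THEN conjunct1] bspec[OF AB[THEN conjunct2, THEN conjunct2]]
    by - assumption+
  have bij: "bij_betw (\<lambda>ab. red (fst ab + snd ab)) (A \<times> B) grid"
    unfolding bij_betw_def
  proof
    show "inj_on (\<lambda>ab. red (fst ab + snd ab)) (A \<times> B)"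
    proof (rule inj_onI)
      fix u v assume uv: "u \<in> A \<times> B" "v \<in> A \<times> B" "red (fst u + snd u) = red (fst v + snd v)"
      from B(2)[OF red_grid, of "fst u + snd u"] show "u = v"
        by (elim ex1E) (metis uv)
    qed
    show "(\<lambda>ab. red (fst ab + snd ab)) ` (A \<times> B) = grid"
    proof (intro equalityI subsetI)
      fix g assume "g \<in> grid"
      from B(2)[OF this] show "g \<in> (\<lambda>ab. red (fst ab + snd ab)) ` (A \<times> B)"
        by (elim ex1E) blast
    qed (use red_grid in blast)
  qed
  show thesis
  proof (rule that)
    show "card A * card B = p ^ 4"
      using bij_betw_same_card[OF bij] by (simp add: card_cartesian_product card_grid)
    fix s assume s: "\<not> dvd_pair (P\<^sup>2) s"
    have "fourier A s * fourier B s = (\<Sum>ab\<in>A \<times> B. chr (fst ab) s * chr (snd ab) s)"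
      by (simp add: fourier_chr sum_product sum.cartesian_product case_prod_unfold)
    also have "\<dots> = (\<Sum>ab\<in>A \<times> B. chr (red (fst ab + snd ab)) s)"
      by (intro sum.cong refl, subst chr_add[symmetric], rule chr_eqI)
        (metis dvd_pair_red wedge_diff_cong_left dvd_diff_commute)
    also have "\<dots> = fourier grid s"
      unfolding fourier_chr by (rule sum.reindex_bij_betw[OF bij])
    also have "\<dots> = 0" by (rule fourier_grid[OF s])
    finally show "fourier A s = 0 \<or> fourier B s = 0" by simp
  qed (fact B(1))
qed

text \<open>By the sizes, injectivity of the sum map already makes it a bijection onto the group.
  The complement is parametrised by \<open>g\<close> on \<open>X\<close>, and its values are reduced
  only here.\<close>

lemma tileI:
  assumes A: "A \<subseteq> grid" and X: "finite X" "card A * card X = p ^ 4"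
    and inj: "\<And>a b x y. a \<in> A \<Longrightarrow> b \<in> A \<Longrightarrow> x \<in> X \<Longrightarrow> y \<in> X \<Longrightarrow>
      dvd_pair (P\<^sup>2) ((a - b) + (g x - g y)) \<Longrightarrow> a = b \<and> x = y"
  shows "tile (Zn_sq (p\<^sup>2)) A"
proof -
  define h where "h = (\<lambda>ax. red (fst ax + g (snd ax)))"
  have "inj_on h (A \<times> X)"
  proof (rule inj_onI)
    fix u v assume uv: "u \<in> A \<times> X" "v \<in> A \<times> X" "h u = h v"
    have "fst u + g (snd u) - (fst v + g (snd v)) = (fst u - fst v) + (g (snd u) - g (snd v))"
      by simp
    then have "dvd_pair (P\<^sup>2) ((fst u - fst v) + (g (snd u) - g (snd v)))"
      using uv(3) unfolding h_def red_eq_iff by metis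
    then show "u = v" using inj[of "fst u" "fst v" "snd u" "snd v"] uv by (auto simp: prod_eq_iff)
  qed
  moreover have "h ` (A \<times> X) \<subseteq> grid" unfolding h_def using red_grid by blast
  ultimately have im: "h ` (A \<times> X) = grid"
    by (intro card_subset_eq finite_grid) (simp_all add: card_image card_cartesian_product X card_grid)
  define B where "B = (\<lambda>x. red (g x)) ` X"
  have h: "h (a, x) = red (a + red (g x))" for a x
    unfolding h_def by (simp add: red_def mod_add_right_eq)
  have "tiling_pair (Zn_sq (p\<^sup>2)) A B"
    unfolding tiling_pair_def carrier_grid mult_Zn_sq
  proof (intro conjI ballI A)
    show "B \<subseteq> grid" unfolding B_def using red_grid by blast
    fix k assume "k \<in> grid"
    then have "k \<in> h ` (A \<times> X)" by (simp only: im)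
    then obtain a x where ax: "a \<in> A" "x \<in> X" "k = h (a, x)" by blast
    show "\<exists>!ab. ab \<in> A \<times> B \<and> k = red (fst ab + snd ab)"
    proof (rule ex1I[of _ "(a, red (g x))"])
      show "(a, red (g x)) \<in> A \<times> B \<and> k = red (fst (a, red (g x)) + snd (a, red (g x)))"
        using ax unfolding B_def h by simp
      fix ab assume ab: "ab \<in> A \<times> B \<and> k = red (fst ab + snd ab)"
      then obtain b y where bw: "b \<in> A" "y \<in> X" "ab = (b, red (g y))" by (auto simp: B_def)
      with ab bw have "k = h (b, y)" unfolding h by simp
      with ax bw have "(a, x) = (b, y)"
        using \<open>inj_on h (A \<times> X)\<close> by (auto dest!: inj_onD)
      with bw show "ab = (a, red (g x))" by simp
    qed
  qed
  then show ?thesis by (auto simp: tile_def)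
qed

end

section \<open>Counting in lines, cosets and residue classes\<close>

lemma card_indicator: "finite A \<Longrightarrow> card {a\<in>A. R a} = (\<Sum>a\<in>A. if R a then 1 else 0)"
  by (simp add: sum.If_cases Int_def)

lemma sum_card_swap:
  assumes "finite A" "finite D"
  shows "(\<Sum>d\<in>D. card {a\<in>A. Q d a}) = (\<Sum>a\<in>A. card {d\<in>D. Q d a})"
  unfolding card_indicator[OF assms(1)] card_indicator[OF assms(2)] by (rule sum.swap)

text \<open>By assumption \<open>g\<close> factors through \<open>f\<close>, which induces a
  surjection from the values of \<open>f\<close> onto those of \<open>g\<close>. The cardinalities
  make this surjection injective, so \<open>f\<close> factors through \<open>g\<close> as
  well.\<close>

lemma image_card_le_imp_fiber:
  assumes "finite L" "card (f ` L) \<le> card (g ` L)"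
    and fg: "\<And>x y. x \<in> L \<Longrightarrow> y \<in> L \<Longrightarrow> f x = f y \<Longrightarrow> g x = g y"
    and xy: "x \<in> L" "y \<in> L" "g x = g y"
  shows "f x = f y"
proof -
  define h where "h z = g (SOME x. x \<in> L \<and> f x = z)" for z
  have h: "h (f x) = g x" if "x \<in> L" for x
  proof -
    have "(SOME y. y \<in> L \<and> f y = f x) \<in> L \<and> f (SOME y. y \<in> L \<and> f y = f x) = f x"
      by (rule someI[of _ x]) (use that in simp)
    then show ?thesis unfolding h_def using fg that by blast
  qed
  then have "h ` f ` L = g ` L" by (auto simp: image_image intro!: image_cong)
  then have "card (h ` (f ` L)) = card (f ` L)"
    using assms(1,2) card_image_le[of "f ` L" h] by simp
  then have "inj_on h (f ` L)" using assms(1) by (intro eq_card_imp_inj_on) auto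
  then show ?thesis using h xy by (metis imageI inj_onD)
qed

context prime_square
begin

lemma card_linear_congruence:
  assumes "\<not> P dvd b"
  shows "card {j\<in>{0..<P}. P dvd k + j * b} = 1"
proof -
  have "coprime b P" using assms prime_imp_coprime[OF P_prime] coprime_commute by blast
  then obtain i l where il: "i * b + l * P = 1"
    using bezout_int[of b P] by (metis coprime_iff_gcd_eq_1)
  define j0 where "j0 = (- k * i) mod P"
  have j0: "P dvd j + k * i \<longleftrightarrow> j = j0" if "j \<in> {0..<P}" for j
    using that mod_eq_dvd_iff[of j P "- k * i"] by (simp add: j0_def)
  have iff: "P dvd k + j * b \<longleftrightarrow> P dvd j + k * i" for j
  proof
    assume "P dvd k + j * b"
    moreover have "j + k * i = i * (k + j * b) + j * (1 - i * b)" by (simp add: algebra_simps)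
    moreover have "1 - i * b = l * P" using il by simp
    ultimately show "P dvd j + k * i" by (metis dvd_add dvd_mult dvd_triv_right)
  next
    assume "P dvd j + k * i"
    moreover have "k + j * b = b * (j + k * i) + k * (1 - i * b)" by (simp add: algebra_simps)
    moreover have "1 - i * b = l * P" using il by simp
    ultimately show "P dvd k + j * b" by (metis dvd_add dvd_mult dvd_triv_right)
  qed
  moreover have "j0 \<in> {0..<P}" using P_pos by (simp add: j0_def)
  ultimately have "{j\<in>{0..<P}. P dvd k + j * b} = {j0}" using j0 iff by auto
  then show ?thesis by simp
qed

text \<open>This is Cramer's rule: the products with \<open>u\<close> and \<open>y\<close> are, up
  to sign, the coordinates of \<open>d\<close> in the basis formed by them.\<close>

lemma dvd_wedge_dual:
  assumes y: "P ^ k dvd wedge y u - 1" and "P ^ k dvd wedge d u" "P ^ k dvd wedge d y"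
  shows "dvd_pair (P ^ k) d"
proof -
  have "fst d = wedge d u * fst y - wedge d y * fst u - fst d * (wedge y u - 1)"
    and "snd d = wedge d u * snd y - wedge d y * snd u - snd d * (wedge y u - 1)"
    by (simp_all add: wedge_def algebra_simps)
  then show ?thesis using assms unfolding dvd_pair_def by (metis dvd_diff dvd_mult dvd_mult2)
qed

lemma not_dvd_one: "P dvd x - 1 \<Longrightarrow> \<not> P dvd x"
  using p_ge_2 dvd_diff[of P x "x - 1"] by auto

lemma line_card_par:
  assumes "prim u" "prim t" "P dvd wedge t u"
  shows "line_card A u c = line_card A t c"
  using wedge_dvd_iff[OF assms(1,2), of 1] assms(3) by (simp add: line_card_def)

lemma z1_par:
  assumes "prim u" "prim t" "P dvd wedge t u"
  shows "z1 A u \<longleftrightarrow> z1 A t"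
  by (simp only: z1_def line_card_par[OF assms])

text \<open>A multiple of \<open>p\<close> loses one factor \<open>p\<close>, so only the direction
  of \<open>u\<close> modulo \<open>p\<close> matters. Hence segments depend on directions and not
  on lifts.\<close>

lemma seg_dvd_par:
  assumes "prim u" "prim t" "P dvd wedge t u" "dvd_pair P d"
  shows "P\<^sup>2 dvd wedge d u \<longleftrightarrow> P\<^sup>2 dvd wedge d t"
proof -
  obtain y where "d = smul P y" using assms(4) by (elim dvd_pairE)
  then show ?thesis using wedge_dvd_iff[OF assms(1,2), of 1 y] assms(3) P_pos
    by (simp add: wedge_linear power2_eq_square)
qed

lemma seg_card_par:
  assumes "prim u" "prim t" "P dvd wedge t u"
  shows "seg_card A u c = seg_card A t c"
proof -
  have "{a\<in>A. dvd_pair P (a - c) \<and> P\<^sup>2 dvd wedge (a - c) u} =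
      {a\<in>A. dvd_pair P (a - c) \<and> P\<^sup>2 dvd wedge (a - c) t}"
    using seg_dvd_par[OF assms] by blast
  then show ?thesis by (simp only: seg_card_def)
qed

lemma z2_par:
  assumes "prim u" "prim t" "P\<^sup>2 dvd wedge t u"
  shows "z2 A u \<longleftrightarrow> z2 A t"
  using wedge_dvd_iff[OF assms(1,2), of 2] assms(3) by (simp add: z2_def coset_card_def)

lemma par_sym: "m dvd wedge t u \<longleftrightarrow> m dvd wedge u t"
  by (simp add: wedge_minus[of t])

lemma line_sum:
  assumes "finite A" and y: "P dvd wedge y u - 1"
  shows "(\<Sum>j\<in>{0..<P}. line_card A u (c + smul j y)) = card A"
proof -
  have "(\<Sum>j\<in>{0..<P}. line_card A u (c + smul j y)) =
      (\<Sum>a\<in>A. card {j\<in>{0..<P}. P dvd wedge (a - (c + smul j y)) u})"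
    unfolding line_card_def by (rule sum_card_swap) (use assms in auto)
  also have "\<dots> = (\<Sum>a\<in>A. 1)"
  proof (rule sum.cong[OF refl])
    fix a
    have "wedge (a - (c + smul j y)) u = wedge (a - c) u + j * - wedge y u" for j
      by (simp add: wedge_linear)
    then show "card {j\<in>{0..<P}. P dvd wedge (a - (c + smul j y)) u} = 1"
      using card_linear_congruence[of "- wedge y u"] not_dvd_one[OF y] by simp
  qed
  finally show ?thesis by simp
qed

lemma z1_line_card:
  assumes "finite A" "prim u" "z1 A u"
  shows "p * line_card A u c = card A"
proof -
  obtain y where y: "P ^ 1 dvd wedge y u - 1" using dual_vector_exists[OF assms(2)] by blast
  have "(\<Sum>j\<in>{0..<P}. line_card A u (c + smul j y)) = (\<Sum>j\<in>{0..<P}. line_card A u c)"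
    using assms(3) unfolding z1_def by (intro sum.cong refl) blast
  then show ?thesis using line_sum[OF assms(1), of y u c] y by simp
qed

text \<open>The line splits into the \<open>p\<close> cosets through c + p j y, where
  \<open>y\<close> is dual to \<open>t\<close>, and these base points are all congruent to
  \<open>c\<close> modulo \<open>p\<close>.\<close>

lemma z2_line_card:
  assumes "finite A" "prim t" "z2 A t"
  shows "line_card A t c = p * coset_card A t c"
proof -
  obtain y where y: "P ^ 1 dvd wedge y t - 1" using dual_vector_exists[OF assms(2)] by blast
  have "p * coset_card A t c = (\<Sum>j\<in>{0..<P}. coset_card A t c)" by simp
  also have "\<dots> = (\<Sum>j\<in>{0..<P}. coset_card A t (c + smul (P * j) y))"
  proof (intro sum.cong refl)
    fix j
    have "dvd_pair P (c - (c + smul (P * j) y))" by (simp add: dvd_pair_def smul_def)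
    then show "coset_card A t c = coset_card A t (c + smul (P * j) y)"
      using assms(3) unfolding z2_def by blast
  qed
  also have "\<dots> = (\<Sum>a\<in>A. card {j\<in>{0..<P}. P\<^sup>2 dvd wedge (a - (c + smul (P * j) y)) t})"
    unfolding coset_card_def by (rule sum_card_swap) (use assms in auto)
  also have "\<dots> = (\<Sum>a\<in>A. if P dvd wedge (a - c) t then 1 else 0)"
  proof (rule sum.cong[OF refl])
    fix a
    have eq: "wedge (a - (c + smul (P * j) y)) t = wedge (a - c) t + P * (j * - wedge y t)" for j
      by (simp add: wedge_linear)
    show "card {j\<in>{0..<P}. P\<^sup>2 dvd wedge (a - (c + smul (P * j) y)) t} =
        (if P dvd wedge (a - c) t then 1 else 0)"
    proof (cases "P dvd wedge (a - c) t")
      case True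
      then obtain k where k: "wedge (a - c) t = P * k" by (elim dvdE)
      have "P\<^sup>2 dvd wedge (a - (c + smul (P * j) y)) t \<longleftrightarrow> P dvd k + j * - wedge y t" for j
        unfolding eq k using P_pos
        by (simp add: power2_eq_square flip: distrib_left right_diff_distrib)
      then show ?thesis
        using True card_linear_congruence[of "- wedge y t" k] not_dvd_one[of "wedge y t"] y by simp
    next
      case False
      have "\<not> P\<^sup>2 dvd wedge (a - (c + smul (P * j) y)) t" for j
      proof
        assume "P\<^sup>2 dvd wedge (a - (c + smul (P * j) y)) t"
        then have "P dvd wedge (a - c) t + P * (j * - wedge y t)"
          unfolding eq using dvd_trans[of P "P\<^sup>2"] by (simp add: power2_eq_square)
        then show False using False by (metis dvd_add_left_iff dvd_triv_left)
      qed
      then show ?thesis using False by simp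
    qed
  qed
  also have "\<dots> = line_card A t c"
    using assms(1) by (simp add: line_card_def sum.If_cases Int_def)
  finally show ?thesis by simp
qed

lemma z2_dvd_card:
  assumes "finite A" "prim t" "z2 A t"
  shows "p dvd card A"
proof -
  obtain y where y: "P ^ 1 dvd wedge y t - 1" using dual_vector_exists[OF assms(2)] by blast
  have "p dvd (\<Sum>j\<in>{0..<P}. line_card A t (0 + smul j y))"
    by (intro dvd_sum) (simp add: z2_line_card[OF assms])
  then show ?thesis using line_sum[OF assms(1), of y t 0] y by simp
qed

text \<open>The vectors \<open>t\<close> run through all lifts of the direction \<open>u\<close>,
  that is, through the generators of all \<open>p\<close> cyclic groups of order p^2 over
  it.\<close>

definition full :: "(int \<times> int) set \<Rightarrow> int \<times> int \<Rightarrow> bool" where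
  "full A u \<longleftrightarrow> (\<forall>t. prim t \<and> P dvd wedge t u \<longrightarrow> z2 A t)"

lemma lift_prim_par:
  assumes "prim u" shows "prim (u + smul (P * j) y)" "P dvd wedge (u + smul (P * j) y) u"
proof -
  show "prim (u + smul (P * j) y)"
    using assms by (simp add: prim_def dvd_pair_def smul_def dvd_add_left_iff)
  show "P dvd wedge (u + smul (P * j) y) u" by (simp add: wedge_linear)
qed

text \<open>Sum the coset counts over the \<open>p\<close> cyclic groups of order \<open>p\<^sup>2\<close> that project to the
  direction \<open>u\<close>: they cover the line of \<open>c\<close> outside the class of \<open>c\<close> exactly once, and all
  contain the group of order \<open>p\<close> generated by \<open>p u\<close>.\<close>

lemma full_class_card:
  assumes "finite A" "prim u" "full A u"
  shows "class_card A c = p * seg_card A u c"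
proof -
  obtain y where "P ^ 1 dvd wedge y u - 1" using dual_vector_exists[OF assms(2)] by blast
  then have y: "P dvd wedge y u - 1" by simp
  define t where "t j = u + smul (P * j) y" for j
  have t: "prim (t j)" "P dvd wedge (t j) u" "z2 A (t j)" for j
    using lift_prim_par[OF assms(2)] assms(3) unfolding t_def full_def by blast+
  have "p * coset_card A (t j) c = line_card A u c" for j
    using z2_line_card[OF assms(1) t(1,3), of j c] line_card_par[OF assms(2) t(1,2), of A c j]
    by simp
  then have "p * (\<Sum>j\<in>{0..<P}. coset_card A (t j) c) = p * line_card A u c"
    by (simp add: sum_distrib_left)
  then have sum1: "(\<Sum>j\<in>{0..<P}. coset_card A (t j) c) = line_card A u c"
    using p_ge_2 by simp
  \<comment> \<open>On the line but outside the class of \<open>c\<close>, a point lies in exactly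
    one of the \<open>p\<close> cosets. Inside the class it lies in all of them or in none,
    according to its segment. The identity records both cases without subtraction.\<close>
  have pw: "card {j\<in>{0..<P}. P\<^sup>2 dvd wedge d (t j)} + (if dvd_pair P d then 1 else 0) =
      p * (if dvd_pair P d \<and> P\<^sup>2 dvd wedge d u then 1 else 0) + (if P dvd wedge d u then 1 else 0)" for d
  proof (cases "P dvd wedge d u")
    case True
    then obtain k where k: "wedge d u = P * k" by (elim dvdE)
    have eq: "P\<^sup>2 dvd wedge d (t j) \<longleftrightarrow> P dvd k + j * wedge d y" for j
      using P_pos unfolding t_def wedge_linear k
      by (simp add: power2_eq_square mult.assoc flip: distrib_left)
    have eq0: "P\<^sup>2 dvd wedge d u \<longleftrightarrow> P dvd k" using P_pos by (simp add: k power2_eq_square)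
    show ?thesis
    proof (cases "dvd_pair P d")
      case D: True
      then have "P dvd j * wedge d y" for j by (intro dvd_mult dvd_wedge_left)
      then have "{j\<in>{0..<P}. P\<^sup>2 dvd wedge d (t j)} = (if P dvd k then {0..<P} else {})"
        unfolding eq by (auto simp: dvd_add_left_iff)
      then show ?thesis using True D eq0 by simp
    next
      case D: False
      then have "\<not> P dvd wedge d y" using dvd_wedge_dual[of 1 y u d] y True by auto
      then show ?thesis using True D card_linear_congruence[of "wedge d y" k] by (simp add: eq)
    qed
  next
    case False
    have "\<not> P\<^sup>2 dvd wedge d (t j)" for j
    proof
      assume "P\<^sup>2 dvd wedge d (t j)"
      then have "P dvd wedge d u + P * (j * wedge d y)"
        unfolding t_def wedge_linear using dvd_trans[of P "P\<^sup>2"]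
        by (simp add: power2_eq_square mult.assoc)
      then show False using False by (metis dvd_add_left_iff dvd_triv_left)
    qed
    moreover have "\<not> dvd_pair P d" using False dvd_wedge_left by blast
    ultimately show ?thesis using False by simp
  qed
  note ind = card_indicator[OF assms(1)]
  have "(\<Sum>j\<in>{0..<P}. coset_card A (t j) c) + class_card A c =
      (\<Sum>a\<in>A. card {j\<in>{0..<P}. P\<^sup>2 dvd wedge (a - c) (t j)} + (if dvd_pair P (a - c) then 1 else 0))"
    unfolding coset_card_def class_card_def sum.distrib ind[symmetric]
    by (subst sum_card_swap) (use assms(1) in auto)
  also have "\<dots> = p * seg_card A u c + line_card A u c"
    unfolding pw sum.distrib sum_distrib_left[symmetric] ind[symmetric] seg_card_def line_card_def ..
  finally show ?thesis using sum1 by simp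
qed

section \<open>Double counting over the directions modulo \<open>p\<close>\<close>

definition dirs :: "(int \<times> int) set" where
  "dirs = insert (0, 1) (Pair 1 ` {0..<P})"

lemma finite_dirs: "finite dirs" by (simp add: dirs_def)

lemma card_dirs: "card dirs = p + 1"
  by (simp add: dirs_def card_insert_if card_image inj_on_def image_iff)

lemma dirs_prim: "d \<in> dirs \<Longrightarrow> prim d"
  using p_ge_2 by (auto simp: dirs_def prim_def dvd_pair_def)

lemma card_dirs_par:
  assumes "prim x" shows "card {d\<in>dirs. P dvd wedge x d} = 1"
proof -
  have *: "{d\<in>dirs. P dvd wedge x d} = (if P dvd fst x then {(0, 1)} else {}) \<union>
      Pair 1 ` {j\<in>{0..<P}. P dvd - snd x + j * fst x}"
    by (auto simp: dirs_def wedge_def algebra_simps)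
  show ?thesis
  proof (cases "P dvd fst x")
    case True
    have "\<not> P dvd - snd x + j * fst x" for j
    proof
      assume "P dvd - snd x + j * fst x"
      then have "P dvd - snd x + j * fst x - j * fst x" using True by (intro dvd_diff dvd_mult)
      then show False using assms True by (simp add: prim_def dvd_pair_def)
    qed
    then show ?thesis using True by (simp add: *)
  next
    case False
    then show ?thesis using card_linear_congruence[of "fst x" "- snd x"]
      by (simp add: * card_image inj_on_def)
  qed
qed

lemma dirs_rep:
  assumes "prim x" obtains d where "d \<in> dirs" "P dvd wedge x d"
  using card_dirs_par[OF assms] by (metis (no_types, lifting) card.empty empty_Collect_eq zero_neq_one)

text \<open>A point not congruent to \<open>c\<close> modulo \<open>p\<close> lies on exactly one of
  the \<open>p + 1\<close> lines through \<open>c\<close>; a point of the class of \<open>c\<close>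
  lies on all of them.\<close>

lemma dirs_line_sum:
  assumes "finite A"
  shows "(\<Sum>d\<in>dirs. line_card A d c) = card A + p * class_card A c"
proof -
  note ind = card_indicator[OF assms(1)]
  have pw: "card {d\<in>dirs. P dvd wedge x d} = 1 + p * (if dvd_pair P x then 1 else 0)" for x
  proof (cases "dvd_pair P x")
    case True
    then have "{d\<in>dirs. P dvd wedge x d} = dirs" using dvd_wedge_left by blast
    then show ?thesis using True card_dirs by simp
  next
    case False
    then show ?thesis using card_dirs_par[of x] by (simp add: prim_def)
  qed
  have "(\<Sum>d\<in>dirs. line_card A d c) = (\<Sum>a\<in>A. card {d\<in>dirs. P dvd wedge (a - c) d})"
    unfolding line_card_def by (rule sum_card_swap[OF assms finite_dirs])
  also have "\<dots> = card A + p * class_card A c"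
    unfolding pw sum.distrib sum_distrib_left[symmetric] ind[symmetric] class_card_def by simp
  finally show ?thesis .
qed

text \<open>Within its class, the segments through \<open>c\<close> behave like the lines through a
  point of a plane over the field with \<open>p\<close> elements: only \<open>c\<close> itself lies
  on all \<open>p + 1\<close> of them.\<close>

lemma dirs_seg_sum:
  assumes "reduced A" "c \<in> A"
  shows "(\<Sum>d\<in>dirs. seg_card A d c) = class_card A c + p"
proof -
  have fin: "finite A" using assms by (simp add: reduced_def)
  note ind = card_indicator[OF fin]
  have pw: "card {d\<in>dirs. dvd_pair P x \<and> P\<^sup>2 dvd wedge x d} =
      (if dvd_pair P x then 1 else 0) + p * (if dvd_pair (P\<^sup>2) x then 1 else 0)" for x
  proof (cases "dvd_pair P x")
    case True
    then obtain z where z: "x = smul P z" by (elim dvd_pairE)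
    have "P\<^sup>2 dvd wedge x d \<longleftrightarrow> P dvd wedge z d" for d
      using P_pos by (simp add: z wedge_linear power2_eq_square)
    moreover have "dvd_pair (P\<^sup>2) x \<longleftrightarrow> dvd_pair P z"
      using P_pos by (simp add: z dvd_pair_def smul_def power2_eq_square)
    moreover have "card {d\<in>dirs. P dvd wedge z d} = 1 + p * (if dvd_pair P z then 1 else 0)"
    proof (cases "dvd_pair P z")
      case True
      then have "{d\<in>dirs. P dvd wedge z d} = dirs" using dvd_wedge_left by blast
      then show ?thesis using True card_dirs by simp
    next
      case False
      then show ?thesis using card_dirs_par[of z] by (simp add: prim_def)
    qed
    ultimately show ?thesis using True by simp
  next
    case False
    moreover have "\<not> dvd_pair (P\<^sup>2) x"
      using False dvd_trans[of P "P\<^sup>2"] by (auto simp: dvd_pair_def power2_eq_square)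
    ultimately show ?thesis by simp
  qed
  have self: "{a\<in>A. dvd_pair (P\<^sup>2) (a - c)} = {c}"
    using assms by (auto simp: reduced_def)
  have "(\<Sum>d\<in>dirs. seg_card A d c) =
      (\<Sum>a\<in>A. card {d\<in>dirs. dvd_pair P (a - c) \<and> P\<^sup>2 dvd wedge (a - c) d})"
    unfolding seg_card_def by (rule sum_card_swap[OF fin finite_dirs])
  also have "\<dots> = class_card A c + p"
    unfolding pw sum.distrib sum_distrib_left[symmetric] ind[symmetric] class_card_def self by simp
  finally show ?thesis .
qed

text \<open>\<open>D1 S u\<close> and \<open>D2 S t\<close> say that some difference of two elements of \<open>S\<close> generates the same
  subgroup as \<open>p u\<close>, respectively as \<open>t\<close>. If \<open>S\<close> is a spectrum of \<open>A\<close>, they imply \<open>z1 A u\<close> and \<open>z2 A t\<close>.\<close>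

definition D1 :: "(int \<times> int) set \<Rightarrow> int \<times> int \<Rightarrow> bool" where
  "D1 A u \<longleftrightarrow> (\<exists>a\<in>A. \<exists>b\<in>A. a \<noteq> b \<and> dvd_pair P (a - b) \<and> P\<^sup>2 dvd wedge (a - b) u)"

definition D2 :: "(int \<times> int) set \<Rightarrow> int \<times> int \<Rightarrow> bool" where
  "D2 A t \<longleftrightarrow> (\<exists>a\<in>A. \<exists>b\<in>A. prim (a - b) \<and> P\<^sup>2 dvd wedge (a - b) t)"

text \<open>Here the difference is parallel to \<open>u\<close> only modulo \<open>p\<close>. For a
  spectrum this yields vanishing at some lift of the direction, not at a prescribed one.\<close>

definition DL :: "(int \<times> int) set \<Rightarrow> int \<times> int \<Rightarrow> bool" where
  "DL A u \<longleftrightarrow> (\<exists>a\<in>A. \<exists>b\<in>A. prim (a - b) \<and> P dvd wedge (a - b) u)"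

section \<open>Bounds from missing differences\<close>

definition lifts :: "int \<Rightarrow> int set" where
  "lifts k = {x\<in>{0..<P\<^sup>2}. P dvd x - k}"

lemma lifts: "finite (lifts k)" "card (lifts k) = p"
proof -
  show "finite (lifts k)" unfolding lifts_def by (rule finite_subset[of _ "{0..<P\<^sup>2}"]) auto
  have "bij_betw (\<lambda>j. k mod P + P * j) {0..<P} (lifts k)"
  proof (rule bij_betw_byWitness[where f' = "\<lambda>x. x div P"])
    show "\<forall>j\<in>{0..<P}. (k mod P + P * j) div P = j" using P_pos by simp
    show "\<forall>x\<in>lifts k. k mod P + P * (x div P) = x"
      unfolding lifts_def mod_eq_dvd_iff[symmetric] by (metis (mono_tags, lifting) mem_Collect_eq mod_mult_div_eq)
    have "k mod P + P * j < P\<^sup>2" if "j < P" for j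
    proof -
      have "P * (j + 1) \<le> P * P" using that P_pos by (intro mult_left_mono) auto
      moreover have "k mod P < P" using P_pos by simp
      ultimately show ?thesis by (simp add: power2_eq_square algebra_simps)
    qed
    moreover have "P dvd k mod P + P * j - k" for j
      using dvd_minus_mod[of P k] by (metis add_diff_eq add.commute diff_add_eq dvd_add_left_iff dvd_triv_left
        dvd_diff_commute diff_add_eq_diff_diff_swap)
    ultimately show "(\<lambda>j. k mod P + P * j) ` {0..<P} \<subseteq> lifts k"
      using P_pos by (auto simp: lifts_def)
    show "(\<lambda>x. x div P) ` lifts k \<subseteq> {0..<P}"
    proof
      fix i assume "i \<in> (\<lambda>x. x div P) ` lifts k"
      then obtain x where x: "i = x div P" "0 \<le> x" "x < P * P"
        by (auto simp: lifts_def power2_eq_square)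
      have "x = P * (x div P) + x mod P" by simp
      moreover have "0 \<le> x mod P" using P_pos by simp
      ultimately have "P * (x div P) < P * P" using x(3) by linarith
      then show "i \<in> {0..<P}" using x P_pos by (simp add: pos_imp_zdiv_nonneg_iff)
    qed
  qed
  from bij_betw_same_card[OF this] show "card (lifts k) = p" by simp
qed

lemma mod_lifts: "P dvd x - k \<Longrightarrow> x mod P\<^sup>2 \<in> lifts k"
proof -
  assume a: "P dvd x - k"
  have "P dvd P\<^sup>2 * (x div P\<^sup>2)" by (simp add: power2_eq_square)
  with a have "P dvd (x - k) - P\<^sup>2 * (x div P\<^sup>2)" by (rule dvd_diff)
  also have "(x - k) - P\<^sup>2 * (x div P\<^sup>2) = x mod P\<^sup>2 - k"
    by (simp add: minus_mult_div_eq_mod[symmetric])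
  finally show ?thesis using P_pos by (simp add: lifts_def)
qed

lemma mod_sq_eq_iff: "x mod P\<^sup>2 = y mod P\<^sup>2 \<longleftrightarrow> P\<^sup>2 dvd x - y"
  by (rule mod_eq_dvd_iff)

lemma wedge_mod_sq_eq_iff: "wedge a u mod P\<^sup>2 = wedge b u mod P\<^sup>2 \<longleftrightarrow> P\<^sup>2 dvd wedge (a - b) u"
  by (simp add: mod_sq_eq_iff wedge_linear)

text \<open>There are only p^2 residues for \<open>wedge a u\<close>, so two points share one. Their
  difference is either divisible by \<open>p\<close> or primitive.\<close>

lemma pigeonhole_coset:
  assumes "finite A" "card A > p\<^sup>2"
  shows "D1 A u \<or> D2 A u"
proof -
  have "(\<lambda>a. wedge a u mod P\<^sup>2) ` A \<subseteq> {0..<P\<^sup>2}" using P_pos by auto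
  then have "card ((\<lambda>a. wedge a u mod P\<^sup>2) ` A) \<le> card {0..<P\<^sup>2}" by (intro card_mono) auto
  then have "card ((\<lambda>a. wedge a u mod P\<^sup>2) ` A) < card A" using assms(2) by (simp add: nat_power_eq)
  then obtain a b where "a \<in> A" "b \<in> A" "a \<noteq> b" "wedge a u mod P\<^sup>2 = wedge b u mod P\<^sup>2"
    using pigeonhole[of "\<lambda>a. wedge a u mod P\<^sup>2" A] by (auto simp: inj_on_def)
  then show ?thesis unfolding wedge_mod_sq_eq_iff D1_def D2_def prim_def by blast
qed

text \<open>A class consists of \<open>p\<close> segments parallel to \<open>u\<close>,
  distinguished by \<open>wedge a u\<close>, and each of them contains at most one point of
  \<open>A\<close>.\<close>

lemma class_card_le:
  assumes "reduced A" "\<not> D1 A u"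
  shows "class_card A c \<le> p"
proof -
  let ?C = "{a\<in>A. dvd_pair P (a - c)}"
  have "inj_on (\<lambda>a. wedge a u mod P\<^sup>2) ?C"
  proof (rule inj_onI)
    fix a b assume ab: "a \<in> ?C" "b \<in> ?C" "wedge a u mod P\<^sup>2 = wedge b u mod P\<^sup>2"
    then have "dvd_pair P (a - b)" using dvd_pair_diff_trans dvd_pair_minus_commute by blast
    then show "a = b" using ab assms(2) unfolding wedge_mod_sq_eq_iff D1_def by blast
  qed
  moreover have "(\<lambda>a. wedge a u mod P\<^sup>2) ` ?C \<subseteq> lifts (wedge c u)"
    by (auto intro!: mod_lifts wedge_diff_cong_left)
  ultimately have "card ?C \<le> card (lifts (wedge c u))"
    using card_inj_on_le lifts(1) by blast
  then show ?thesis by (simp add: class_card_def lifts)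
qed

lemma seg_card_one:
  assumes "\<not> D1 A u" "c \<in> A"
  shows "seg_card A u c = 1"
proof -
  have "{a\<in>A. dvd_pair P (a - c) \<and> P\<^sup>2 dvd wedge (a - c) u} = {c}"
    using assms by (auto simp: D1_def wedge_def)
  then show ?thesis by (simp add: seg_card_def)
qed

lemma seg_card_le:
  assumes "reduced A" "prim u"
  shows "seg_card A u c \<le> p"
proof -
  let ?C = "{a\<in>A. dvd_pair P (a - c) \<and> P\<^sup>2 dvd wedge (a - c) u}"
  obtain y where y: "P ^ 2 dvd wedge y u - 1" using dual_vector_exists[OF assms(2)] by blast
  have "inj_on (\<lambda>a. wedge a y mod P\<^sup>2) ?C"
  proof (rule inj_onI)
    fix a b assume ab: "a \<in> ?C" "b \<in> ?C" "wedge a y mod P\<^sup>2 = wedge b y mod P\<^sup>2"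
    then have "P\<^sup>2 dvd wedge (a - c) u - wedge (b - c) u" by (intro dvd_diff) auto
    then have "P\<^sup>2 dvd wedge (a - b) u" by (simp add: wedge_linear)
    with ab have "dvd_pair (P\<^sup>2) (a - b)"
      unfolding wedge_mod_sq_eq_iff by (intro dvd_wedge_dual[OF y])
    then show "a = b" using assms(1) ab by (simp add: reduced_def)
  qed
  moreover have "(\<lambda>a. wedge a y mod P\<^sup>2) ` ?C \<subseteq> lifts (wedge c y)"
    by (auto intro!: mod_lifts wedge_diff_cong_left)
  ultimately have "card ?C \<le> card (lifts (wedge c y))"
    using card_inj_on_le lifts(1) by blast
  then show ?thesis by (simp add: seg_card_def lifts)
qed

lemma class_card_pos: "finite A \<Longrightarrow> c \<in> A \<Longrightarrow> class_card A c > 0"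
proof -
  assume "finite A" "c \<in> A"
  then have "c \<in> {a\<in>A. dvd_pair P (a - c)}" "finite {a\<in>A. dvd_pair P (a - c)}" by simp_all
  then show ?thesis unfolding class_card_def by (metis card_gt_0_iff emptyE)
qed

lemma coset_card_pos: "finite A \<Longrightarrow> c \<in> A \<Longrightarrow> coset_card A t c > 0"
proof -
  assume "finite A" "c \<in> A"
  then have "c \<in> {a\<in>A. P\<^sup>2 dvd wedge (a - c) t}" "finite {a\<in>A. P\<^sup>2 dvd wedge (a - c) t}"
    by (simp_all add: wedge_def)
  then show ?thesis unfolding coset_card_def by (metis card_gt_0_iff emptyE)
qed

lemma class_cardE:
  assumes "class_card A c > 0"
  obtains a where "a \<in> A" "dvd_pair P (a - c)"
  using assms unfolding class_card_def by (metis (mono_tags, lifting) Collect_empty_eq card.empty less_irrefl)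

lemma class_card_cong: "dvd_pair P (c - c') \<Longrightarrow> class_card A c = class_card A c'"
  unfolding class_card_def using dvd_pair_diff_cong by (metis (no_types, lifting))

lemma coset_eq_seg:
  assumes "\<not> D2 A t" "c \<in> A"
  shows "coset_card A t c = seg_card A t c"
proof -
  have "{a\<in>A. P\<^sup>2 dvd wedge (a - c) t} = {a\<in>A. dvd_pair P (a - c) \<and> P\<^sup>2 dvd wedge (a - c) t}"
    using assms by (auto simp: D2_def prim_def)
  then show ?thesis by (simp add: coset_card_def seg_card_def)
qed

lemma line_eq_class:
  assumes "\<not> DL A t" "c \<in> A"
  shows "line_card A t c = class_card A c"
proof -
  have "{a\<in>A. P dvd wedge (a - c) t} = {a\<in>A. dvd_pair P (a - c)}"
    using assms dvd_wedge_left unfolding DL_def prim_def by blast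
  then show ?thesis by (simp add: line_card_def class_card_def)
qed

lemma seg_le_class: "finite A \<Longrightarrow> seg_card A u c \<le> class_card A c"
  unfolding seg_card_def class_card_def by (intro card_mono) auto

lemma seg_le_coset: "finite A \<Longrightarrow> seg_card A u c \<le> coset_card A u c"
  unfolding seg_card_def coset_card_def by (intro card_mono) auto

lemma class_le_line: "finite A \<Longrightarrow> class_card A c \<le> line_card A u c"
  unfolding line_card_def class_card_def by (intro card_mono) (auto intro: dvd_wedge_left)

text \<open>On a line parallel to \<open>t\<close>, the \<open>t'\<close>-coset of a point determines its class, hence its
  \<open>t\<close>-coset. There are at most \<open>p\<close> cosets of the first kind, and all \<open>p\<close> cosets of the second
  kind occur; so conversely the \<open>t\<close>-coset determines the class.\<close>

lemma z2_not_D2_par: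
  assumes A: "finite A" and t: "prim t" "prim t'" "P dvd wedge t' t" and z: "z2 A t" and n: "\<not> D2 A t'"
  shows "\<not> D2 A t"
proof
  assume "D2 A t"
  then obtain a b where ab: "a \<in> A" "b \<in> A" "prim (a - b)" "P\<^sup>2 dvd wedge (a - b) t"
    by (auto simp: D2_def)
  obtain y where "P ^ 1 dvd wedge y t - 1" using dual_vector_exists[OF t(1)] by blast
  then have y: "P dvd wedge y t - 1" by simp
  define L where "L = {x\<in>A. P dvd wedge (x - a) t}"
  define f where "f x = wedge x t' mod P\<^sup>2" for x
  define g where "g x = wedge x t mod P\<^sup>2" for x
  have peq: "dvd_pair P (x - x')" if "x \<in> L" "x' \<in> L" "f x = f x'" for x x'
    using that n unfolding f_def wedge_mod_sq_eq_iff L_def D2_def prim_def by blast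
  have fg: "g x = g x'" if "x \<in> L" "x' \<in> L" "f x = f x'" for x x'
    using peq[OF that] that(3) seg_dvd_par[OF t, of "x - x'"]
    unfolding f_def g_def wedge_mod_sq_eq_iff by simp
  have "f ` L \<subseteq> lifts (wedge a t')"
  proof (clarsimp simp: f_def, rule mod_lifts)
    fix x1 x2 assume "(x1, x2) \<in> L"
    then have "P dvd wedge ((x1, x2) - a) t" by (simp add: L_def)
    then show "P dvd wedge (x1, x2) t' - wedge a t'"
      using wedge_dvd_iff[OF t(1,2), of 1 "(x1, x2) - a"] t(3) by (simp add: wedge_linear)
  qed
  then have c1: "card (f ` L) \<le> p" using card_mono[OF lifts(1)] lifts(2) by metis
  \<comment> \<open>The coset of \<open>a\<close> is nonempty, and equidistribution carries this
    over to every coset above the same line.\<close>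
  have "lifts (wedge a t) \<subseteq> g ` L"
  proof
    fix k assume k: "k \<in> lifts (wedge a t)"
    then have kP: "P dvd k - wedge a t" "0 \<le> k" "k < P\<^sup>2" by (auto simp: lifts_def)
    obtain y' where y': "P ^ 2 dvd wedge y' t - 1" using dual_vector_exists[OF t(1)] by blast
    define c where "c = a + smul (k - wedge a t) y'"
    have "dvd_pair P (a - c)" using kP(1) by (simp add: c_def dvd_pair_def smul_def)
    then have "coset_card A t c = coset_card A t a" using z unfolding z2_def by metis
    then have "coset_card A t c > 0" using coset_card_pos[OF A ab(1)] by simp
    then have "{x\<in>A. P\<^sup>2 dvd wedge (x - c) t} \<noteq> {}" unfolding coset_card_def by force
    then obtain x where x: "x \<in> A" "P\<^sup>2 dvd wedge (x - c) t" by blast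
    have "wedge x t - k = wedge (x - c) t + (k - wedge a t) * (wedge y' t - 1)"
      by (simp add: c_def wedge_linear algebra_simps)
    then have xk: "P\<^sup>2 dvd wedge x t - k" using x(2) y' by simp
    then have "P dvd (wedge x t - k) + (k - wedge a t)"
      using kP(1) dvd_trans[of P "P\<^sup>2"] by (intro dvd_add) (auto simp: power2_eq_square)
    then have "x \<in> L" using x(1) by (simp add: L_def wedge_linear)
    moreover have "g x = k" using xk kP by (simp add: g_def flip: mod_sq_eq_iff)
    ultimately show "k \<in> g ` L" by blast
  qed
  then have "p \<le> card (g ` L)" using card_mono[of "g ` L" "lifts (wedge a t)"] A lifts(2) by (simp add: L_def)
  with c1 have "card (f ` L) \<le> card (g ` L)" by simp
  moreover have "finite L" using A by (simp add: L_def)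
  moreover have "a \<in> L" "b \<in> L" "g a = g b"
  proof -
    show "a \<in> L" using ab by (simp add: L_def wedge_def)
    have "P dvd wedge (a - b) t" using ab(4) dvd_trans[of P "P\<^sup>2"] by (simp add: power2_eq_square)
    then show "b \<in> L" using ab(2) by (simp add: L_def wedge_linear dvd_diff_commute)
    show "g a = g b" using ab(4) by (simp add: g_def wedge_mod_sq_eq_iff)
  qed
  ultimately have "f a = f b" using image_card_le_imp_fiber[of L f g a b] fg by blast
  with peq \<open>a \<in> L\<close> \<open>b \<in> L\<close> ab(3) show False by (auto simp: prim_def)
qed

text \<open>The same idea with the roles exchanged: if all \<open>p\<close> classes on the line occur, then the class
  determines the coset.\<close>

lemma not_D2_class_eq_seg:
  assumes A: "finite A" and t: "prim t" and n: "\<not> D2 A t" and a: "a \<in> A"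
    and occ: "\<And>i. class_card A (a + smul i t) > 0"
  shows "seg_card A t a = class_card A a"
proof -
  obtain y where "P ^ 1 dvd wedge y t - 1" using dual_vector_exists[OF t] by blast
  then have y: "P dvd wedge y t - 1" by simp
  define L where "L = {x\<in>A. P dvd wedge (x - a) t}"
  define f where "f x = wedge x t mod P\<^sup>2" for x
  define g where "g x = wedge x y mod P" for x
  have fg: "g x = g x'" if "x \<in> L" "x' \<in> L" "f x = f x'" for x x'
  proof -
    have "dvd_pair P (x - x')"
      using that n unfolding f_def wedge_mod_sq_eq_iff L_def D2_def prim_def by blast
    then show ?thesis unfolding g_def mod_eq_dvd_iff by (rule wedge_diff_cong_left)
  qed
  have "f ` L \<subseteq> lifts (wedge a t)"
    by (auto simp: f_def L_def wedge_linear intro!: mod_lifts)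
  then have c1: "card (f ` L) \<le> p" using card_mono[OF lifts(1)] lifts(2) by metis
  have "{0..<P} \<subseteq> g ` L"
  proof
    fix j assume j: "j \<in> {0..<P}"
    define i where "i = wedge a y - j"
    obtain x where x: "x \<in> A" "dvd_pair P (x - (a + smul i t))" using class_cardE[OF occ] by blast
    have "P dvd wedge x t - wedge (a + smul i t) t" using x(2) by (rule wedge_diff_cong_left)
    then have "x \<in> L" using x(1) by (simp add: L_def wedge_linear)
    moreover have "P dvd wedge x y - wedge (a + smul i t) y" using x(2) by (rule wedge_diff_cong_left)
    then have "P dvd (wedge x y - wedge (a + smul i t) y) - i * (wedge y t - 1)"
      by (rule dvd_diff) (rule dvd_mult[OF y])
    moreover have "(wedge x y - wedge (a + smul i t) y) - i * (wedge y t - 1) = wedge x y - j"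
      by (simp add: wedge_linear i_def wedge_minus[of t y] algebra_simps)
    ultimately have "x \<in> L \<and> P dvd wedge x y - j" by simp
    then have "g x = j" using j by (simp add: g_def flip: mod_eq_dvd_iff)
    then show "j \<in> g ` L" using \<open>x \<in> L\<close> by blast
  qed
  then have "p \<le> card (g ` L)" using card_mono[of "g ` L" "{0..<P}"] A by (simp add: L_def)
  with c1 have le: "card (f ` L) \<le> card (g ` L)" by simp
  have "P\<^sup>2 dvd wedge (x - a) t" if "x \<in> A" "dvd_pair P (x - a)" for x
  proof -
    have "x \<in> L" using that dvd_wedge_left[of P "x - a" t] by (simp add: L_def)
    moreover have "a \<in> L" using a by (simp add: L_def wedge_def)
    moreover have "g x = g a" unfolding g_def mod_eq_dvd_iff using that(2) by (rule wedge_diff_cong_left)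
    moreover have "finite L" using A by (simp add: L_def)
    ultimately have "f x = f a"
      using image_card_le_imp_fiber[OF _ le fg] by blast
    then show ?thesis by (simp add: f_def wedge_mod_sq_eq_iff)
  qed
  then have "{x\<in>A. dvd_pair P (x - a) \<and> P\<^sup>2 dvd wedge (x - a) t} = {x\<in>A. dvd_pair P (x - a)}" by blast
  then show ?thesis by (simp add: seg_card_def class_card_def)
qed

section \<open>Equidistribution patterns that give both a spectrum and a tiling complement\<close>

text \<open>The conclusion says that \<open>A\<close> is invariant under translation by \<open>p v\<close>.\<close>

lemma seg_card_periodic:
  assumes A: "reduced A" "a \<in> A" and v: "prim v"
    and z: "\<And>t. prim t \<Longrightarrow> \<not> P dvd wedge t v \<Longrightarrow> z2 A t"
  shows "seg_card A v a = p"
proof -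
  have fin: "finite A" using A by (simp add: reduced_def)
  obtain d0 where d0: "d0 \<in> dirs" "P dvd wedge v d0" using dirs_rep[OF v] by blast
  \<comment> \<open>Each of the \<open>p\<close> directions other than that of \<open>v\<close> is
    full and contributes a \<open>p\<close>-th part of the class to the direction sum. The total
    exceeds the class by \<open>p\<close>, and this remainder is the segment along
    \<open>v\<close>.\<close>
  have "class_card A a = p * seg_card A d a" if d: "d \<in> dirs - {d0}" for d
  proof (rule full_class_card[OF fin])
    show "prim d" using d dirs_prim by blast
    show "full A d" unfolding full_def
    proof (intro allI impI, rule z, blast, rule notI)
      fix t assume t: "prim t \<and> P dvd wedge t d" "P dvd wedge t v"
      have "card {d\<in>dirs. P dvd wedge t d} = 1" using card_dirs_par t by blast
      moreover have "P dvd wedge t d0"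
        using wedge_dvd_trans[of v 1 t d0] v t(2) d0(2) par_sym by (metis power_one_right)
      ultimately show False using d d0 t by (metis (no_types, lifting) DiffD1 DiffD2 card_1_singletonE
        insertI1 mem_Collect_eq singletonD)
    qed
  qed
  then have "p * (\<Sum>d\<in>dirs - {d0}. seg_card A d a) = (\<Sum>d\<in>dirs - {d0}. class_card A a)"
    by (simp add: sum_distrib_left)
  also have "\<dots> = p * class_card A a" using d0 finite_dirs card_dirs by simp
  finally have "(\<Sum>d\<in>dirs - {d0}. seg_card A d a) = class_card A a" using p_ge_2 by simp
  moreover have "(\<Sum>d\<in>dirs. seg_card A d a) = seg_card A d0 a + (\<Sum>d\<in>dirs - {d0}. seg_card A d a)"
    by (rule sum.remove[OF finite_dirs d0(1)])
  ultimately have "seg_card A d0 a = p" using dirs_seg_sum[OF A] by simp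
  moreover have "seg_card A d0 a = seg_card A v a"
    by (rule seg_card_par) (use d0 dirs_prim v in auto)
  ultimately show ?thesis by simp
qed

text \<open>Each of the \<open>p + 1\<close> lines through \<open>c\<close> has
  \<open>card A\<close> / p points, and the direction sum then determines the class of
  \<open>c\<close>, whether or not \<open>c\<close> belongs to \<open>A\<close>.\<close>

lemma all_z1_class_card:
  assumes "finite A" "\<And>u. prim u \<Longrightarrow> z1 A u"
  shows "p\<^sup>2 * class_card A c = card A"
proof -
  have "p * (\<Sum>d\<in>dirs. line_card A d c) = (\<Sum>d\<in>dirs. card A)"
    unfolding sum_distrib_left
    by (intro sum.cong refl z1_line_card) (use assms dirs_prim in auto)
  then have "p * card A + p * (p * class_card A c) = p * card A + card A"
    using dirs_line_sum[OF assms(1), of c] card_dirs by (simp add: algebra_simps)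
  then show ?thesis by (simp add: power2_eq_square)
qed

lemma dvd_abs_less: "m dvd x \<Longrightarrow> \<bar>x\<bar> < m \<Longrightarrow> x = 0" for x m :: int
  by (cases "x = 0") (use dvd_imp_le_int[of x m] in auto)

lemma dvd_pair_smul_prim:
  assumes "prim u" "dvd_pair (P ^ k) (smul i u)"
  shows "P ^ k dvd i"
  by (rule prim_mult_dvd[OF assms(1)]) (use assms(2) in \<open>simp_all add: dvd_pair_def smul_def\<close>)

lemma prim_smul: "prim u \<Longrightarrow> \<not> P dvd i \<Longrightarrow> prim (smul i u)"
  using dvd_pair_smul_prim[of u 1 i] by (auto simp: prim_def)

lemma dvd_pair_P_mult: "dvd_pair (P\<^sup>2) (smul (P * i) u) \<longleftrightarrow> dvd_pair P (smul i u)"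
  using P_pos by (simp add: dvd_pair_def smul_def power2_eq_square mult.assoc)

lemma dvd_pair_sq_imp: "dvd_pair (P\<^sup>2) x \<Longrightarrow> dvd_pair P x"
  using dvd_trans[of P "P\<^sup>2"] by (auto simp: dvd_pair_def power2_eq_square)

lemma dvd_wedge_add_cancel:
  "dvd_pair m (x + y) \<Longrightarrow> m dvd wedge y u \<Longrightarrow> m dvd wedge x u"
  using dvd_wedge_left[of m "x + y" u] by (simp add: wedge_linear dvd_add_left_iff)

lemma dvd_pair_add_cancel: "dvd_pair m (x + y) \<Longrightarrow> dvd_pair m y \<Longrightarrow> dvd_pair m x"
  by (simp add: dvd_pair_def dvd_add_left_iff)

lemma dvd_pair_add_cancel': "dvd_pair m (x + y) \<Longrightarrow> dvd_pair m x \<Longrightarrow> dvd_pair m y"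
  by (simp add: dvd_pair_def dvd_add_right_iff)

lemma card_le_one_eq:
  assumes "finite A" "card {x\<in>A. R x} \<le> 1" "a \<in> A" "b \<in> A" "R a" "R b"
  shows "a = b"
proof -
  have "{x\<in>A. R x} \<subseteq> {a}" using assms card_le_Suc0_iff_eq[of "{x\<in>A. R x}"] by auto
  with assms show ?thesis by blast
qed

lemma fourier_zeroI:
  assumes A: "finite A" and s: "\<not> dvd_pair (P\<^sup>2) s"
    and z2: "prim s \<Longrightarrow> z2 A s" and z1: "\<And>y. s = smul P y \<Longrightarrow> prim y \<Longrightarrow> z1 A y"
  shows "fourier A s = 0"
proof (cases "prim s")
  case True
  then show ?thesis using fourier_zero_iff_z2[OF A] z2 by blast
next
  case False
  then obtain y where y: "s = smul P y" unfolding prim_def using dvd_pairE by blast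
  then have "prim y" using s dvd_pair_P_mult[of 1 y] by (simp add: smul_simps prim_def)
  then show ?thesis using fourier_zero_iff_z1[OF A] z1 y by blast
qed

text \<open>Differences of points i u + j v have the same form with coefficients smaller than
  \<open>m\<close> and \<open>n\<close> in absolute value. Vanishing at all of them also shows that
  the points are distinct, because the transform does not vanish at 0.\<close>

lemma spectralI:
  assumes A: "A \<subseteq> grid" "A \<noteq> {}" and card: "card A = m * n"
    and z: "\<And>i j. \<bar>i\<bar> < int m \<Longrightarrow> \<bar>j\<bar> < int n \<Longrightarrow> i \<noteq> 0 \<or> j \<noteq> 0 \<Longrightarrow>
      fourier A (smul i u + smul j v) = 0"
  shows "spectral (p\<^sup>2) A"
proof -
  have fin: "finite A" using A finite_grid finite_subset by blast
  define g where "g = (\<lambda>ij. smul (fst ij) u + smul (snd ij) v)"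
  define X where "X = {0..<int m} \<times> {0..<int n}"
  have diff: "g x - g y = smul (fst x - fst y) u + smul (snd x - snd y) v" for x y
    by (simp add: g_def smul_def algebra_simps)
  have zero: "fourier A (g x - g y) = 0" if "x \<in> X" "y \<in> X" "x \<noteq> y" for x y
    unfolding diff by (rule z) (use that in \<open>auto simp: X_def prod_eq_iff\<close>)
  have "inj_on g X"
  proof (rule inj_onI, rule ccontr)
    fix x y assume "x \<in> X" "y \<in> X" "g x = g y" "x \<noteq> y"
    with zero[of x y] have "fourier A 0 = 0" by simp
    then show False using fin A by (simp add: fourier_zero)
  qed
  then have "card (g ` X) = card A"
    by (simp add: card_image card X_def card_cartesian_product)
  then show ?thesis
    unfolding spectral_iff[OF A]
    by (intro exI[of _ "g ` X"]) (use zero in \<open>auto simp: X_def\<close>)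
qed

lemma tile_gridI:
  assumes A: "A \<subseteq> grid" and card: "card A * (m * n) = p ^ 4"
    and inj: "\<And>a b i j. a \<in> A \<Longrightarrow> b \<in> A \<Longrightarrow> \<bar>i\<bar> < int m \<Longrightarrow> \<bar>j\<bar> < int n \<Longrightarrow>
      dvd_pair (P\<^sup>2) ((a - b) + (smul i u + smul j v)) \<Longrightarrow> a = b \<and> i = 0 \<and> j = 0"
  shows "tile (Zn_sq (p\<^sup>2)) A"
proof (rule tileI[OF A])
  let ?X = "{0..<int m} \<times> {0..<int n}"
  let ?g = "\<lambda>ij. smul (fst ij) u + smul (snd ij) v"
  show "finite ?X" by simp
  show "card A * card ?X = p ^ 4" using card by (simp add: card_cartesian_product)
  fix a b x y assume *: "a \<in> A" "b \<in> A" "x \<in> ?X" "y \<in> ?X" "dvd_pair (P\<^sup>2) (a - b + (?g x - ?g y))"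
  have eq: "?g x - ?g y = smul (fst x - fst y) u + smul (snd x - snd y) v"
    by (simp add: smul_def algebra_simps)
  have d: "dvd_pair (P\<^sup>2) (a - b + (smul (fst x - fst y) u + smul (snd x - snd y) v))"
    using *(5) unfolding eq .
  have "a = b \<and> fst x - fst y = 0 \<and> snd x - snd y = 0"
    by (rule inj[OF *(1,2) _ _ d]) (use *(3,4) in auto)
  then show "a = b \<and> x = y" by (simp add: prod_eq_iff)
qed

text \<open>At size p^2 the three alternatives mean: one point in each class; one point in each
  coset of the group of \<open>t\<close>; or one class on each line parallel to \<open>d\<close>,
  with one point in each of its segments along \<open>u\<close>. At size p^3 they mean: one point in
  each segment along \<open>u\<close>, with \<open>p\<close> points in every class; or invariance
  under \<open>p v\<close>, with exactly one segment along \<open>v\<close> in each coset of the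
  group of \<open>v\<close>.\<close>

definition good :: "(int \<times> int) set \<Rightarrow> bool" where
  "good A \<longleftrightarrow> card A = 1 \<or> card A = p ^ 4 \<or>
    (card A = p \<and> (\<exists>u. prim u \<and> (z1 A u \<or> z2 A u))) \<or>
    (card A = p\<^sup>2 \<and> ((\<forall>u. prim u \<longrightarrow> z1 A u) \<or> (\<exists>t. prim t \<and> z1 A t \<and> z2 A t) \<or>
      (\<exists>d u. prim d \<and> prim u \<and> \<not> P dvd wedge d u \<and> z1 A d \<and> full A u))) \<or>
    (card A = p ^ 3 \<and> ((\<forall>u. prim u \<longrightarrow> z1 A u) \<and> (\<exists>u. prim u \<and> full A u) \<or>
      (\<exists>v. prim v \<and> z1 A v \<and> z2 A v \<and> (\<forall>t. prim t \<longrightarrow> \<not> P dvd wedge t v \<longrightarrow> z2 A t))))"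

lemma good_spectral_tile:
  assumes A: "A \<subseteq> grid" "A \<noteq> {}" and good: "good A"
  shows "spectral (p\<^sup>2) A \<and> tile (Zn_sq (p\<^sup>2)) A"
proof -
  have red: "reduced A" by (rule reduced_grid[OF A(1)])
  then have fin: "finite A" by (simp add: reduced_def)
  have pp: "int (p\<^sup>2) = P\<^sup>2" by simp
  have dual: "\<exists>y. P\<^sup>2 dvd wedge y t - 1 \<and> \<not> P dvd wedge y t" if t: "prim t" for t
  proof -
    obtain y where y: "P\<^sup>2 dvd wedge y t - 1" using dual_vector_exists[OF t] by blast
    then have "P dvd wedge y t - 1" using dvd_trans[of P "P\<^sup>2"] by (simp add: power2_eq_square)
    with y not_dvd_one show ?thesis by blast
  qed
  have zeroI: "i = 0" if "P dvd i" "\<bar>i\<bar> < int p" for i using dvd_abs_less that by blast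
  have zeroI2: "i = 0" if "P\<^sup>2 dvd i" "\<bar>i\<bar> < int (p\<^sup>2)" for i using dvd_abs_less that pp by metis
  have multiple: "fourier A (smul i t) = 0"
    if t: "prim t" "z1 A t" "z2 A t" and i: "i \<noteq> 0" "\<bar>i\<bar> < int (p\<^sup>2)" for i t
  proof (rule fourier_zeroI[OF fin])
    show "\<not> dvd_pair (P\<^sup>2) (smul i t)" using dvd_pair_smul_prim[OF t(1), of 2 i] zeroI2 i by blast
    show "z2 A (smul i t)" if "prim (smul i t)"
      using z2_par[OF t(1) that] t(3) by (simp add: wedge_linear)
    show "z1 A y" if y: "smul i t = smul P y" "prim y" for y
    proof -
      have "P * wedge y t = wedge (smul i t) t" unfolding y by (simp add: wedge_linear)
      then have "wedge y t = 0" using P_pos by (simp add: wedge_linear)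
      then show ?thesis using z1_par[OF t(1) y(2)] t(2) by simp
    qed
  qed
  have full_lift: "z2 A (smul i u + smul j w)"
    if "full A u" "prim u" "\<not> P dvd i" "P dvd j" for i j u w
  proof -
    have "prim (smul i u + smul j w)"
    proof (unfold prim_def, rule notI)
      assume "dvd_pair P (smul i u + smul j w)"
      moreover have "dvd_pair P (smul j w)" using that(4) by (simp add: dvd_pair_def smul_def)
      ultimately have "dvd_pair P (smul i u)" by (rule dvd_pair_add_cancel)
      then show False using prim_smul[OF that(2,3)] by (simp add: prim_def)
    qed
    moreover have "P dvd wedge (smul i u + smul j w) u" using that(4) by (simp add: wedge_linear)
    ultimately show ?thesis using that(1) unfolding full_def by blast
  qed
  from good consider
      (c0) "card A = 1" | (c4) "card A = p ^ 4"
    | (c1a) u where "card A = p" "prim u" "z1 A u" | (c1b) u where "card A = p" "prim u" "z2 A u"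
    | (c2a) "card A = p\<^sup>2" "\<forall>u. prim u \<longrightarrow> z1 A u"
    | (c2b) t where "card A = p\<^sup>2" "prim t" "z1 A t" "z2 A t"
    | (c2c) d u where "card A = p\<^sup>2" "prim d" "prim u" "\<not> P dvd wedge d u" "z1 A d" "full A u"
    | (c3a) u where "card A = p ^ 3" "\<forall>u. prim u \<longrightarrow> z1 A u" "prim u" "full A u"
    | (c3b) v where "card A = p ^ 3" "prim v" "z1 A v" "z2 A v"
        "\<forall>t. prim t \<longrightarrow> \<not> P dvd wedge t v \<longrightarrow> z2 A t"
    unfolding good_def by (elim disjE exE conjE) blast+
  then show ?thesis
  proof cases
    case c0
    have "spectral (p\<^sup>2) A"
      by (rule spectralI[OF A, of 1 1 0 0]) (use c0 in auto)
    moreover have "tile (Zn_sq (p\<^sup>2)) A"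
    proof (rule tile_gridI[OF A(1), of "p\<^sup>2" "p\<^sup>2" "(1, 0)" "(0, 1)"])
      show "card A * (p\<^sup>2 * p\<^sup>2) = p ^ 4" using c0 by (simp flip: power_add)
      fix a b i j assume *: "a \<in> A" "b \<in> A" "\<bar>i\<bar> < int (p\<^sup>2)" "\<bar>j\<bar> < int (p\<^sup>2)"
        "dvd_pair (P\<^sup>2) (a - b + (smul i (1, 0) + smul j (0, 1)))"
      have "a = b" using c0 * by (metis card_1_singletonE singletonD)
      then have "P\<^sup>2 dvd i" "P\<^sup>2 dvd j" using *(5) by (simp_all add: dvd_pair_def smul_def)
      then show "a = b \<and> i = 0 \<and> j = 0" using \<open>a = b\<close> zeroI2 * by blast
    qed
    ultimately show ?thesis ..
  next
    case c4
    have Ag: "A = grid" by (rule card_subset_eq[OF finite_grid A(1)]) (simp add: c4 card_grid)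
    have "spectral (p\<^sup>2) A"
    proof (rule spectralI[OF A, of "p\<^sup>2" "p\<^sup>2" "(1, 0)" "(0, 1)"])
      show "card A = p\<^sup>2 * p\<^sup>2" using c4 by (simp flip: power_add)
      fix i j assume *: "\<bar>i\<bar> < int (p\<^sup>2)" "\<bar>j\<bar> < int (p\<^sup>2)" "i \<noteq> 0 \<or> j \<noteq> 0"
      have "\<not> dvd_pair (P\<^sup>2) (smul i (1, 0) + smul j (0, 1))"
        using * zeroI2 by (auto simp: dvd_pair_def smul_def)
      then show "fourier A (smul i (1, 0) + smul j (0, 1)) = 0" unfolding Ag by (rule fourier_grid)
    qed
    moreover have "tile (Zn_sq (p\<^sup>2)) A"
    proof (rule tile_gridI[OF A(1), of 1 1 0 0])
      fix a b i j assume *: "a \<in> A" "b \<in> A" "\<bar>i\<bar> < int 1" "\<bar>j\<bar> < int 1"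
        "dvd_pair (P\<^sup>2) (a - b + (smul i 0 + smul j 0))"
      then show "a = b \<and> i = 0 \<and> j = 0" using red by (auto simp: reduced_def smul_simps)
    qed (simp add: c4)
    ultimately show ?thesis ..
  next
    case c1a
    obtain y where y: "P\<^sup>2 dvd wedge y u - 1" "\<not> P dvd wedge y u" using dual c1a by blast
    have line: "line_card A u c = 1" for c using z1_line_card[OF fin c1a(2,3), of c] c1a(1) p_ge_2 by simp
    have "spectral (p\<^sup>2) A"
    proof (rule spectralI[OF A, of p 1 "smul P u" 0])
      fix i j assume *: "\<bar>i\<bar> < int p" "\<bar>j\<bar> < int 1" "i \<noteq> 0 \<or> j \<noteq> 0"
      then have "\<not> P dvd i" using zeroI by auto
      then have pr: "prim (smul i u)" by (rule prim_smul[OF c1a(2)])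
      then have "z1 A (smul i u)" using z1_par[OF c1a(2) pr] c1a(3) by (simp add: wedge_linear)
      then have "fourier A (smul P (smul i u)) = 0" using fourier_zero_iff_z1[OF fin pr] by blast
      then show "fourier A (smul i (smul P u) + smul j 0) = 0" by (simp add: smul_simps mult.commute)
    qed (simp add: c1a)
    moreover have "tile (Zn_sq (p\<^sup>2)) A"
    \<comment> \<open>One point of \<open>A\<close> lies on each line parallel to \<open>u\<close>.
      The complement is the subgroup of order p^3 of all elements over the line through 0.\<close>
    proof (rule tile_gridI[OF A(1), of "p\<^sup>2" p u "smul P y"])
      show "card A * (p\<^sup>2 * p) = p ^ 4" using c1a by (simp add: power2_eq_square power4_eq_xxxx)
      fix a b i j assume *: "a \<in> A" "b \<in> A" "\<bar>i\<bar> < int (p\<^sup>2)" "\<bar>j\<bar> < int p"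
        "dvd_pair (P\<^sup>2) (a - b + (smul i u + smul j (smul P y)))"
      have "P dvd wedge (a - b) u"
        by (rule dvd_wedge_add_cancel[OF dvd_pair_sq_imp[OF *(5)]]) (simp add: wedge_linear)
      then have ab: "a = b"
        using card_le_one_eq[OF fin, of "\<lambda>x. P dvd wedge (x - b) u" a b] line[of b] *
        by (simp add: line_card_def wedge_def)
      then have d: "dvd_pair (P\<^sup>2) (smul i u + smul j (smul P y))" using *(5) by simp
      have "P\<^sup>2 dvd P * (j * wedge y u)"
        using dvd_wedge_left[OF d, of u] by (simp add: wedge_linear algebra_simps)
      then have "P dvd j * wedge y u" using P_pos by (simp add: power2_eq_square)
      then have "P dvd j" using y(2) P_prime by (simp add: prime_dvd_mult_iff)
      then have j: "j = 0" using zeroI * by blast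
      then have "dvd_pair (P ^ 2) (smul i u)" using d by (simp add: smul_simps)
      then have "i = 0" using dvd_pair_smul_prim[OF c1a(2)] zeroI2 * by blast
      with ab j show "a = b \<and> i = 0 \<and> j = 0" by blast
    qed
    ultimately show ?thesis ..
  next
    case c1b
    obtain y where y: "P\<^sup>2 dvd wedge y u - 1" "\<not> P dvd wedge y u" using dual c1b by blast
    have "spectral (p\<^sup>2) A"
    proof (rule spectralI[OF A, of p 1 u 0])
      fix i j assume *: "\<bar>i\<bar> < int p" "\<bar>j\<bar> < int 1" "i \<noteq> 0 \<or> j \<noteq> 0"
      then have "\<not> P dvd i" using zeroI by auto
      then have pr: "prim (smul i u)" by (rule prim_smul[OF c1b(2)])
      then have "z2 A (smul i u)" using z2_par[OF c1b(2) pr] c1b(3) by (simp add: wedge_linear)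
      then show "fourier A (smul i u + smul j 0) = 0"
        using fourier_zero_iff_z2[OF fin pr] by (simp add: smul_simps)
    qed (simp add: c1b)
    moreover have "tile (Zn_sq (p\<^sup>2)) A"
    \<comment> \<open>All of \<open>A\<close> lies on one line, with one point in each coset of
      \<open>u\<close>. Multiples of \<open>u\<close> fill these cosets, and multiples of the dual
      vector \<open>y\<close> reach the other lines.\<close>
    proof (rule tile_gridI[OF A(1), of "p\<^sup>2" p u y])
      show "card A * (p\<^sup>2 * p) = p ^ 4" using c1b by (simp add: power2_eq_square power4_eq_xxxx)
      fix a b i j assume *: "a \<in> A" "b \<in> A" "\<bar>i\<bar> < int (p\<^sup>2)" "\<bar>j\<bar> < int p"
        "dvd_pair (P\<^sup>2) (a - b + (smul i u + smul j y))"
      have line: "line_card A u b = p * coset_card A u b" by (rule z2_line_card[OF fin c1b(2,3)])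
      have "line_card A u b \<le> card A" unfolding line_card_def by (rule card_mono[OF fin]) auto
      then have "line_card A u b \<le> p" using c1b(1) by simp
      then have coset: "coset_card A u b = 1"
        using line coset_card_pos[OF fin *(2), of u] p_ge_2 by (cases "coset_card A u b") auto
      then have "{x\<in>A. P dvd wedge (x - b) u} = A"
        using line c1b(1) by (intro card_subset_eq[OF fin]) (auto simp: line_card_def)
      then have L: "P dvd wedge (a - b) u" using * by blast
      have "P dvd wedge (a - b) u + j * wedge y u"
        using dvd_wedge_left[OF dvd_pair_sq_imp[OF *(5)], of u] by (simp add: wedge_linear)
      then have "P dvd j * wedge y u" using L by (simp add: dvd_add_right_iff)
      then have "P dvd j" using y(2) P_prime by (simp add: prime_dvd_mult_iff)
      then have j: "j = 0" using zeroI * by blast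
      then have d: "dvd_pair (P\<^sup>2) (a - b + smul i u)" using *(5) by (simp add: smul_simps)
      have "P\<^sup>2 dvd wedge (a - b) u"
        by (rule dvd_wedge_add_cancel[OF d]) (simp add: wedge_linear)
      then have ab: "a = b"
        using card_le_one_eq[OF fin, of "\<lambda>x. P\<^sup>2 dvd wedge (x - b) u" a b] coset *
        by (simp add: coset_card_def wedge_def)
      then have "dvd_pair (P ^ 2) (smul i u)" using d by simp
      then have "i = 0" using dvd_pair_smul_prim[OF c1b(2)] zeroI2 * by blast
      with ab j show "a = b \<and> i = 0 \<and> j = 0" by blast
    qed
    ultimately show ?thesis ..
  next
    case c2a
    have cls: "class_card A c = 1" for c
      using all_z1_class_card[OF fin, of c] c2a p_ge_2 by simp
    have "spectral (p\<^sup>2) A"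
    proof (rule spectralI[OF A, of p p "(P, 0)" "(0, P)"])
      show "card A = p * p" using c2a by (simp add: power2_eq_square)
      fix i j assume *: "\<bar>i\<bar> < int p" "\<bar>j\<bar> < int p" "i \<noteq> 0 \<or> j \<noteq> 0"
      have pr: "prim (i, j)" using * zeroI by (auto simp: prim_def dvd_pair_def)
      then have "fourier A (smul P (i, j)) = 0" using fourier_zero_iff_z1[OF fin pr] c2a by blast
      then show "fourier A (smul i (P, 0) + smul j (0, P)) = 0" by (simp add: smul_def mult.commute)
    qed
    moreover have "tile (Zn_sq (p\<^sup>2)) A"
    proof (rule tile_gridI[OF A(1), of p p "(P, 0)" "(0, P)"])
      show "card A * (p * p) = p ^ 4" using c2a by (simp add: power2_eq_square power4_eq_xxxx)
      fix a b i j assume *: "a \<in> A" "b \<in> A" "\<bar>i\<bar> < int p" "\<bar>j\<bar> < int p"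
        "dvd_pair (P\<^sup>2) (a - b + (smul i (P, 0) + smul j (0, P)))"
      have "dvd_pair P (a - b)"
        by (rule dvd_pair_add_cancel[OF dvd_pair_sq_imp[OF *(5)]]) (simp add: dvd_pair_def smul_def)
      then have ab: "a = b"
        using card_le_one_eq[OF fin, of "\<lambda>x. dvd_pair P (x - b)" a b] cls[of b] *
        by (simp add: class_card_def)
      then have "P\<^sup>2 dvd i * P" "P\<^sup>2 dvd j * P" using *(5) by (simp_all add: dvd_pair_def smul_def)
      then have "P dvd i" "P dvd j" using P_pos by (simp_all add: power2_eq_square)
      then show "a = b \<and> i = 0 \<and> j = 0" using ab zeroI * by blast
    qed
    ultimately show ?thesis ..
  next
    case c2b
    have coset: "coset_card A t c = 1" for c
      using z1_line_card[OF fin c2b(2,3), of c] z2_line_card[OF fin c2b(2,4), of c] c2b(1) p_ge_2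
      by (simp add: power2_eq_square)
    have "spectral (p\<^sup>2) A"
    proof (rule spectralI[OF A, of "p\<^sup>2" 1 t 0])
      fix i j assume *: "\<bar>i\<bar> < int (p\<^sup>2)" "\<bar>j\<bar> < int 1" "i \<noteq> 0 \<or> j \<noteq> 0"
      then show "fourier A (smul i t + smul j 0) = 0"
        using multiple[OF c2b(2-4), of i] by (simp add: smul_simps)
    qed (simp add: c2b)
    moreover have "tile (Zn_sq (p\<^sup>2)) A"
    proof (rule tile_gridI[OF A(1), of "p\<^sup>2" 1 t 0])
      show "card A * (p\<^sup>2 * 1) = p ^ 4" using c2b by (simp flip: power_add)
      fix a b i j assume *: "a \<in> A" "b \<in> A" "\<bar>i\<bar> < int (p\<^sup>2)" "\<bar>j\<bar> < int 1"
        "dvd_pair (P\<^sup>2) (a - b + (smul i t + smul j 0))"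
      then have d: "dvd_pair (P\<^sup>2) (a - b + smul i t)" by (simp add: smul_simps)
      have "P\<^sup>2 dvd wedge (a - b) t"
        by (rule dvd_wedge_add_cancel[OF d]) (simp add: wedge_linear)
      then have ab: "a = b"
        using card_le_one_eq[OF fin, of "\<lambda>x. P\<^sup>2 dvd wedge (x - b) t" a b] coset[of b] *
        by (simp add: coset_card_def wedge_def)
      then have "dvd_pair (P ^ 2) (smul i t)" using d by simp
      then have "i = 0" using dvd_pair_smul_prim[OF c2b(2)] zeroI2 * by blast
      with ab * show "a = b \<and> i = 0 \<and> j = 0" by simp
    qed
    ultimately show ?thesis ..
  next
    case c2c
    have line: "line_card A d c = p" for c
      using z1_line_card[OF fin c2c(2,5), of c] c2c(1) p_ge_2 by (simp add: power2_eq_square)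
    have "spectral (p\<^sup>2) A"
    \<comment> \<open>A difference with nonzero \<open>i\<close> is a lift of a multiple of
      \<open>u\<close>, covered by fullness. For \<open>i = 0\<close> it is \<open>p\<close> times a
      multiple of \<open>d\<close>.\<close>
    proof (rule spectralI[OF A, of p p u "smul P d"])
      show "card A = p * p" using c2c by (simp add: power2_eq_square)
      fix i j assume *: "\<bar>i\<bar> < int p" "\<bar>j\<bar> < int p" "i \<noteq> 0 \<or> j \<noteq> 0"
      show "fourier A (smul i u + smul j (smul P d)) = 0"
      proof (cases "i = 0")
        case True
        then have "\<not> P dvd j" using zeroI * by blast
        then have pr: "prim (smul j d)" by (rule prim_smul[OF c2c(2)])
        have "z1 A (smul j d)" using z1_par[OF c2c(2) pr] c2c(5) by (simp add: wedge_linear)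
        then have "fourier A (smul P (smul j d)) = 0" using fourier_zero_iff_z1[OF fin pr] by blast
        then show ?thesis using True by (simp add: smul_simps mult.commute)
      next
        case False
        then have i: "\<not> P dvd i" using zeroI * by blast
        have "prim (smul i u)" by (rule prim_smul[OF c2c(3) i])
        then have "prim (smul i u + smul (j * P) d)"
          unfolding prim_def by (metis dvd_pair_add_cancel dvd_pair_smul mult.commute smul_simps(6))
        moreover have "z2 A (smul i u + smul (j * P) d)" by (rule full_lift[OF c2c(6,3) i]) simp
        ultimately show ?thesis using fourier_zero_iff_z2[OF fin] by (simp add: smul_simps)
      qed
    qed
    moreover have "tile (Zn_sq (p\<^sup>2)) A"
    \<comment> \<open>Class sizes are positive multiples of \<open>p\<close>, and a line parallel to
      \<open>d\<close> has just \<open>p\<close> points, so it contains one class only. Shifts by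
      \<open>d\<close> run through the classes of this line, shifts by \<open>p u\<close> through
      the segments inside a class.\<close>
    proof (rule tile_gridI[OF A(1), of p p "smul P u" d])
      show "card A * (p * p) = p ^ 4" using c2c by (simp add: power2_eq_square power4_eq_xxxx)
      fix a b i j assume *: "a \<in> A" "b \<in> A" "\<bar>i\<bar> < int p" "\<bar>j\<bar> < int p"
        "dvd_pair (P\<^sup>2) (a - b + (smul i (smul P u) + smul j d))"
      have cl: "class_card A b = p * seg_card A u b" by (rule full_class_card[OF fin c2c(3,6)])
      have le: "class_card A b \<le> p" using class_le_line[OF fin, of b d] line by simp
      then have seg: "seg_card A u b = 1"
        using cl class_card_pos[OF fin *(2)] p_ge_2 by (cases "seg_card A u b") auto
      have "{x\<in>A. dvd_pair P (x - b)} = {x\<in>A. P dvd wedge (x - b) d}"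
      proof (rule card_subset_eq)
        show "finite {x\<in>A. P dvd wedge (x - b) d}" using fin by simp
        show "{x\<in>A. dvd_pair P (x - b)} \<subseteq> {x\<in>A. P dvd wedge (x - b) d}"
          using dvd_wedge_left by blast
        show "card {x\<in>A. dvd_pair P (x - b)} = card {x\<in>A. P dvd wedge (x - b) d}"
          using cl seg line[of b] by (simp add: class_card_def line_card_def)
      qed
      moreover have "P dvd wedge (a - b) d"
        by (rule dvd_wedge_add_cancel[OF dvd_pair_sq_imp[OF *(5)]]) (simp add: wedge_linear)
      ultimately have peq: "dvd_pair P (a - b)" using *(1) by blast
      have "dvd_pair P (smul i (smul P u) + smul j d)"
        by (rule dvd_pair_add_cancel'[OF dvd_pair_sq_imp[OF *(5)] peq])
      moreover have "dvd_pair P (smul i (smul P u))" by (simp add: dvd_pair_def smul_def)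
      ultimately have "dvd_pair (P ^ 1) (smul j d)" using dvd_pair_add_cancel' by auto
      then have "P ^ 1 dvd j" by (rule dvd_pair_smul_prim[OF c2c(2)])
      then have j: "j = 0" using zeroI * by simp
      then have dd: "dvd_pair (P\<^sup>2) (a - b + smul i (smul P u))" using *(5) by (simp add: smul_simps)
      have "P\<^sup>2 dvd wedge (a - b) u"
        by (rule dvd_wedge_add_cancel[OF dd]) (simp add: wedge_linear)
      then have ab: "a = b"
        using card_le_one_eq[OF fin, of "\<lambda>x. dvd_pair P (x - b) \<and> P\<^sup>2 dvd wedge (x - b) u" a b] seg * peq
        by (simp add: seg_card_def wedge_def)
      then have "dvd_pair P (smul i u)" using dd dvd_pair_P_mult by (simp add: smul_simps mult.commute)
      then have "i = 0" using dvd_pair_smul_prim[OF c2c(3), of 1] zeroI * by simp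
      with ab j show "a = b \<and> i = 0 \<and> j = 0" by blast
    qed
    ultimately show ?thesis ..
  next
    case c3a
    obtain y where y: "P\<^sup>2 dvd wedge y u - 1" "\<not> P dvd wedge y u" using dual c3a by blast
    have seg: "seg_card A u c = 1" for c
      using all_z1_class_card[OF fin, of c] full_class_card[OF fin c3a(3,4), of c] c3a(1,2) p_ge_2
      by (simp add: power2_eq_square power3_eq_cube)
    have "spectral (p\<^sup>2) A"
    \<comment> \<open>These points represent all elements over the line of \<open>u\<close> through
      0. The primitive ones are lifts of that direction, and the others are covered by
      \<open>z1\<close> in all directions.\<close>
    proof (rule spectralI[OF A, of "p\<^sup>2" p u "smul P y"])
      show "card A = p\<^sup>2 * p" using c3a by (simp add: power2_eq_square power3_eq_cube)
      fix i j assume *: "\<bar>i\<bar> < int (p\<^sup>2)" "\<bar>j\<bar> < int p" "i \<noteq> 0 \<or> j \<noteq> 0"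
      have sm: "smul j (smul P y) = smul (j * P) y" by (simp add: smul_simps)
      show "fourier A (smul i u + smul j (smul P y)) = 0"
      proof (rule fourier_zeroI[OF fin])
        show "\<not> dvd_pair (P\<^sup>2) (smul i u + smul j (smul P y))"
        proof
          assume d: "dvd_pair (P\<^sup>2) (smul i u + smul j (smul P y))"
          have "P\<^sup>2 dvd P * (j * wedge y u)"
            using dvd_wedge_left[OF d, of u] by (simp add: wedge_linear algebra_simps)
          then have "P dvd j * wedge y u" using P_pos by (simp add: power2_eq_square)
          then have "P dvd j" using y(2) P_prime by (simp add: prime_dvd_mult_iff)
          then have j: "j = 0" using zeroI * by blast
          then have "dvd_pair (P ^ 2) (smul i u)" using d by (simp add: smul_simps)
          then have "i = 0" using dvd_pair_smul_prim[OF c3a(3)] zeroI2 * by blast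
          with j * show False by blast
        qed
        assume pr: "prim (smul i u + smul j (smul P y))"
        have "\<not> P dvd i"
        proof
          assume "P dvd i"
          then have "dvd_pair P (smul i u + smul j (smul P y))" by (simp add: dvd_pair_def smul_def)
          with pr show False by (simp add: prim_def)
        qed
        then show "z2 A (smul i u + smul j (smul P y))"
          unfolding sm by (rule full_lift[OF c3a(4,3)]) simp
      qed (use c3a in blast)
    qed
    moreover have "tile (Zn_sq (p\<^sup>2)) A"
    proof (rule tile_gridI[OF A(1), of p 1 "smul P u" 0])
      show "card A * (p * 1) = p ^ 4" using c3a by (simp add: power3_eq_cube power4_eq_xxxx)
      fix a b i j assume *: "a \<in> A" "b \<in> A" "\<bar>i\<bar> < int p" "\<bar>j\<bar> < int 1"
        "dvd_pair (P\<^sup>2) (a - b + (smul i (smul P u) + smul j 0))"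
      then have dd: "dvd_pair (P\<^sup>2) (a - b + smul i (smul P u))" by (simp add: smul_simps)
      have "P\<^sup>2 dvd wedge (a - b) u"
        by (rule dvd_wedge_add_cancel[OF dd]) (simp add: wedge_linear)
      moreover have "dvd_pair P (a - b)"
        by (rule dvd_pair_add_cancel[OF dvd_pair_sq_imp[OF dd]]) (simp add: dvd_pair_def smul_def)
      ultimately have ab: "a = b"
        using card_le_one_eq[OF fin, of "\<lambda>x. dvd_pair P (x - b) \<and> P\<^sup>2 dvd wedge (x - b) u" a b] seg[of b] *
        by (simp add: seg_card_def wedge_def)
      then have "dvd_pair P (smul i u)" using dd dvd_pair_P_mult by (simp add: smul_simps mult.commute)
      then have "i = 0" using dvd_pair_smul_prim[OF c3a(3), of 1] zeroI * by simp
      with ab * show "a = b \<and> i = 0 \<and> j = 0" by simp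
    qed
    ultimately show ?thesis ..
  next
    case c3b
    obtain y where y: "P\<^sup>2 dvd wedge y v - 1" "\<not> P dvd wedge y v" using dual c3b by blast
    have "spectral (p\<^sup>2) A"
    \<comment> \<open>Differences with nonzero \<open>j\<close> are transverse to \<open>v\<close>,
      so only multiples of \<open>v\<close> remain for the two conditions at \<open>v\<close>
      itself.\<close>
    proof (rule spectralI[OF A, of "p\<^sup>2" p v y])
      show "card A = p\<^sup>2 * p" using c3b by (simp add: power2_eq_square power3_eq_cube)
      fix i j assume *: "\<bar>i\<bar> < int (p\<^sup>2)" "\<bar>j\<bar> < int p" "i \<noteq> 0 \<or> j \<noteq> 0"
      show "fourier A (smul i v + smul j y) = 0"
      proof (cases "j = 0")
        case True
        then show ?thesis using multiple[OF c3b(2-4), of i] * by (simp add: smul_simps)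
      next
        case False
        then have "\<not> P dvd j" using zeroI * by blast
        then have np: "\<not> P dvd wedge (smul i v + smul j y) v"
          using y(2) P_prime by (simp add: wedge_linear prime_dvd_mult_iff)
        then have "prim (smul i v + smul j y)" unfolding prim_def using dvd_wedge_left by blast
        then show ?thesis using np c3b(5) fourier_zero_iff_z2[OF fin] by blast
      qed
    qed
    moreover have "tile (Zn_sq (p\<^sup>2)) A"
    \<comment> \<open>In every coset of the group of \<open>v\<close> the set is a single segment,
      and the first \<open>p\<close> multiples of \<open>v\<close> move it through the segments of
      that coset.\<close>
    proof (rule tile_gridI[OF A(1), of p 1 v 0])
      show "card A * (p * 1) = p ^ 4" using c3b by (simp add: power3_eq_cube power4_eq_xxxx)
      fix a b i j assume *: "a \<in> A" "b \<in> A" "\<bar>i\<bar> < int p" "\<bar>j\<bar> < int 1"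
        "dvd_pair (P\<^sup>2) (a - b + (smul i v + smul j 0))"
      then have dd: "dvd_pair (P\<^sup>2) (a - b + smul i v)" by (simp add: smul_simps)
      have "seg_card A v b = p" by (rule seg_card_periodic[OF red *(2) c3b(2)]) (use c3b(5) in blast)
      moreover have "coset_card A v b = p"
        using z1_line_card[OF fin c3b(2,3), of b] z2_line_card[OF fin c3b(2,4), of b] c3b(1) p_ge_2
        by (simp add: power3_eq_cube)
      ultimately have "{x\<in>A. dvd_pair P (x - b) \<and> P\<^sup>2 dvd wedge (x - b) v} = {x\<in>A. P\<^sup>2 dvd wedge (x - b) v}"
        unfolding seg_card_def coset_card_def using fin by (intro card_subset_eq) auto
      moreover have "P\<^sup>2 dvd wedge (a - b) v"
        by (rule dvd_wedge_add_cancel[OF dd]) (simp add: wedge_linear)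
      ultimately have "dvd_pair P (a - b)" using *(1) by blast
      then have "dvd_pair P (smul i v)" using dvd_pair_sq_imp[OF dd] dvd_pair_add_cancel' by blast
      then have i: "i = 0" using dvd_pair_smul_prim[OF c3b(2), of 1] zeroI * by simp
      then have "a = b" using dd red * by (simp add: smul_simps reduced_def)
      with i * show "a = b \<and> i = 0 \<and> j = 0" by simp
    qed
    ultimately show ?thesis ..
  qed
qed

end

section \<open>Spectral pairs\<close>

lemma sum_fibers: "finite A \<Longrightarrow> card A = (\<Sum>k\<in>f ` A. card {x\<in>A. f x = k})"
  using sum.image_gen[of A "\<lambda>_. 1 :: nat" f] by (simp only: card_eq_sum)

lemma card_le_fibers:
  assumes "finite A" "\<And>a. a \<in> A \<Longrightarrow> card {x\<in>A. f x = f a} \<le> m"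
  shows "card A \<le> card (f ` A) * m"
proof -
  have "(\<Sum>k\<in>f ` A. card {x\<in>A. f x = k}) \<le> card (f ` A) * m"
    using sum_bounded_above[of "f ` A" "\<lambda>k. card {x\<in>A. f x = k}" m] assms(2) by auto
  then show ?thesis using sum_fibers[OF assms(1), of f] by simp
qed

lemma dvd_card_fibers:
  assumes "finite A" "\<And>a. a \<in> A \<Longrightarrow> m dvd card {x\<in>A. f x = f a}"
  shows "m dvd card A"
proof -
  have "m dvd card {x\<in>A. f x = k}" if k: "k \<in> f ` A" for k
  proof -
    obtain a where a: "a \<in> A" "k = f a" using k by (rule imageE)
    show ?thesis using assms(2)[OF a(1)] unfolding a(2) .
  qed
  then have "m dvd (\<Sum>k\<in>f ` A. card {x\<in>A. f x = k})" by (rule dvd_sum)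
  then show ?thesis by (simp only: sum_fibers[OF assms(1), of f])
qed

text \<open>This is the equality case of the bound by fibres: one smaller fibre would make the total
  too small.\<close>

lemma fiber_eq_of_card:
  assumes "finite A" "\<And>a. a \<in> A \<Longrightarrow> card {x\<in>A. f x = f a} \<le> m"
    and "card (f ` A) * m \<le> n * m" and "card A = n * m" and "a \<in> A"
  shows "card {x\<in>A. f x = f a} = m"
proof (rule ccontr)
  assume "card {x\<in>A. f x = f a} \<noteq> m"
  then have "card {x\<in>A. f x = f a} < m" using assms(2,5) le_neq_implies_less by blast
  then have "(\<Sum>k\<in>f ` A. card {x\<in>A. f x = k}) < (\<Sum>k\<in>f ` A. m)"
    by (intro sum_strict_mono_ex1) (use assms in auto)
  then show False using sum_fibers[OF assms(1), of f] assms(3,4) by simp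
qed

context prime_square
begin

section \<open>Size bounds and their equality cases\<close>

lemma line_sum_obtain:
  assumes "finite A" "prim u"
  obtains y where "\<And>c. (\<Sum>j\<in>{0..<P}. line_card A u (c + smul j y)) = card A"
proof -
  obtain y where "P ^ 1 dvd wedge y u - 1" using dual_vector_exists[OF assms(2)] by blast
  then have "P dvd wedge y u - 1" by simp
  then show thesis by (intro that line_sum[OF assms(1)])
qed

text \<open>The base point \<open>c\<close> need not belong to \<open>A\<close>: its line either
  contains a point of \<open>A\<close>, which may serve as base point, or is empty.\<close>

lemma line_card_bound:
  assumes "finite A" "prim u" "\<And>a. a \<in> A \<Longrightarrow> line_card A u a \<le> m"
  shows "line_card A u c \<le> m"
proof (cases "\<exists>a\<in>A. P dvd wedge (a - c) u")
  case True
  then obtain a where a: "a \<in> A" "P dvd wedge (a - c) u" by blast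
  have "P dvd wedge (x - c) u \<longleftrightarrow> P dvd wedge (x - a) u" for x
  proof -
    have "wedge (x - c) u = wedge (x - a) u + wedge (a - c) u" by (simp add: wedge_linear)
    then show ?thesis using a(2) by (simp add: dvd_add_left_iff)
  qed
  then have "line_card A u c = line_card A u a" by (simp add: line_card_def)
  then show ?thesis using assms(3) a by simp
next
  case False
  then have "{a\<in>A. P dvd wedge (a - c) u} = {}" by blast
  then show ?thesis unfolding line_card_def by (simp only: card.empty le0)
qed

lemma card_le_lines:
  assumes "finite A" "prim u" "\<And>a. a \<in> A \<Longrightarrow> line_card A u a \<le> m"
  shows "card A \<le> p * m"
proof -
  obtain y where y: "\<And>c. (\<Sum>j\<in>{0..<P}. line_card A u (c + smul j y)) = card A"
    using line_sum_obtain[OF assms(1,2)] by blast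
  have "(\<Sum>j\<in>{0..<P}. line_card A u (0 + smul j y)) \<le> of_nat (card {0..<P}) * m"
    by (rule sum_bounded_above) (rule line_card_bound[OF assms])
  then show ?thesis using y[of 0] by simp
qed

lemma line_card_eq:
  assumes "finite A" "prim u" "\<And>a. a \<in> A \<Longrightarrow> line_card A u a \<le> m" "card A = p * m"
  shows "line_card A u c = m"
proof (rule ccontr)
  obtain y where y: "\<And>c. (\<Sum>j\<in>{0..<P}. line_card A u (c + smul j y)) = card A"
    using line_sum_obtain[OF assms(1,2)] by blast
  assume "line_card A u c \<noteq> m"
  then have "line_card A u (c + smul 0 y) < m"
    using line_card_bound[OF assms(1-3), of c] by (simp add: smul_simps)
  then have "(\<Sum>j\<in>{0..<P}. line_card A u (c + smul j y)) < (\<Sum>j\<in>{0..<P}. m)"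
    using line_card_bound[OF assms(1-3)] P_pos by (intro sum_strict_mono_ex1) (auto intro!: bexI[of _ 0])
  then show False using y[of c] assms(4) by simp
qed

lemma line_card_le_of_cosets:
  assumes "finite A" "\<And>a. a \<in> A \<Longrightarrow> coset_card A t a \<le> m"
  shows "line_card A t c \<le> p * m"
proof -
  let ?L = "{a\<in>A. P dvd wedge (a - c) t}" and ?f = "\<lambda>a. wedge a t mod P\<^sup>2"
  have sub: "?f ` ?L \<subseteq> lifts (wedge c t)" by (auto simp: wedge_linear intro!: mod_lifts)
  have "card ?L \<le> card (?f ` ?L) * m"
  proof (rule card_le_fibers)
    fix a assume "a \<in> ?L"
    then have "coset_card A t a \<le> m" using assms(2) by blast
    moreover have "{x\<in>?L. ?f x = ?f a} \<subseteq> {x\<in>A. P\<^sup>2 dvd wedge (x - a) t}"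
      by (auto simp: wedge_mod_sq_eq_iff)
    then have "card {x\<in>?L. ?f x = ?f a} \<le> coset_card A t a"
      unfolding coset_card_def using assms(1) by (intro card_mono) auto
    ultimately show "card {x\<in>?L. ?f x = ?f a} \<le> m" by simp
  qed (use assms(1) in simp)
  also have "\<dots> \<le> p * m" using card_mono[OF lifts(1) sub] lifts(2) by simp
  finally show ?thesis by (simp add: line_card_def)
qed

lemma class_two_le_line:
  assumes "finite A" "P dvd wedge (a - b) t" "prim (a - b)"
  shows "class_card A a + class_card A b \<le> line_card A t a"
proof -
  let ?X = "{x\<in>A. dvd_pair P (x - a)}" and ?Y = "{x\<in>A. dvd_pair P (x - b)}"
  have "?X \<inter> ?Y = {}"
    using assms(3) dvd_pair_diff_trans dvd_pair_minus_commute unfolding prim_def by blast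
  then have "card (?X \<union> ?Y) = card ?X + card ?Y" using assms(1) by (intro card_Un_disjoint) auto
  moreover have "P dvd wedge (x - a) t" if "dvd_pair P (x - b)" for x
  proof -
    have "wedge (x - a) t = wedge (x - b) t - wedge (a - b) t" by (simp add: wedge_linear)
    then show ?thesis using dvd_wedge_left[OF that, of t] assms(2) by simp
  qed
  then have "?X \<union> ?Y \<subseteq> {x\<in>A. P dvd wedge (x - a) t}" using dvd_wedge_left by blast
  then have "card (?X \<union> ?Y) \<le> line_card A t a"
    unfolding line_card_def using assms(1) by (intro card_mono) auto
  ultimately show ?thesis by (simp add: class_card_def)
qed

lemma seg_card_D1:
  assumes "c \<in> A" "seg_card A u c > 1" shows "D1 A u"
proof (rule ccontr)
  assume "\<not> D1 A u"
  then have "seg_card A u c = 1" by (rule seg_card_one[OF _ assms(1)])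
  with assms(2) show False by simp
qed

lemma seg_card_pos: "finite A \<Longrightarrow> c \<in> A \<Longrightarrow> seg_card A u c > 0"
proof -
  assume "finite A" "c \<in> A"
  then have "{c} \<subseteq> {a\<in>A. dvd_pair P (a - c) \<and> P\<^sup>2 dvd wedge (a - c) u}" by (simp add: wedge_def)
  then have "card {c} \<le> seg_card A u c"
    unfolding seg_card_def using \<open>finite A\<close> by (intro card_mono) simp_all
  then show ?thesis by simp
qed

lemma peq_pair_D1:
  assumes "reduced A" "a \<in> A" "b \<in> A" "a \<noteq> b" "dvd_pair P (a - b)"
  obtains u where "prim u" "D1 A u"
proof -
  obtain y where y: "a - b = smul P y" using assms(5) by (elim dvd_pairE)
  have "\<not> dvd_pair (P\<^sup>2) (a - b)" using assms by (auto simp: reduced_def)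
  then have "prim y" using dvd_pair_P_mult[of 1 y] by (simp add: y smul_simps prim_def)
  moreover have "P\<^sup>2 dvd wedge (a - b) y" by (simp add: y wedge_linear)
  then have "D1 A y" using assms by (auto simp: D1_def)
  ultimately show thesis by (rule that)
qed

lemma class_card_one:
  assumes A: "reduced A" "c \<in> A" and no: "\<And>u. prim u \<Longrightarrow> \<not> D1 A u"
  shows "class_card A c = 1"
proof -
  have "{a\<in>A. dvd_pair P (a - c)} = {c}"
    using peq_pair_D1[OF A(1) _ A(2)] no A(2) by force
  then show ?thesis by (simp add: class_card_def)
qed

text \<open>Every segment through \<open>a\<close> is complete by periodicity, and so is the class
  that these segments cover.\<close>

lemma z2_all_class_card:
  assumes A: "reduced A" "a \<in> A" and z: "\<And>t. prim t \<Longrightarrow> z2 A t"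
  shows "class_card A a = p\<^sup>2"
proof -
  have "(\<Sum>d\<in>dirs. seg_card A d a) = (\<Sum>d\<in>dirs. p)"
    by (intro sum.cong refl seg_card_periodic[OF A]) (use z dirs_prim in auto)
  then have "class_card A a + p = (p + 1) * p" using dirs_seg_sum[OF A] card_dirs by simp
  then show ?thesis by (simp add: power2_eq_square)
qed

lemma all_z_card:
  assumes A: "reduced A" "A \<noteq> {}" and z: "\<And>t. prim t \<Longrightarrow> z1 A t \<and> z2 A t"
  shows "card A = p ^ 4"
proof -
  obtain a where a: "a \<in> A" using A by blast
  have "class_card A a = p\<^sup>2" using z2_all_class_card[OF A(1) a] z by blast
  moreover have "p\<^sup>2 * class_card A a = card A"
    using all_z1_class_card[of A a] A z by (auto simp: reduced_def)
  ultimately show ?thesis by (simp flip: power_add)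
qed

text \<open>Each of the p^2 cosets of the group of \<open>t\<close> meets \<open>A\<close> inside a
  single segment.\<close>

lemma not_D2_card_le:
  assumes "reduced A" "prim t" "\<not> D2 A t"
  shows "card A \<le> p ^ 3"
proof -
  have fin: "finite A" using assms by (simp add: reduced_def)
  have "coset_card A t a \<le> p" if "a \<in> A" for a
    using coset_eq_seg[OF assms(3) that] seg_card_le[OF assms(1,2)] by simp
  then have "line_card A t a \<le> p * p" for a by (rule line_card_le_of_cosets[OF fin])
  then have "card A \<le> p * (p * p)" by (rule card_le_lines[OF fin assms(2)])
  then show ?thesis by (simp add: power3_eq_cube)
qed

lemma not_D2_seg_card:
  assumes A: "reduced A" "prim t" "\<not> D2 A t" and card: "card A = p ^ 3" and a: "a \<in> A"
  shows "seg_card A t a = p"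
proof -
  have fin: "finite A" using A by (simp add: reduced_def)
  let ?f = "\<lambda>a. wedge a t mod P\<^sup>2"
  have fib: "{x\<in>A. ?f x = ?f a} = {x\<in>A. P\<^sup>2 dvd wedge (x - a) t}" for a
    by (simp add: wedge_mod_sq_eq_iff)
  have "card {x\<in>A. ?f x = ?f a} = p"
  proof (rule fiber_eq_of_card[OF fin])
    show "card {x\<in>A. ?f x = ?f a} \<le> p" if "a \<in> A" for a
      using coset_eq_seg[OF A(3) that] seg_card_le[OF A(1,2), of a] unfolding fib by (simp add: coset_card_def)
    have "?f ` A \<subseteq> {0..<P\<^sup>2}" using P_pos by auto
    then have "card (?f ` A) \<le> card {0..<P\<^sup>2}" by (intro card_mono) auto
    then show "card (?f ` A) * p \<le> p\<^sup>2 * p" by (simp add: nat_power_eq)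
  qed (use card a in \<open>simp_all add: power2_eq_square power3_eq_cube\<close>)
  then show ?thesis using coset_eq_seg[OF A(3) a] unfolding fib by (simp add: coset_card_def)
qed

text \<open>Points of \<open>A\<close> in a common coset of the group of \<open>u\<close> are
  incongruent modulo \<open>p\<close>, and such a coset meets only \<open>p\<close> classes.\<close>

lemma not_D1_card_le:
  assumes "reduced A" "prim u" "\<not> D1 A u"
  shows "card A \<le> p ^ 3"
proof -
  have fin: "finite A" using assms by (simp add: reduced_def)
  have "coset_card A u a \<le> p" if "a \<in> A" for a
  proof -
    obtain y where "P ^ 1 dvd wedge y u - 1" using dual_vector_exists[OF assms(2)] by blast
    then have y: "P dvd wedge y u - 1" by simp
    let ?C = "{x\<in>A. P\<^sup>2 dvd wedge (x - a) u}"
    have "inj_on (\<lambda>x. wedge x y mod P) ?C"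
    proof (rule inj_onI)
      fix b c assume bc: "b \<in> ?C" "c \<in> ?C" "wedge b y mod P = wedge c y mod P"
      have "P\<^sup>2 dvd wedge (b - a) u - wedge (c - a) u" using bc by (intro dvd_diff) auto
      then have d: "P\<^sup>2 dvd wedge (b - c) u" by (simp add: wedge_linear)
      then have "P ^ 1 dvd wedge (b - c) u" using dvd_trans[of P "P\<^sup>2"] by (simp add: power2_eq_square)
      moreover have "P ^ 1 dvd wedge (b - c) y" using bc(3) by (simp add: mod_eq_dvd_iff wedge_linear)
      ultimately have "dvd_pair P (b - c)" using dvd_wedge_dual[of 1 y u "b - c"] y by simp
      then show "b = c" using bc d assms(3) by (auto simp: D1_def)
    qed
    moreover have "(\<lambda>x. wedge x y mod P) ` ?C \<subseteq> {0..<P}" using P_pos by auto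
    ultimately have "card ?C \<le> card {0..<P}" by (rule card_inj_on_le) simp
    then show ?thesis by (simp add: coset_card_def)
  qed
  then have "line_card A u a \<le> p * p" for a by (rule line_card_le_of_cosets[OF fin])
  then have "card A \<le> p * (p * p)" by (rule card_le_lines[OF fin assms(2)])
  then show ?thesis by (simp add: power3_eq_cube)
qed

lemma line_card_le_of_classes:
  assumes "finite A" "prim u" "\<And>a. a \<in> A \<Longrightarrow> class_card A a \<le> m"
  shows "line_card A u c \<le> p * m"
proof -
  obtain y where "P ^ 1 dvd wedge y u - 1" using dual_vector_exists[OF assms(2)] by blast
  then have y: "P dvd wedge y u - 1" by simp
  let ?L = "{a\<in>A. P dvd wedge (a - c) u}" and ?f = "\<lambda>a. wedge a y mod P"
  have "card ?L \<le> card (?f ` ?L) * m"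
  proof (rule card_le_fibers)
    fix a assume a: "a \<in> ?L"
    have "dvd_pair P (x - a)" if x: "x \<in> ?L" "?f x = ?f a" for x
    proof -
      have "P dvd wedge (x - c) u - wedge (a - c) u" using x a by (intro dvd_diff) auto
      then have "P ^ 1 dvd wedge (x - a) u" by (simp add: wedge_linear)
      moreover have "P ^ 1 dvd wedge (x - a) y" using x(2) by (simp add: mod_eq_dvd_iff wedge_linear)
      ultimately show ?thesis using dvd_wedge_dual[of 1 y u "x - a"] y by simp
    qed
    then have "{x\<in>?L. ?f x = ?f a} \<subseteq> {x\<in>A. dvd_pair P (x - a)}" by blast
    then have "card {x\<in>?L. ?f x = ?f a} \<le> class_card A a"
      unfolding class_card_def using assms(1) by (intro card_mono) auto
    moreover have "class_card A a \<le> m" using a assms(3) by blast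
    ultimately show "card {x\<in>?L. ?f x = ?f a} \<le> m" by simp
  qed (use assms(1) in simp)
  also have "\<dots> \<le> p * m"
  proof (rule mult_right_mono)
    have "?f ` ?L \<subseteq> {0..<P}" using P_pos by auto
    then have "card (?f ` ?L) \<le> card {0..<P}" by (intro card_mono) auto
    then show "card (?f ` ?L) \<le> p" by simp
  qed simp
  finally show ?thesis by (simp add: line_card_def)
qed

lemma prim_unit: "prim (0, 1)"
  by (rule dirs_prim) (simp add: dirs_def)

lemma class_bound_card_le:
  assumes A: "finite A" and m: "\<And>a. a \<in> A \<Longrightarrow> class_card A a \<le> m"
  shows "card A \<le> p\<^sup>2 * m"
proof -
  have "card A \<le> p * (p * m)"
    by (rule card_le_lines[OF A prim_unit], rule line_card_le_of_classes[OF A prim_unit]) (rule m)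
  then show ?thesis by (simp add: power2_eq_square)
qed

section \<open>Sets paired with their spectra\<close>

text \<open>Only the combinatorial consequences of orthogonality are retained. Including those of
  the dual orthogonality makes the relation symmetric, so every result about \<open>A\<close> can
  also be applied to \<open>S\<close>.\<close>

definition spair :: "(int \<times> int) set \<Rightarrow> (int \<times> int) set \<Rightarrow> bool" where
  "spair A S \<longleftrightarrow> reduced A \<and> reduced S \<and> card S = card A \<and> A \<noteq> {} \<and>
    (\<forall>u. prim u \<longrightarrow> (D1 S u \<longrightarrow> z1 A u) \<and> (D2 S u \<longrightarrow> z2 A u) \<and>
      (D1 A u \<longrightarrow> z1 S u) \<and> (D2 A u \<longrightarrow> z2 S u))"

lemma spair_sym: "spair A S \<Longrightarrow> spair S A"
proof -
  assume sp: "spair A S"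
  then have "card S > 0" unfolding spair_def reduced_def by (simp add: card_gt_0_iff)
  then have "S \<noteq> {}" by auto
  with sp show "spair S A" unfolding spair_def by simp
qed

lemma spairD:
  assumes "spair A S"
  shows "reduced A" "reduced S" "finite A" "finite S" "card S = card A" "A \<noteq> {}" "S \<noteq> {}"
    "prim u \<Longrightarrow> D1 S u \<Longrightarrow> z1 A u" "prim u \<Longrightarrow> D2 S u \<Longrightarrow> z2 A u"
proof -
  show "reduced A" "reduced S" "card S = card A" "A \<noteq> {}" using assms by (simp_all add: spair_def)
  then show "finite A" "finite S" by (simp_all add: reduced_def)
  show "S \<noteq> {}" using spair_sym[OF assms] by (simp add: spair_def)
  show "prim u \<Longrightarrow> D1 S u \<Longrightarrow> z1 A u" "prim u \<Longrightarrow> D2 S u \<Longrightarrow> z2 A u"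
    using assms unfolding spair_def by blast+
qed

lemma spair_DL:
  assumes "spair A S" "DL S u"
  obtains t where "prim t" "P dvd wedge t u" "z2 A t"
proof -
  obtain a b where ab: "a \<in> S" "b \<in> S" "prim (a - b)" "P dvd wedge (a - b) u"
    using assms(2) by (auto simp: DL_def)
  then have "D2 S (a - b)" unfolding D2_def by (metis dvd_0_right wedge_self)
  then have "z2 A (a - b)" by (rule spairD(9)[OF assms(1) ab(3)])
  with ab show thesis by (intro that)
qed

lemma spair_from_fourier:
  assumes A: "reduced A" "A \<noteq> {}" and S: "finite S" "card S = card A"
    and z: "\<And>s t. s \<in> S \<Longrightarrow> t \<in> S \<Longrightarrow> s \<noteq> t \<Longrightarrow> fourier A (s - t) = 0"
  shows "spair A S"
proof -
  have finA: "finite A" using A by (simp add: reduced_def)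
  have D1z: "z1 X u" if X: "finite X" and zz: "\<And>s t. s \<in> Y \<Longrightarrow> t \<in> Y \<Longrightarrow> s \<noteq> t \<Longrightarrow> fourier X (s - t) = 0"
    and Y: "reduced Y" and u: "prim u" "D1 Y u" for X Y u
  proof -
    obtain a b where ab: "a \<in> Y" "b \<in> Y" "a \<noteq> b" "dvd_pair P (a - b)" "P\<^sup>2 dvd wedge (a - b) u"
      using u(2) by (auto simp: D1_def)
    obtain y where y: "a - b = smul P y" using ab(4) by (elim dvd_pairE)
    have "\<not> dvd_pair (P\<^sup>2) (a - b)" using ab Y by (auto simp: reduced_def)
    then have pr: "prim y" using dvd_pair_P_mult[of 1 y] by (simp add: y smul_simps prim_def)
    have "fourier X (smul P y) = 0" using zz[OF ab(1-3)] by (simp add: y)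
    then have "z1 X y" using fourier_zero_iff_z1[OF X pr] by blast
    moreover have "P dvd wedge y u" using ab(5) P_pos by (simp add: y wedge_linear power2_eq_square)
    ultimately show ?thesis using z1_par[OF u(1) pr] by blast
  qed
  have D2z: "z2 X u" if X: "finite X" and zz: "\<And>s t. s \<in> Y \<Longrightarrow> t \<in> Y \<Longrightarrow> s \<noteq> t \<Longrightarrow> fourier X (s - t) = 0"
    and u: "prim u" "D2 Y u" for X Y u
  proof -
    obtain a b where ab: "a \<in> Y" "b \<in> Y" "prim (a - b)" "P\<^sup>2 dvd wedge (a - b) u"
      using u(2) by (auto simp: D2_def)
    then have "a \<noteq> b" by (auto simp: prim_def)
    then have "z2 X (a - b)" using zz ab fourier_zero_iff_z2[OF X] by blast
    then show ?thesis using z2_par[OF u(1) ab(3,4)] by blast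
  qed
  have redS: "reduced S"
    unfolding reduced_def
  proof (intro conjI ballI impI S(1), rule ccontr)
    fix s t assume st: "s \<in> S" "t \<in> S" "dvd_pair (P\<^sup>2) (s - t)" "s \<noteq> t"
    then have "fourier A (s - t) = fourier A 0" by (intro fourier_cong) simp
    with z[OF st(1,2,4)] show False using A finA by (simp add: fourier_zero)
  qed
  have dual: "fourier S (a - b) = 0" if "a \<in> A" "b \<in> A" "a \<noteq> b" for a b
    by (rule fourier_dual[OF finA S(1,2) z that])
  show ?thesis unfolding spair_def
    using A S(2) redS D1z[OF finA z redS] D1z[OF S(1) dual A(1)] D2z[OF finA z] D2z[OF S(1) dual]
    by blast
qed

text \<open>More than p^3 points force both kinds of differences in all directions, so the transform
  of \<open>A\<close> vanishes off zero and \<open>A\<close> has the size of the whole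
  group.\<close>

lemma spair_large:
  assumes sp: "spair A S" and "card A > p ^ 3"
  shows "card A = p ^ 4"
proof (rule all_z_card)
  show "reduced A" "A \<noteq> {}" using spairD[OF sp] by blast+
  fix t assume t: "prim t"
  have "D1 S t" "D2 S t"
    using not_D1_card_le[OF spairD(2)[OF sp] t] not_D2_card_le[OF spairD(2)[OF sp] t]
      assms(2) spairD(5)[OF sp] by auto
  then show "z1 A t \<and> z2 A t" using spairD(8,9)[OF sp t] by blast
qed

text \<open>Where \<open>z2 A t\<close> fails, the bound p^3 for sets without differences along
  \<open>t\<close> is attained by \<open>S\<close>, so \<open>S\<close> consists of complete
  segments along \<open>t\<close>. These supply the differences that give
  \<open>z1 A t\<close>.\<close>

lemma spair_p3:
  assumes sp: "spair A S" and card: "card A = p ^ 3"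
  shows "good A"
proof -
  have redS: "reduced S" and finS: "finite S" and cS: "card S = p ^ 3" and S: "S \<noteq> {}"
    using spairD[OF sp] card by auto
  obtain s where s: "s \<in> S" using S by blast
  have p1: "p\<^sup>2 < p ^ 3" using p_ge_2 by (simp add: power_strict_increasing)
  have seg: "seg_card S t s = p" if "prim t" "\<not> z2 A t" "s \<in> S" for t s
    using not_D2_seg_card[OF redS that(1) _ cS that(3)] spairD(9)[OF sp that(1)] that(2) by blast
  have z1: "z1 A t" if "prim t" "\<not> z2 A t" for t
    using seg_card_D1[OF s, of t] seg[OF that s] p_ge_2 spairD(8)[OF sp that(1)] by simp
  show ?thesis
  proof (cases "\<forall>u. prim u \<longrightarrow> z1 A u")
    case all: True
    \<comment> \<open>Otherwise all segments through points of \<open>S\<close>, and hence their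
      classes, are complete. But on a line with a failing lift \<open>t\<close> the \<open>p\<close>
      cosets contain at most \<open>p\<close> points each, too few for two complete classes.\<close>
    have "\<exists>u. prim u \<and> full A u"
    proof (rule ccontr)
      assume no: "\<not> ?thesis"
      have segs: "seg_card S d a = p" if "d \<in> dirs" "a \<in> S" for d a
      proof -
        have "prim d" using that dirs_prim by blast
        then obtain t where t: "prim t" "P dvd wedge t d" "\<not> z2 A t" using no unfolding full_def by blast
        then show ?thesis using seg[OF t(1,3) that(2)] seg_card_par[OF \<open>prim d\<close> t(1,2)] by simp
      qed
      have cls: "class_card S a = p\<^sup>2" if "a \<in> S" for a
        using dirs_seg_sum[OF redS that] segs[OF _ that] card_dirs by (simp add: power2_eq_square)
      obtain b where b: "b \<in> S" "prim (b - s)"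
      proof -
        have "{x\<in>S. dvd_pair P (x - s)} \<noteq> S"
          using cls[OF s] p1 cS by (metis class_card_def less_irrefl)
        then show thesis using that by (auto simp: prim_def)
      qed
      obtain t where t: "prim t" "P dvd wedge t (b - s)" "\<not> z2 A t"
        using no b(2) unfolding full_def by blast
      have nD: "\<not> D2 S t" using spairD(9)[OF sp t(1)] t(3) by blast
      have "coset_card S t x \<le> p" if "x \<in> S" for x
        using coset_eq_seg[OF nD that] seg_card_le[OF redS t(1)] by simp
      then have "line_card S t b \<le> p * p" by (rule line_card_le_of_cosets[OF finS])
      moreover have "P dvd wedge (b - s) t" using t(2) by (simp add: par_sym)
      then have "class_card S b + class_card S s \<le> line_card S t b"
        by (rule class_two_le_line[OF finS _ b(2)])
      moreover have "p * p > 0" using p_ge_2 by simp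
      ultimately show False
        using cls[OF s, unfolded power2_eq_square] cls[OF b(1), unfolded power2_eq_square] by linarith
    qed
    with all card show ?thesis unfolding good_def by blast
  next
    case False
    then obtain u where u: "prim u" "\<not> z1 A u" by blast
    have nD1: "\<not> D1 S u" using spairD(8)[OF sp u(1)] u(2) by blast
    have "\<exists>v. prim v \<and> z1 A v \<and> z2 A v \<and> (\<forall>t. prim t \<longrightarrow> \<not> P dvd wedge t v \<longrightarrow> z2 A t)"
    proof (cases "\<exists>t. prim t \<and> \<not> z2 A t")
      case True
      then obtain t where t: "prim t" "\<not> z2 A t" by blast
      \<comment> \<open>Both segments through \<open>s\<close> would fill its class, which has at
        most \<open>p\<close> points, whereas transverse segments meet in \<open>s\<close>
        only.\<close>
      have others: "z2 A t'" if t': "prim t'" "\<not> P dvd wedge t' t" for t'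
      proof (rule ccontr)
        assume n: "\<not> z2 A t'"
        have le: "class_card S s \<le> p" by (rule class_card_le[OF redS nD1])
        have eq: "{x\<in>S. dvd_pair P (x - s) \<and> P\<^sup>2 dvd wedge (x - s) w} = {x\<in>S. dvd_pair P (x - s)}"
          if "seg_card S w s = p" for w
          by (rule card_seteq) (use finS le that in \<open>auto simp: class_card_def seg_card_def\<close>)
        have "{x\<in>S. dvd_pair P (x - s) \<and> P\<^sup>2 dvd wedge (x - s) t} \<subseteq> {s}"
        proof
          fix x assume x: "x \<in> {x\<in>S. dvd_pair P (x - s) \<and> P\<^sup>2 dvd wedge (x - s) t}"
          then have x2: "P\<^sup>2 dvd wedge (x - s) t'" using eq[OF seg[OF t'(1) n s]] by blast
          obtain y where y: "x - s = smul P y" using x by (auto elim: dvd_pairE)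
          have "P\<^sup>2 dvd wedge (x - s) t" using x by blast
          with x2 have "P dvd wedge y t" "P dvd wedge y t'"
            unfolding y using P_pos by (simp_all add: wedge_linear power2_eq_square)
          then have "dvd_pair P y"
            using wedge_dvd_trans[of y 1 t' t] t'(2) par_sym[of P y]
            unfolding prim_def power_one_right by blast
          then have "dvd_pair (P\<^sup>2) (x - s)" using dvd_pair_P_mult[of 1 y] by (simp add: y smul_simps)
          then show "x \<in> {s}" using redS x s by (simp add: reduced_def)
        qed
        then have "card {x\<in>S. dvd_pair P (x - s) \<and> P\<^sup>2 dvd wedge (x - s) t} \<le> card {s}"
          by (intro card_mono) simp_all
        then have "seg_card S t s \<le> 1" by (simp add: seg_card_def)
        then show False using seg[OF t s] p_ge_2 by simp
      qed
      \<comment> \<open>Otherwise each line parallel to \<open>t\<close> would hold just one class,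
        of at most \<open>p\<close> points. The lift \<open>v\<close> obtained from this inherits
        \<open>z1\<close> from \<open>t\<close>.\<close>
      have "DL S t"
      proof (rule ccontr)
        assume "\<not> DL S t"
        then have "line_card S t a \<le> p" if "a \<in> S" for a
          using line_eq_class[OF _ that] class_card_le[OF redS nD1] by simp
        then have "card S \<le> p * p" by (rule card_le_lines[OF finS t(1)])
        then show False using cS p1 by (simp add: power2_eq_square)
      qed
      then obtain v where v: "prim v" "P dvd wedge v t" "z2 A v" using spair_DL[OF sp] by blast
      have "z1 A v" using z1[OF t] z1_par[OF t(1) v(1,2)] by blast
      moreover have "z2 A t'" if "prim t'" "\<not> P dvd wedge t' v" for t'
        using others[OF that(1)] wedge_dvd_trans[of t 1 t' v] t(1) v(2) that(2)
        unfolding power_one_right by blast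
      ultimately show ?thesis using v by blast
    next
      case False
      obtain v where "prim v" "D1 S v"
      proof (rule ccontr)
        assume "\<not> thesis"
        then have "class_card S a \<le> 1" if "a \<in> S" for a
          using class_card_one[OF redS that] \<open>\<And>v. prim v \<Longrightarrow> D1 S v \<Longrightarrow> thesis\<close> by fastforce
        then have "card S \<le> p\<^sup>2 * 1" by (rule class_bound_card_le[OF finS])
        then show False using cS p1 by simp
      qed
      then show ?thesis using False spairD(8)[OF sp] by blast
    qed
    with card show ?thesis unfolding good_def by blast
  qed
qed

text \<open>Avoiding all patterns forces the occurring classes of \<open>S\<close> to have exactly
  \<open>p\<close> points: some direction without \<open>z1\<close> bounds them by \<open>p\<close>,
  and each line parallel to \<open>d0\<close> contains just one of them. A line through two classes
  then has too many points.\<close>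

lemma spair_p2:
  assumes sp: "spair A S" and card: "card A = p\<^sup>2" and d0: "prim d0" "z1 A d0"
  shows "good A"
proof (rule ccontr)
  assume bad: "\<not> good A"
  have redS: "reduced S" and finS: "finite S" and cS: "card S = p\<^sup>2" and S: "S \<noteq> {}"
    using spairD[OF sp] card by auto
  have both: "\<not> z2 A t" if "prim t" "z1 A t" for t using bad card that unfolding good_def by blast
  obtain d where d: "prim d" "\<not> z1 A d" using bad card unfolding good_def by blast
  have nfull: "\<not> full A u" if "prim u" "\<not> P dvd wedge d0 u" for u
    using bad card that d0 unfolding good_def by blast
  have cls_le: "class_card S a \<le> p" for a
    by (rule class_card_le[OF redS]) (use spairD(8)[OF sp d(1)] d(2) in blast)
  have "\<not> DL S d0"
  proof
    assume "DL S d0"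
    then obtain t where t: "prim t" "P dvd wedge t d0" "z2 A t" using spair_DL[OF sp] by blast
    then show False using both z1_par[OF d0(1) t(1,2)] d0(2) by blast
  qed
  then have line: "line_card S d0 a = class_card S a" if "a \<in> S" for a
    using line_eq_class that by blast
  have lp: "line_card S d0 c = p" for c
    by (rule line_card_eq[OF finS d0(1)]) (use line cls_le cS in \<open>auto simp: power2_eq_square\<close>)
  then have cls: "class_card S a = p" if "a \<in> S" for a using line[OF that] by simp
  obtain s where s: "s \<in> S" using S by blast
  obtain b where b: "b \<in> S" "prim (b - s)"
  proof -
    have "{x\<in>S. dvd_pair P (x - s)} \<noteq> S"
      using cls[OF s] cS p_ge_2 by (auto simp: class_card_def power2_eq_square)
    then show thesis using that by (auto simp: prim_def)
  qed
  have "D2 S (b - s)" unfolding D2_def using b s by (metis dvd_0_right wedge_self)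
  then have z2x: "z2 A (b - s)" by (rule spairD(9)[OF sp b(2)])
  then have nz1: "\<not> z1 A (b - s)" using both b(2) by blast
  then have "\<not> P dvd wedge d0 (b - s)" using z1_par[OF b(2) d0(1)] d0(2) by blast
  then obtain t where t: "prim t" "P dvd wedge t (b - s)" "\<not> z2 A t"
    using nfull[OF b(2)] unfolding full_def by blast
  have nD: "\<not> D2 S t" using spairD(9)[OF sp t(1)] t(3) by blast
  have nD1: "\<not> D1 S t" using spairD(8)[OF sp t(1)] nz1 z1_par[OF b(2) t(1,2)] by blast
  \<comment> \<open>As \<open>S\<close> has no difference of either kind along \<open>t\<close>, the
    \<open>p\<close> cosets over this line hold at most \<open>p\<close> points of \<open>S\<close>
    altogether, but two classes of \<open>p\<close> points lie on it.\<close>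
  have "coset_card S t x \<le> 1" if "x \<in> S" for x
    using coset_eq_seg[OF nD that] seg_card_one[OF nD1 that] by simp
  then have "line_card S t b \<le> p * 1" by (rule line_card_le_of_cosets[OF finS])
  moreover have "P dvd wedge (b - s) t" using t(2) by (simp add: par_sym)
  then have "class_card S b + class_card S s \<le> line_card S t b"
    by (rule class_two_le_line[OF finS _ b(2)])
  ultimately show False using cls[OF s] cls[OF b(1)] p_ge_2 by simp
qed

text \<open>The spectrum serves as complement. A coincidence makes \<open>a - b\<close> and
  \<open>s - t\<close> opposite modulo p^2, so by duality \<open>z2 S (s - t)\<close> holds. The
  classes of \<open>S\<close> are singletons, so a line has at most \<open>p\<close> points and a
  coset at most one; but \<open>s\<close> and \<open>t\<close> share a coset.\<close>

lemma spair_p2_tile: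
  assumes sp: "spair A S" and A: "A \<subseteq> grid" and card: "card A = p\<^sup>2"
    and no: "\<And>u. prim u \<Longrightarrow> \<not> z1 A u"
  shows "tile (Zn_sq (p\<^sup>2)) A"
proof (rule tileI[OF A, of S "\<lambda>s. s"])
  have redA: "reduced A" and redS: "reduced S" and finS: "finite S" and finA: "finite A"
    and cS: "card S = p\<^sup>2"
    using spairD[OF sp] card by auto
  show "finite S" by (fact finS)
  show "card A * card S = p ^ 4" using card cS by (simp flip: power_add)
  have nD1: "\<not> D1 S u" if "prim u" for u using no[OF that] spairD(8)[OF sp that] by blast
  fix a b s t assume *: "a \<in> A" "b \<in> A" "s \<in> S" "t \<in> S" "dvd_pair (P\<^sup>2) (a - b + (s - t))"
  show "a = b \<and> s = t"
  proof (cases "s = t")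
    case True
    then show ?thesis using * redA by (simp add: reduced_def)
  next
    case False
    have "\<not> dvd_pair P (s - t)"
      using peq_pair_D1[OF redS *(3,4) False] nD1 by blast
    then have pr: "prim (s - t)" by (simp add: prim_def)
    have prA: "prim (a - b)"
      using pr dvd_pair_add_cancel'[OF dvd_pair_sq_imp[OF *(5)]] by (auto simp: prim_def)
    have par: "P\<^sup>2 dvd wedge (a - b) (s - t)"
      by (rule dvd_wedge_add_cancel[OF *(5)]) (simp add: wedge_linear)
    have "D2 S (s - t)" unfolding D2_def using * pr by (metis dvd_0_right wedge_self)
    then have zA: "z2 A (s - t)" by (rule spairD(9)[OF sp pr])
    have "D2 A (s - t)" unfolding D2_def using * prA par by blast
    then have zS: "z2 S (s - t)" by (rule spairD(9)[OF spair_sym[OF sp] pr])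
    have clsS: "class_card S x = 1" if "x \<in> S" for x by (rule class_card_one[OF redS that nD1])
    have "line_card S (s - t) s \<le> p * 1"
      by (rule line_card_le_of_classes[OF finS pr]) (use clsS in simp)
    then have "coset_card S (s - t) s \<le> 1"
      using z2_line_card[OF finS pr zS, of s] p_ge_2 by simp
    moreover have "wedge (s - s) (s - t) = 0" "wedge (t - s) (s - t) = 0"
      by (simp_all add: wedge_def algebra_simps)
    ultimately have "s = t"
      using card_le_one_eq[OF finS, of "\<lambda>x. P\<^sup>2 dvd wedge (x - s) (s - t)" s t] *(3,4)
      unfolding coset_card_def by (metis dvd_0_right)
    with False show ?thesis by blast
  qed
qed

lemma spair_dvd_card:
  assumes sp: "spair A S" and card: "card A > 1"
  obtains u where "prim u" "z1 A u \<or> z2 A u"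
proof -
  have "card S > 1" "finite S" "reduced S" using spairD[OF sp] card by auto
  then obtain a b where ab: "a \<in> S" "b \<in> S" "a \<noteq> b"
    by (metis One_nat_def card_le_Suc0_iff_eq linorder_not_le)
  show thesis
  proof (cases "prim (a - b)")
    case True
    then have "D2 S (a - b)" unfolding D2_def using ab by (metis dvd_0_right wedge_self)
    then show thesis using spairD(9)[OF sp True] that True by blast
  next
    case False
    then obtain u where "prim u" "D1 S u"
      using peq_pair_D1[OF \<open>reduced S\<close> ab] by (auto simp: prim_def)
    then show thesis using spairD(8)[OF sp] that by blast
  qed
qed

lemma spair_p_dvd:
  assumes sp: "spair A S" and card: "card A > 1"
  shows "p dvd card A"
proof -
  obtain u where u: "prim u" "z1 A u \<or> z2 A u" using spair_dvd_card[OF sp card] by blast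
  then show ?thesis
    using z1_line_card[OF spairD(3)[OF sp] u(1)] z2_dvd_card[OF spairD(3)[OF sp] u(1)]
    by (metis dvd_triv_left)
qed

lemma not_dvd_small: "0 < k \<Longrightarrow> k < p \<Longrightarrow> \<not> p dvd k"
  by (rule nat_dvd_not_less)

lemma coprime_small: "0 < k \<Longrightarrow> k < p \<Longrightarrow> coprime p k"
  by (rule prime_imp_coprime[OF prime_p not_dvd_small])

lemma other_class:
  assumes "finite A" "class_card A a < card A"
  obtains b where "b \<in> A" "prim (b - a)"
proof -
  have "{x\<in>A. dvd_pair P (x - a)} \<noteq> A" using assms(2) unfolding class_card_def by (metis less_irrefl)
  then obtain b where "b \<in> A" "\<not> dvd_pair P (b - a)" by blast
  then show thesis using that unfolding prim_def by blast
qed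

lemma dvd_line_of_classes:
  assumes "finite A" "prim u" "\<And>a. a \<in> A \<Longrightarrow> m dvd class_card A a"
  shows "m dvd line_card A u c"
proof -
  let ?L = "{a\<in>A. P dvd wedge (a - c) u}" and ?f = "\<lambda>a. (fst a mod P, snd a mod P)"
  have "m dvd card ?L"
  proof (rule dvd_card_fibers[of _ _ ?f])
    show "finite ?L" using assms(1) by simp
    fix a assume a: "a \<in> ?L"
    have "P dvd wedge (x - c) u" if "dvd_pair P (x - a)" for x
    proof -
      have "wedge (x - c) u = wedge (x - a) u + wedge (a - c) u" by (simp add: wedge_linear)
      then show ?thesis using a dvd_wedge_left[OF that, of u] by simp
    qed
    moreover have "?f x = ?f a \<longleftrightarrow> dvd_pair P (x - a)" for x
      by (simp add: dvd_pair_def mod_eq_dvd_iff)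
    ultimately have "{x\<in>?L. ?f x = ?f a} = {x\<in>A. dvd_pair P (x - a)}" by blast
    then show "m dvd card {x\<in>?L. ?f x = ?f a}" using assms(3) a by (simp add: class_card_def)
  qed
  then show ?thesis by (simp add: line_card_def)
qed

lemma dvd_class_of_segs:
  assumes "finite A" "\<And>a. a \<in> A \<Longrightarrow> m dvd seg_card A u a"
  shows "m dvd class_card A c"
proof -
  let ?L = "{a\<in>A. dvd_pair P (a - c)}" and ?f = "\<lambda>a. wedge a u mod P\<^sup>2"
  have "m dvd card ?L"
  proof (rule dvd_card_fibers[of _ _ ?f])
    show "finite ?L" using assms(1) by simp
    fix a assume a: "a \<in> ?L"
    have "dvd_pair P (x - c) \<longleftrightarrow> dvd_pair P (x - a)" for x
      using a dvd_pair_diff_cong[of P a c x] by blast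
    then have "{x\<in>?L. ?f x = ?f a} = {x\<in>A. dvd_pair P (x - a) \<and> P\<^sup>2 dvd wedge (x - a) u}"
      unfolding wedge_mod_sq_eq_iff by blast
    then show "m dvd card {x\<in>?L. ?f x = ?f a}" using assms(2) a by (simp add: seg_card_def)
  qed
  then show ?thesis by (simp add: class_card_def)
qed

lemma z1_z2_coset_card:
  assumes "finite A" "prim t" "z1 A t" "z2 A t"
  shows "p\<^sup>2 * coset_card A t c = card A"
  unfolding z1_line_card[OF assms(1-3), of c, symmetric] z2_line_card[OF assms(1,2,4), of c]
  by (simp add: power2_eq_square)

text \<open>A difference of \<open>S\<close> along \<open>u\<close> gives vanishing at some lift
  \<open>t\<close> of that direction, and \<open>z1\<close> passes from \<open>u\<close> to
  \<open>t\<close>.\<close>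

lemma spair_no_DL:
  assumes sp: "spair A S" and u: "prim u" "z1 A u" and no: "\<And>t. prim t \<Longrightarrow> z1 A t \<Longrightarrow> \<not> z2 A t"
  shows "\<not> DL S u"
proof
  assume "DL S u"
  then obtain t where t: "prim t" "P dvd wedge t u" "z2 A t" by (rule spair_DL[OF sp])
  then show False using no[OF t(1)] z1_par[OF u(1) t(1,2)] u(2) by blast
qed

lemma not_DL_card_le:
  assumes "finite A" "prim u" "\<not> DL A u" "\<And>a. a \<in> A \<Longrightarrow> class_card A a \<le> m"
  shows "card A \<le> p * m"
  by (rule card_le_lines[OF assms(1,2)]) (use line_eq_class[OF assms(3)] assms(4) in simp)

text \<open>A coset on which \<open>A\<close> is equidistributed lies in one class as soon as some parallel
  direction is not equidistributed for the partner \<open>S\<close>.\<close>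

lemma spair_nonfull_line:
  assumes sp: "spair A S" and u: "prim u" "DL S u" "\<not> full S u" and a: "a \<in> A"
  shows "line_card A u a = p * seg_card A u a"
proof -
  obtain t where t: "prim t" "P dvd wedge t u" "z2 A t" using spair_DL[OF sp u(2)] by blast
  obtain t' where t': "prim t'" "P dvd wedge t' u" "\<not> z2 S t'" using u(3) unfolding full_def by blast
  have nD: "\<not> D2 A t'" using spairD(9)[OF spair_sym[OF sp] t'(1)] t'(3) by blast
  have "P dvd wedge t' t"
    using wedge_dvd_trans[of u 1 t' t] u(1) t(2) t'(2) by simp
  then have "\<not> D2 A t" by (rule z2_not_D2_par[OF spairD(3)[OF sp] t(1) t'(1) _ t(3) nD])
  then have "coset_card A t a = seg_card A t a" using a by (rule coset_eq_seg)
  then show ?thesis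
    using z2_line_card[OF spairD(3)[OF sp] t(1,3), of a] line_card_par[OF u(1) t(1,2), of A a]
      seg_card_par[OF u(1) t(1,2), of A a] by simp
qed

section \<open>Excluded sizes of spectral sets\<close>

text \<open>The classes of \<open>S\<close> are singletons here. Hence \<open>S\<close> is full in
  no direction, and it has primitive differences in every direction, since \<open>p\<close> lines
  could not hold it otherwise.\<close>

lemma spair_small_no_z1:
  assumes sp: "spair A S" and card: "p < card A" "card A < p\<^sup>2"
    and no: "\<And>u. prim u \<Longrightarrow> \<not> z1 A u"
  shows False
proof -
  have sp': "spair S A" by (rule spair_sym[OF sp])
  have redA: "reduced A" and redS: "reduced S" and finA: "finite A" and finS: "finite S"
    and cS: "card S = card A" and A: "A \<noteq> {}" and S: "S \<noteq> {}"
    using spairD[OF sp] by auto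
  obtain s where s: "s \<in> S" using S by blast
  obtain a where a: "a \<in> A" using A by blast
  have clsS: "class_card S x = 1" if "x \<in> S" for x
    by (rule class_card_one[OF redS that]) (use no spairD(8)[OF sp] in blast)
  have DLS: "DL S u" if u: "prim u" for u
  proof (rule ccontr)
    assume "\<not> DL S u"
    then have "card S \<le> p * 1" by (rule not_DL_card_le[OF finS u]) (simp add: clsS)
    then show False using card cS by simp
  qed
  have nfullS: "\<not> full S u" if u: "prim u" for u
  proof
    assume "full S u"
    then have "class_card S s = p * seg_card S u s" by (rule full_class_card[OF finS u])
    then show False using clsS[OF s] p_ge_2 by simp
  qed
  have noS: "\<not> z2 S t" if "prim t" "z1 S t" for t
  proof
    assume "z2 S t"
    then have "p\<^sup>2 dvd card S" using z1_z2_coset_card[OF finS that] by (metis dvd_triv_left)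
    then show False using card cS p_ge_2 by (auto dest: dvd_imp_le)
  qed
  show False
  proof (cases "\<exists>u. prim u \<and> z1 S u")
    case False
    have clsA: "class_card A x = 1" if "x \<in> A" for x
      by (rule class_card_one[OF redA that]) (use False spairD(8)[OF sp'] in blast)
    \<comment> \<open>With no \<open>z1\<close> on either side the roles can be exchanged, so every
      line through \<open>s\<close> has exactly \<open>p\<close> points. The direction sum would
      then give \<open>S\<close> the size p^2.\<close>
    have "line_card S d s = p" if d: "d \<in> dirs" for d
    proof -
      have pd: "prim d" using d dirs_prim by blast
      have DLA: "DL A d"
      proof (rule ccontr)
        assume "\<not> DL A d"
        then have "card A \<le> p * 1" by (rule not_DL_card_le[OF finA pd]) (simp add: clsA)
        then show False using card by simp
      qed
      have "\<not> full A d"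
      proof
        assume "full A d"
        then have "class_card A a = p * seg_card A d a" by (rule full_class_card[OF finA pd])
        then show False using clsA[OF a] p_ge_2 by simp
      qed
      then have "line_card S d s = p * seg_card S d s"
        by (rule spair_nonfull_line[OF sp' pd DLA _ s])
      moreover have "seg_card S d s = 1"
        using seg_le_class[OF finS, of d s] seg_card_pos[OF finS s, of d] clsS[OF s] by simp
      ultimately show ?thesis by simp
    qed
    then have "(p + 1) * p = card S + p * class_card S s"
      using dirs_line_sum[OF finS, of s] card_dirs by simp
    then show False using clsS[OF s] card cS by (simp add: power2_eq_square)
  next
    case True
    then obtain u where u: "prim u" "z1 S u" by blast
    have nDL: "\<not> DL A u" by (rule spair_no_DL[OF sp' u noS])
    obtain t where t: "prim t" "P dvd wedge t u" "z2 A t" using spair_DL[OF sp DLS[OF u(1)]] by blast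
    have "z1 S t" using z1_par[OF u(1) t(1,2)] u(2) by blast
    then have nD2: "\<not> D2 A t" using noS[OF t(1)] spairD(9)[OF sp' t(1)] by blast
    have clsA: "class_card A x = p * seg_card A u x" if x: "x \<in> A" for x
      using line_eq_class[OF nDL x] z2_line_card[OF finA t(1,3), of x] coset_eq_seg[OF nD2 x]
        line_card_par[OF u(1) t(1,2), of A x] seg_card_par[OF u(1) t(1,2), of A x] by simp
    \<comment> \<open>A larger class contains differences along every direction. All directions
      would then satisfy \<open>z1\<close> for \<open>S\<close>, and p^2 would divide its
      size.\<close>
    have clsA_le: "class_card A x \<le> p" for x
    proof (rule ccontr)
      assume big: "\<not> class_card A x \<le> p"
      have "z1 S v" if v: "prim v" for v
        using class_card_le[OF redA, of v x] big spairD(8)[OF sp' v] by blast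
      then have "p\<^sup>2 * class_card S s = card S" by (rule all_z1_class_card[OF finS])
      then show False using clsS[OF s] card cS by simp
    qed
    have clsA: "class_card A x = p" if x: "x \<in> A" for x
      using clsA[OF x] clsA_le[of x] seg_card_pos[OF finA x, of u] p_ge_2
      by (cases "seg_card A u x") auto
    obtain b where b: "b \<in> A" "prim (b - a)"
      using other_class[OF finA, of a] clsA[OF a] card by auto
    have "D2 A (b - a)" unfolding D2_def using a b by (metis dvd_0_right wedge_self)
    then have "z2 S (b - a)" by (rule spairD(9)[OF sp' b(2)])
    then have "\<not> D1 A (b - a)" using noS[OF b(2)] spairD(8)[OF sp' b(2)] by blast
    then have "seg_card A (b - a) b = 1" using b(1) by (rule seg_card_one)
    \<comment> \<open>The line through \<open>a\<close> and \<open>b\<close> must accommodate two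
      classes of \<open>p\<close> points each.\<close>
    then have "line_card A (b - a) b = p"
      using spair_nonfull_line[OF sp b(2) DLS[OF b(2)] nfullS[OF b(2)] b(1)] by simp
    moreover have "class_card A b + class_card A a \<le> line_card A (b - a) b"
      by (rule class_two_le_line[OF finA _ b(2)]) (simp add: wedge_self)
    ultimately show False using clsA[OF a] clsA[OF b(1)] p_ge_2 by simp
  qed
qed

text \<open>The size is p k with 1 < k < p, and both sets turn out to have \<open>k\<close> points
  in each occurring class. Coprimality of \<open>k\<close> and \<open>p\<close> then confines
  \<open>S\<close> to one line modulo \<open>p\<close>.\<close>

lemma spair_small_z1:
  assumes sp: "spair A S" and card: "p < card A" "card A < p\<^sup>2"
    and u: "prim u" "z1 A u" and u': "prim u'" "z1 S u'"
  shows False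
proof -
  have sp': "spair S A" by (rule spair_sym[OF sp])
  have finA: "finite A" and finS: "finite S" and cS: "card S = card A" and A: "A \<noteq> {}" and S: "S \<noteq> {}"
    using spairD[OF sp] by auto
  obtain s where s: "s \<in> S" using S by blast
  obtain a where a: "a \<in> A" using A by blast
  have no: "\<not> z2 X t" if "finite X" "card X = card A" "prim t" "z1 X t" for X t
  proof
    assume "z2 X t"
    then have "p\<^sup>2 dvd card X" using z1_z2_coset_card[OF that(1,3,4)] by (metis dvd_triv_left)
    then show False using card that(2) p_ge_2 by (auto dest: dvd_imp_le)
  qed
  define k where "k = line_card A u 0"
  have pk: "card A = p * k" unfolding k_def using z1_line_card[OF finA u] by simp
  have k: "1 < k" "k < p" using card unfolding pk power2_eq_square by simp_all
  have cop: "coprime p k"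
    using k by (intro coprime_small) auto
  have lineA: "line_card A u c = k" for c
    using z1_line_card[OF finA u, of c] pk p_ge_2 by simp
  have lineS: "line_card S u' c = k" for c
    using z1_line_card[OF finS u', of c] pk cS p_ge_2 by simp
  \<comment> \<open>A line parallel to \<open>u\<close> contains only one class of \<open>S\<close>,
    and this class fits into a line parallel to \<open>u'\<close>, which has \<open>k\<close>
    points. Since \<open>p\<close> such lines hold p k points, equality holds everywhere.\<close>
  have lineS2: "line_card S u c = k" for c
  proof (rule line_card_eq[OF finS u(1)])
    fix x assume "x \<in> S"
    then have "line_card S u x = class_card S x"
      using line_eq_class spair_no_DL[OF sp u no[OF finA refl]] by blast
    then show "line_card S u x \<le> k" using class_le_line[OF finS, of x u'] lineS[of x] by simp
  qed (use cS pk in simp)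
  have clsS: "class_card S x = k" if "x \<in> S" for x
    using line_eq_class[OF spair_no_DL[OF sp u no[OF finA refl]] that] lineS2[of x] by simp
  have nDLA: "\<not> DL A u'" by (rule spair_no_DL[OF sp' u' no[OF finS cS]])
  have "line_card A u' c = k" for c
  proof (rule line_card_eq[OF finA u'(1) _ pk])
    fix x assume "x \<in> A"
    then show "line_card A u' x \<le> k"
      using line_eq_class[OF nDLA] class_le_line[OF finA, of x u] lineA[of x] by simp
  qed
  then have clsA: "class_card A x = k" if "x \<in> A" for x
    using line_eq_class[OF nDLA that] by simp
  have kp: "k < card A" using pk k by simp
  obtain b where b: "b \<in> A" "prim (b - a)" using other_class[OF finA, of a] clsA[OF a] kp by auto
  obtain r where r: "r \<in> S" "prim (r - s)" using other_class[OF finS, of s] clsS[OF s] kp cS by auto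
  define x where "x = b - a"
  have "D2 A x" unfolding D2_def x_def using a b by (metis dvd_0_right wedge_self)
  then have z2S: "z2 S x" using spairD(9)[OF sp'] b(2) by (simp add: x_def)
  have px: "prim x" using b(2) by (simp add: x_def)
  \<comment> \<open>The number of points on this line is a multiple of \<open>k\<close>, as whole
    classes lie on it, and of \<open>p\<close> by \<open>z2\<close>, hence of the size of
    \<open>S\<close>.\<close>
  have all: "P dvd wedge (q - s) x" if "q \<in> S" for q
  proof -
    have "k dvd line_card S x s" by (rule dvd_line_of_classes[OF finS px]) (simp add: clsS)
    moreover have "p dvd line_card S x s" by (simp add: z2_line_card[OF finS px z2S])
    ultimately have "p * k dvd line_card S x s" using cop by (simp add: divides_mult)
    moreover have "line_card S x s > 0"
      using class_le_line[OF finS, of s x] clsS[OF s] k by simp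
    ultimately have "card S \<le> line_card S x s" using pk cS by (simp add: dvd_imp_le)
    then have "{q\<in>S. P dvd wedge (q - s) x} = S"
      unfolding line_card_def by (intro card_seteq finS) auto
    then show ?thesis using that by blast
  qed
  have "D2 S (r - s)" unfolding D2_def using r s by (metis dvd_0_right wedge_self)
  then have "z2 A (r - s)" by (rule spairD(9)[OF sp r(2)])
  then have "\<not> z1 A (r - s)" using no[OF finA refl r(2)] by blast
  moreover have rx: "P dvd wedge (r - s) x" by (rule all[OF r(1)])
  ultimately have nz1x: "\<not> z1 A x" using z1_par[OF px r(2)] by blast
  then have nxu: "\<not> P dvd wedge x u" using z1_par[OF u(1) px] u(2) by blast
  have "\<not> full A x"
  proof
    assume "full A x"
    then have "class_card A a = p * seg_card A x a" by (rule full_class_card[OF finA px])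
    then have "p dvd k" using clsA[OF a] by simp
    then show False using k not_dvd_small[of k] by simp
  qed
  then obtain t where t: "prim t" "P dvd wedge t x" "\<not> z2 A t" unfolding full_def by blast
  have nD: "\<not> D2 S t" using spairD(9)[OF sp t(1)] t(3) by blast
  \<comment> \<open>Each line parallel to \<open>u\<close> meets \<open>S\<close>, and
    \<open>S\<close> lies on one line transverse to \<open>u\<close>, so each of the
    \<open>p\<close> classes on that line occurs.\<close>
  have occ: "class_card S (s + smul i t) > 0" for i
  proof -
    have "line_card S u (s + smul i t) \<noteq> 0" using lineS2 k by simp
    then have "{q\<in>S. P dvd wedge (q - (s + smul i t)) u} \<noteq> {}"
      unfolding line_card_def by (metis card.empty)
    then obtain q where q: "q \<in> S" "P dvd wedge (q - (s + smul i t)) u" by blast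
    have "wedge (q - (s + smul i t)) x = wedge (q - s) x - i * wedge t x" by (simp add: wedge_linear)
    then have "P dvd wedge (q - (s + smul i t)) x" using all[OF q(1)] t(2) by simp
    then have "dvd_pair P (q - (s + smul i t))"
      using wedge_dvd_trans[of "q - (s + smul i t)" 1 x u] q(2) nxu par_sym[of P "q - (s + smul i t)"]
      unfolding prim_def power_one_right by blast
    then have "class_card S q = class_card S (s + smul i t)" by (rule class_card_cong)
    then show ?thesis using clsS[OF q(1)] k by simp
  qed
  have "seg_card S t s = k" using not_D2_class_eq_seg[OF finS t(1) nD s occ] clsS[OF s] by simp
  then have "D1 S t" using seg_card_D1[OF s] k by simp
  then have "z1 A t" by (rule spairD(8)[OF sp t(1)])
  then show False using nz1x z1_par[OF px t(1,2)] by blast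
qed

lemma spair_small:
  assumes sp: "spair A S" and card: "p < card A" "card A < p\<^sup>2"
  shows False
proof (cases "(\<exists>u. prim u \<and> z1 A u) \<and> (\<exists>u. prim u \<and> z1 S u)")
  case True
  then show False using spair_small_z1[OF sp card] by blast
next
  case False
  have cS: "card S = card A" by (rule spairD(5)[OF sp])
  from False show False
    using spair_small_no_z1[OF sp card] spair_small_no_z1[OF spair_sym[OF sp]] card cS by auto
qed

section \<open>Sizes strictly between p^2 and p^3\<close>

text \<open>Vanishing at all elements of order p^2 makes \<open>A\<close> a union of complete
  classes. One direction with \<open>z1\<close> would then give divisibility by p^3, and without any
  such direction the classes of \<open>S\<close> are singletons.\<close>

lemma spair_mid_not_all_z2:
  assumes sp: "spair A S" and card: "p\<^sup>2 < card A" "card A < p ^ 3"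
  obtains t where "prim t" "\<not> z2 A t"
proof (rule ccontr)
  assume "\<not> thesis"
  then have all: "z2 A t" if "prim t" for t using that \<open>\<And>t. prim t \<Longrightarrow> \<not> z2 A t \<Longrightarrow> thesis\<close> by blast
  have redA: "reduced A" and redS: "reduced S" and finA: "finite A" and finS: "finite S"
    and cS: "card S = card A"
    using spairD[OF sp] by auto
  have cls: "class_card A a = p\<^sup>2" if "a \<in> A" for a by (rule z2_all_class_card[OF redA that all])
  show False
  proof (cases "\<exists>u. prim u \<and> z1 A u")
    case True
    then obtain u where u: "prim u" "z1 A u" by blast
    have "p\<^sup>2 dvd line_card A u 0" by (rule dvd_line_of_classes[OF finA u(1)]) (simp add: cls)
    then have "p * p\<^sup>2 dvd p * line_card A u 0" by (rule mult_dvd_mono[OF dvd_refl])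
    then have "p * p\<^sup>2 dvd card A" unfolding z1_line_card[OF finA u] .
    then have "p ^ 3 dvd card A" by (simp add: power2_eq_square power3_eq_cube mult.assoc)
    then have "p ^ 3 \<le> card A" by (rule dvd_imp_le) (use card in simp)
    then show False using card by simp
  next
    case False
    have "class_card S s = 1" if "s \<in> S" for s
      by (rule class_card_one[OF redS that]) (use False spairD(8)[OF sp] in blast)
    then have "card S \<le> p\<^sup>2 * 1" by (intro class_bound_card_le[OF finS]) simp
    then show False using card cS by simp
  qed
qed

lemma spair_mid_z:
  assumes sp: "spair A S" and card: "p\<^sup>2 < card A" and u: "prim u"
  shows "z1 A u \<or> z2 A u"
  using pigeonhole_coset[OF spairD(4)[OF sp], of u] card spairD(5)[OF sp] spairD(8,9)[OF sp u] by auto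

lemma spair_mid_z1_or_full:
  assumes sp: "spair A S" and card: "p\<^sup>2 < card A" and u: "prim u"
  shows "z1 A u \<or> full A u"
proof (rule disjCI)
  assume n: "\<not> full A u"
  then obtain t where t: "prim t" "P dvd wedge t u" "\<not> z2 A t" unfolding full_def by blast
  then have "z1 A t" using spair_mid_z[OF sp card t(1)] by blast
  then show "z1 A u" using z1_par[OF u t(1,2)] by blast
qed

text \<open>In the remaining mixed case the lines of \<open>S\<close> parallel to \<open>t\<close>
  contain one class each, of at most \<open>p\<close> points, so that \<open>S\<close> has at most
  p^2 points, contrary to the assumed size.\<close>

lemma spair_mid_dvd:
  assumes sp: "spair A S" and card: "p\<^sup>2 < card A" "card A < p ^ 3"
  shows "p\<^sup>2 dvd card A"
proof -
  have redS: "reduced S" and finA: "finite A" and finS: "finite S" and cS: "card S = card A"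
    using spairD[OF sp] by auto
  obtain t where t: "prim t" "\<not> z2 A t" using spair_mid_not_all_z2[OF sp card] by blast
  then have z1t: "z1 A t" using spair_mid_z[OF sp card(1)] by blast
  consider (both) w where "prim w" "z1 A w" "z2 A w" | (all) "\<forall>u. prim u \<longrightarrow> z1 A u"
    | (mixed) u where "\<And>w. prim w \<Longrightarrow> z1 A w \<Longrightarrow> \<not> z2 A w" "prim u" "\<not> z1 A u"
    by blast
  then show ?thesis
  proof cases
    case both
    then show ?thesis using z1_z2_coset_card[OF finA, of w] by (metis dvd_triv_left)
  next
    case all
    then show ?thesis using all_z1_class_card[OF finA, of 0] by (metis dvd_triv_left)
  next
    case mixed
    have nDL: "\<not> DL S t" by (rule spair_no_DL[OF sp t(1) z1t mixed(1)])
    have "card S \<le> p * p"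
      by (rule not_DL_card_le[OF finS t(1) nDL], rule class_card_le[OF redS, of u])
        (use spairD(8)[OF sp mixed(2)] mixed(3) in blast)
    then show ?thesis using card cS by (simp add: power2_eq_square)
  qed
qed

text \<open>A larger class of \<open>A\<close> gives \<open>z1\<close> in all directions for
  \<open>S\<close>, so every class of \<open>S\<close> has \<open>k\<close> points. This makes
  \<open>S\<close> nowhere full, which fixes the segments of \<open>A\<close> in all directions with
  \<open>z1\<close>.\<close>

lemma spair_mid_class_le:
  assumes sp: "spair A S" and card: "card A = p\<^sup>2 * k" and k: "1 < k" "k < p" and a: "a \<in> A"
  shows "class_card A a \<le> p"
proof (rule ccontr)
  assume big: "\<not> class_card A a \<le> p"
  have sp': "spair S A" by (rule spair_sym[OF sp])
  have redA: "reduced A" and finA: "finite A" and finS: "finite S" and cS: "card S = card A" and S: "S \<noteq> {}"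
    using spairD[OF sp] by auto
  obtain s where s: "s \<in> S" using S by blast
  have cA: "p\<^sup>2 < card A" "card A < p ^ 3"
    using k card p_ge_2 by (simp_all add: power2_eq_square power3_eq_cube)
  have "z1 S v" if v: "prim v" for v
    using class_card_le[OF redA, of v a] big spairD(8)[OF sp' v] by blast
  then have "p\<^sup>2 * class_card S c = card S" for c by (rule all_z1_class_card[OF finS])
  then have clsS: "class_card S c = k" for c using p_ge_2 unfolding cS card by simp
  have nfullS: "\<not> full S u" if u: "prim u" for u
  proof
    assume "full S u"
    then have "class_card S s = p * seg_card S u s" by (rule full_class_card[OF finS u])
    then have "p dvd k" using clsS[of s] by simp
    then show False using k not_dvd_small[of k] by simp
  qed
  have DLS: "DL S u" if u: "prim u" for u
  proof -
    obtain x where x: "x \<in> S" "dvd_pair P (x - (s + u))"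
      using class_cardE[of S "s + u"] clsS k by auto
    have eq: "x - s = (x - (s + u)) + u" by simp
    have "prim (x - s)"
      using u x(2) dvd_pair_add_cancel'[of P "x - (s + u)" u] unfolding prim_def eq by blast
    moreover have "P dvd wedge (x - s) u"
      unfolding eq wedge_add_left using dvd_wedge_left[OF x(2)] by (simp add: wedge_self)
    ultimately show ?thesis using x(1) s unfolding DL_def by blast
  qed
  have line: "line_card A u x = p * seg_card A u x" if "prim u" "x \<in> A" for u x
    by (rule spair_nonfull_line[OF sp that(1) DLS[OF that(1)] nfullS[OF that(1)] that(2)])
  have lz1: "line_card A u x = p * k" if "prim u" "z1 A u" for u x
    using z1_line_card[OF finA that, of x] card p_ge_2 by (simp add: power2_eq_square)
  have seg: "seg_card A u x = k" if "prim u" "z1 A u" "x \<in> A" for u x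
    using line[OF that(1,3)] lz1[OF that(1,2), of x] p_ge_2 by simp
  obtain t where t: "prim t" "\<not> z2 A t" using spair_mid_not_all_z2[OF sp cA] by blast
  then have z1t: "z1 A t" using spair_mid_z[OF sp cA(1)] by blast
  have "\<not> (\<forall>u. prim u \<longrightarrow> z1 A u)"
  proof
    assume all: "\<forall>u. prim u \<longrightarrow> z1 A u"
    have "p\<^sup>2 * class_card A a = card A" by (rule all_z1_class_card[OF finA]) (use all in blast)
    then have "class_card A a = k" unfolding card using p_ge_2 by simp
    then show False using big k by simp
  qed
  then obtain u where u: "prim u" "\<not> z1 A u" by blast
  then have "full A u" using spair_mid_z1_or_full[OF sp cA(1)] by blast
  then have "p dvd class_card A a" using full_class_card[OF finA u(1), of a] by simp
  moreover have "k dvd class_card A a"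
    by (rule dvd_class_of_segs[OF finA, of _ t]) (simp add: seg[OF t(1) z1t])
  moreover have "coprime p k"
    using k by (intro coprime_small) auto
  \<comment> \<open>The factor \<open>p\<close> comes from a full direction, the factor
    \<open>k\<close> from the segments along \<open>t\<close>. The class lies in a line of p k
    points and therefore has p k points.\<close>
  ultimately have "p * k dvd class_card A a" by (simp add: divides_mult)
  then have "p * k \<le> class_card A a" using class_card_pos[OF finA a] by (rule dvd_imp_le)
  moreover have "class_card A a \<le> p * k" using class_le_line[OF finA, of a t] lz1[OF t(1) z1t] by simp
  ultimately have cls: "class_card A a = p * k" by simp
  have "seg_card A d a = k" if d: "d \<in> dirs" for d
  proof -
    have pd: "prim d" using d dirs_prim by blast
    show ?thesis
    proof (cases "z1 A d")
      case True
      then show ?thesis by (rule seg[OF pd _ a])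
    next
      case False
      then have "full A d" using spair_mid_z1_or_full[OF sp cA(1) pd] by blast
      then show ?thesis using full_class_card[OF finA pd, of a] cls p_ge_2 by simp
    qed
  qed
  \<comment> \<open>The direction sum leaves \<open>k = p\<close>, which is excluded.\<close>
  then have "(p + 1) * k = p * k + p" using dirs_seg_sum[OF redA a] card_dirs cls by simp
  then show False using k by simp
qed

text \<open>The bound on classes holds for both sets, which makes their full directions coincide and
  gives \<open>k\<close> points to every segment of \<open>A\<close> in the other directions. The
  direction sum or divisibility then excludes 1 < k < p.\<close>

lemma spair_mid:
  assumes sp: "spair A S" and cA: "p\<^sup>2 < card A" "card A < p ^ 3"
  shows False
proof -
  have sp': "spair S A" by (rule spair_sym[OF sp])
  have redA: "reduced A" and finA: "finite A" and finS: "finite S" and cS: "card S = card A" and A: "A \<noteq> {}"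
    using spairD[OF sp] by auto
  obtain a where a: "a \<in> A" using A by blast
  obtain k where k: "card A = p\<^sup>2 * k" using spair_mid_dvd[OF sp cA] by (elim dvdE)
  have k2: "1 < k" "k < p" using cA p_ge_2 unfolding k by (simp_all add: power2_eq_square power3_eq_cube)
  have clsA: "class_card A x \<le> p" if "x \<in> A" for x by (rule spair_mid_class_le[OF sp k k2 that])
  have clsS: "class_card S x \<le> p" if "x \<in> S" for x
    by (rule spair_mid_class_le[OF sp' _ k2 that]) (simp add: cS k)
  have DLA: "DL A u" if u: "prim u" for u
  proof (rule ccontr)
    assume "\<not> DL A u"
    then have "card A \<le> p * p" by (rule not_DL_card_le[OF finA u _ clsA])
    then show False using cA by (simp add: power2_eq_square)
  qed
  have DLS: "DL S u" if u: "prim u" for u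
  proof (rule ccontr)
    assume "\<not> DL S u"
    then have "card S \<le> p * p" by (rule not_DL_card_le[OF finS u _ clsS])
    then show False using cA cS by (simp add: power2_eq_square)
  qed
  \<comment> \<open>If \<open>A\<close> were full but \<open>S\<close> not, a line of
    \<open>A\<close> along \<open>u\<close> would have as many points as one class, at most
    \<open>p\<close>.\<close>
  have fullAS: "full S u" if u: "prim u" "full A u" for u
  proof (rule ccontr)
    assume n: "\<not> full S u"
    have "line_card A u x \<le> p" if x: "x \<in> A" for x
      using spair_nonfull_line[OF sp u(1) DLS[OF u(1)] n x] full_class_card[OF finA u, of x] clsA[OF x] by simp
    then have "card A \<le> p * p" by (rule card_le_lines[OF finA u(1)])
    then show False using cA by (simp add: power2_eq_square)
  qed
  have fullSA: "full A u" if u: "prim u" "full S u" for u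
  proof (rule ccontr)
    assume n: "\<not> full A u"
    have "line_card S u x \<le> p" if x: "x \<in> S" for x
      using spair_nonfull_line[OF sp' u(1) DLA[OF u(1)] n x] full_class_card[OF finS u, of x] clsS[OF x] by simp
    then have "card S \<le> p * p" by (rule card_le_lines[OF finS u(1)])
    then show False using cA cS by (simp add: power2_eq_square)
  qed
  have seg: "seg_card A u x = k" if "prim u" "\<not> full A u" "x \<in> A" for u x
  proof -
    have "z1 A u" using spair_mid_z1_or_full[OF sp cA(1) that(1)] that(2) by blast
    then have "p * line_card A u x = p\<^sup>2 * k" unfolding k[symmetric] by (rule z1_line_card[OF finA that(1)])
    then have "line_card A u x = p * k" using p_ge_2 by (simp add: power2_eq_square)
    moreover have "\<not> full S u" using fullSA[OF that(1)] that(2) by blast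
    then have "line_card A u x = p * seg_card A u x"
      by (rule spair_nonfull_line[OF sp that(1) DLS[OF that(1)] _ that(3)])
    ultimately show ?thesis using p_ge_2 by simp
  qed
  show False
  proof (cases "\<forall>u. prim u \<longrightarrow> z1 A u")
    case True
    have "p\<^sup>2 * class_card A a = card A" by (rule all_z1_class_card[OF finA]) (use True in blast)
    then have cls: "class_card A a = k" unfolding k using p_ge_2 by simp
    have "seg_card A d a = k" if d: "d \<in> dirs" for d
    proof (rule seg[OF dirs_prim[OF d] _ a])
      show "\<not> full A d"
      proof
        assume "full A d"
        then have "class_card A a = p * seg_card A d a" by (rule full_class_card[OF finA dirs_prim[OF d]])
        then have "p dvd k" using cls by simp
        then show False using k2 not_dvd_small[of k] by simp
      qed
    qed
    then have "(p + 1) * k = k + p" using dirs_seg_sum[OF redA a] card_dirs cls by simp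
    then show False using k2 p_ge_2 by simp
  next
    case False
    then obtain u where u: "prim u" "\<not> z1 A u" by blast
    then have "full A u" using spair_mid_z1_or_full[OF sp cA(1)] by blast
    then have pd: "p dvd class_card A a" using full_class_card[OF finA u(1), of a] by simp
    obtain t where t: "prim t" "\<not> z2 A t" using spair_mid_not_all_z2[OF sp cA] by blast
    have "\<not> full A t" unfolding full_def using t by (metis dvd_0_right wedge_self)
    then have "k dvd class_card A a"
      by (intro dvd_class_of_segs[OF finA, of _ t]) (simp add: seg[OF t(1)])
    moreover have "class_card A a = p"
      using pd clsA[OF a] class_card_pos[OF finA a] by (meson dvd_imp_le le_antisym)
    ultimately have "k dvd p" by simp
    then show False using k2 prime_p by (auto simp: prime_nat_iff)
  qed
qed

section \<open>Tiling pairs\<close>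

text \<open>The tiling enters only through the sizes and the zeros of the transforms, separated by
  the order of the frequency: \<open>z1\<close> for order \<open>p\<close>, \<open>z2\<close> for
  order p^2.\<close>

definition tpair :: "(int \<times> int) set \<Rightarrow> (int \<times> int) set \<Rightarrow> bool" where
  "tpair A B \<longleftrightarrow> reduced A \<and> reduced B \<and> card A * card B = p ^ 4 \<and>
    (\<forall>t. prim t \<longrightarrow> (z1 A t \<or> z1 B t) \<and> (z2 A t \<or> z2 B t))"

lemma tpairD:
  assumes "tpair A B"
  shows "reduced A" "reduced B" "finite A" "finite B" "A \<noteq> {}" "B \<noteq> {}" "card A * card B = p ^ 4"
    "prim t \<Longrightarrow> z1 A t \<or> z1 B t" "prim t \<Longrightarrow> z2 A t \<or> z2 B t"
proof -
  show "reduced A" "reduced B" "card A * card B = p ^ 4" using assms by (simp_all add: tpair_def)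
  then show "finite A" "finite B" by (simp_all add: reduced_def)
  have "card A * card B \<noteq> 0" using \<open>card A * card B = p ^ 4\<close> p_ge_2 by simp
  then show "A \<noteq> {}" "B \<noteq> {}" by auto
  show "prim t \<Longrightarrow> z1 A t \<or> z1 B t" "prim t \<Longrightarrow> z2 A t \<or> z2 B t"
    using assms unfolding tpair_def by blast+
qed

lemma tile_tpair:
  assumes A: "A \<subseteq> grid" and "tile (Zn_sq (p\<^sup>2)) A"
  obtains B where "tpair A B"
proof -
  obtain B where B: "B \<subseteq> grid" "card A * card B = p ^ 4"
    "\<And>s. \<not> dvd_pair (P\<^sup>2) s \<Longrightarrow> fourier A s = 0 \<or> fourier B s = 0"
    using tile_fourier[OF assms] by blast
  have red: "reduced A" "reduced B" using reduced_grid A B(1) by blast+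
  then have fin: "finite A" "finite B" by (simp_all add: reduced_def)
  have "(z1 A t \<or> z1 B t) \<and> (z2 A t \<or> z2 B t)" if t: "prim t" for t
  proof -
    have 1: "\<not> dvd_pair (P\<^sup>2) t" using t dvd_pair_sq_imp unfolding prim_def by blast
    have 2: "\<not> dvd_pair (P\<^sup>2) (smul P t)"
      using dvd_pair_P_mult[of 1 t] t by (simp add: smul_simps prim_def)
    show ?thesis
      using B(3)[OF 1] B(3)[OF 2] fourier_zero_iff_z1[OF fin(1) t] fourier_zero_iff_z1[OF fin(2) t]
        fourier_zero_iff_z2[OF fin(1) t] fourier_zero_iff_z2[OF fin(2) t] by blast
  qed
  then have "tpair A B" using red B(2) unfolding tpair_def by blast
  then show thesis by (rule that)
qed

text \<open>If no coefficient of \<open>A\<close> vanished, all those of \<open>B\<close> off zero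
  would, and \<open>B\<close> would be the whole group.\<close>

lemma all_z_exhaust:
  assumes "tpair A B" "card A \<noteq> 1"
  obtains u where "prim u" "z1 A u \<or> z2 A u"
proof (rule ccontr)
  assume no: "\<not> thesis"
  have "card B = p ^ 4"
  proof (rule all_z_card[OF tpairD(2,6)[OF assms(1)]])
    fix t assume "prim t"
    then show "z1 B t \<and> z2 B t" using no that tpairD(8,9)[OF assms(1), of t] by blast
  qed
  then show False using tpairD(7)[OF assms(1)] assms(2) p_ge_2 by simp
qed

text \<open>The count on the line is a positive multiple of \<open>p\<close> bounded by
  \<open>p\<close>. So the whole of \<open>B\<close> lies on this line.\<close>

lemma line_card_prime:
  assumes "finite B" "card B = p" "prim t" "z2 B t" "b \<in> B"
  shows "line_card B t b = p" "coset_card B t b = 1"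
proof -
  have eq: "line_card B t b = p * coset_card B t b" by (rule z2_line_card[OF assms(1,3,4)])
  have "line_card B t b \<le> card B" unfolding line_card_def by (rule card_mono[OF assms(1)]) auto
  then have "p * coset_card B t b \<le> p" using eq assms(2) by simp
  then have "coset_card B t b \<le> 1" using p_ge_2 by simp
  with coset_card_pos[OF assms(1,5), of t] show "coset_card B t b = 1" by simp
  with eq show "line_card B t b = p" by simp
qed

lemma tpair_p3:
  assumes tp: "tpair A B" and card: "card A = p ^ 3"
  shows "good A"
proof -
  have redB: "reduced B" and finB: "finite B" and B: "B \<noteq> {}" using tpairD[OF tp] by auto
  have "p ^ 3 * card B = p ^ 3 * p"
    using tpairD(7)[OF tp] card by (simp add: power3_eq_cube power4_eq_xxxx)
  then have cB: "card B = p" using p_ge_2 by simp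
  obtain b where b: "b \<in> B" using B by blast
  have on_line: "P dvd wedge (x - b) t" if "prim t" "z2 B t" "x \<in> B" for t x
  proof -
    have "{x\<in>B. P dvd wedge (x - b) t} = B"
      using line_card_prime(1)[OF finB cB that(1,2) b] cB finB
      by (intro card_seteq) (auto simp: line_card_def)
    then show ?thesis using that(3) by blast
  qed
  show ?thesis
  proof (cases "\<exists>d. prim d \<and> z1 B d")
    case False
    then have all: "z1 A u" if "prim u" for u using tpairD(8)[OF tp that] that by blast
    have "\<exists>u. prim u \<and> full A u"
    proof (rule ccontr)
      assume no: "\<nexists>u. prim u \<and> full A u"
      \<comment> \<open>If no direction were full for \<open>A\<close>, then \<open>B\<close> would
        lie on one line in every direction. The direction sum for lines then gives \<open>p\<close>
        points in the class of \<open>b\<close>, that for segments only one.\<close>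
      have *: "line_card B d b = p \<and> seg_card B d b = 1" if d: "d \<in> dirs" for d
      proof -
        have pd: "prim d" using d dirs_prim by blast
        obtain t where t: "prim t" "P dvd wedge t d" "\<not> z2 A t"
          using no pd unfolding full_def by blast
        then have z: "z2 B t" using tpairD(9)[OF tp t(1)] by blast
        have "seg_card B t b = 1"
          using seg_le_coset[OF finB, of t b] seg_card_pos[OF finB b, of t]
            line_card_prime(2)[OF finB cB t(1) z b] by simp
        then show ?thesis
          using line_card_prime(1)[OF finB cB t(1) z b] line_card_par[OF pd t(1,2), of B b]
            seg_card_par[OF pd t(1,2), of B b] by simp
      qed
      have "(p + 1) * p = p + p * class_card B b"
        using dirs_line_sum[OF finB, of b] * card_dirs cB by simp
      then have "p * p = p * class_card B b" by simp
      then have "class_card B b = p" using p_ge_2 by simp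
      moreover have "p + 1 = class_card B b + p"
        using dirs_seg_sum[OF redB b] * card_dirs by simp
      ultimately show False using p_ge_2 by simp
    qed
    then show ?thesis using all card unfolding good_def by blast
  next
    case True
    then obtain d where d: "prim d" "z1 B d" by blast
    have "p * line_card B d b = p" using z1_line_card[OF finB d, of b] cB by simp
    then have "line_card B d b = 1" using p_ge_2 by simp
    then have cls: "class_card B b = 1"
      using class_le_line[OF finB, of b d] class_card_pos[OF finB b] by simp
    have nfull: "\<not> full B u" if u: "prim u" for u
    proof
      assume "full B u"
      then have "class_card B b = p * seg_card B u b" by (rule full_class_card[OF finB u])
      then show False using cls p_ge_2 by simp
    qed
    have "\<exists>v. prim v \<and> z1 A v \<and> z2 A v \<and> (\<forall>t. prim t \<longrightarrow> \<not> P dvd wedge t v \<longrightarrow> z2 A t)"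
    proof (cases "\<exists>x. prim x \<and> z2 B x")
      case True
      then obtain x where x: "prim x" "z2 B x" by blast
      obtain c where c: "c \<in> B" "prim (c - b)" using other_class[OF finB, of b] cls cB p_ge_2 by auto
      \<comment> \<open>Two directions modulo \<open>p\<close> with \<open>z2\<close> for
        \<open>B\<close> would both be the direction of the line on which \<open>B\<close>
        lies.\<close>
      have others: "z2 A t" if t: "prim t" "\<not> P dvd wedge t x" for t
      proof (rule ccontr)
        assume "\<not> z2 A t"
        then have "z2 B t" using tpairD(9)[OF tp t(1)] by blast
        then have "P dvd wedge (c - b) t" "P dvd wedge (c - b) x" using on_line t(1) x c(1) by blast+
        then have "P dvd wedge t x"
          using wedge_dvd_trans[of "c - b" 1 t x] c(2) par_sym[of P "c - b"] unfolding power_one_right by blast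
        with t(2) show False by blast
      qed
      have "\<not> z1 B x"
      proof
        assume "z1 B x"
        then have "p * line_card B x b = card B" by (rule z1_line_card[OF finB x(1)])
        then show False using line_card_prime(1)[OF finB cB x b] cB p_ge_2 by simp
      qed
      then have z1x: "z1 A x" using tpairD(8)[OF tp x(1)] by blast
      obtain v where v: "prim v" "P dvd wedge v x" "\<not> z2 B v"
        using nfull[OF x(1)] unfolding full_def by blast
      have "z2 A v" using v tpairD(9)[OF tp v(1)] by blast
      moreover have "z1 A v" using z1x z1_par[OF x(1) v(1,2)] by blast
      moreover have "z2 A t" if "prim t" "\<not> P dvd wedge t v" for t
        using others[OF that(1)] wedge_dvd_trans[of x 1 t v] x(1) v(2) that(2)
        unfolding power_one_right by blast
      ultimately show ?thesis using v(1) by blast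
    next
      case False
      then have all: "z2 A t" if "prim t" for t using tpairD(9)[OF tp that] that by blast
      have "\<not> (\<forall>u. prim u \<longrightarrow> z1 B u)"
      proof
        assume "\<forall>u. prim u \<longrightarrow> z1 B u"
        then have "p\<^sup>2 * class_card B b = card B" by (intro all_z1_class_card[OF finB]) blast
        then show False using cls cB p_ge_2 by (simp add: power2_eq_square)
      qed
      then show ?thesis using all tpairD(8)[OF tp] by blast
    qed
    then show ?thesis using card unfolding good_def by blast
  qed
qed

text \<open>Each direction with \<open>z1\<close> for \<open>A\<close> must be full for
  \<open>B\<close> if \<open>A\<close> has no pattern. Thus every occurring class of
  \<open>B\<close> has \<open>p\<close> points, spread over different segments along that direction.
  Two congruent points of \<open>B\<close> then single out a direction \<open>x\<close> without
  \<open>z1\<close> for \<open>A\<close>, and \<open>x\<close> completes a pattern with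
  \<open>d\<close>.\<close>

lemma tpair_p2:
  assumes tp: "tpair A B" and card: "card A = p\<^sup>2" and d: "prim d" "z1 A d"
  shows "good A"
proof (rule ccontr)
  assume bad: "\<not> good A"
  have redB: "reduced B" and finB: "finite B" and B: "B \<noteq> {}" using tpairD[OF tp] by auto
  have "p\<^sup>2 * card B = p ^ 4" unfolding card[symmetric] by (rule tpairD(7)[OF tp])
  also have "p ^ 4 = p\<^sup>2 * p\<^sup>2" by (simp flip: power_add)
  finally have cB: "card B = p\<^sup>2" using p_ge_2 unfolding mult_cancel1 by auto
  have both: "\<not> z2 A t" if "prim t" "z1 A t" for t using bad card that unfolding good_def by blast
  have fullB: "full B u" if u: "prim u" "z1 A u" for u
    unfolding full_def
  proof (intro allI impI)
    fix t assume t: "prim t \<and> P dvd wedge t u"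
    then have "z1 A t" using z1_par[OF u(1)] u(2) by blast
    then show "z2 B t" using both tpairD(9)[OF tp] t by blast
  qed
  have lineB: "line_card B u c = p" if "prim u" "z1 B u" for u c
    using z1_line_card[OF finB that, of c] cB p_ge_2 by (simp add: power2_eq_square)
  obtain d' where d': "prim d'" "\<not> z1 A d'" using bad card unfolding good_def by blast
  then have "z1 B d'" using tpairD(8)[OF tp d'(1)] by blast
  then have le: "class_card B x \<le> p" for x
    using class_le_line[OF finB, of x d'] lineB[OF d'(1)] by simp
  have seg: "class_card B x = p \<and> seg_card B u x = 1" if u: "prim u" "z1 A u" and x: "x \<in> B" for u x
  proof -
    have "class_card B x = p * seg_card B u x" by (rule full_class_card[OF finB u(1) fullB[OF u]])
    moreover from this have "seg_card B u x \<le> 1" using le[of x] p_ge_2 by simp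
    ultimately show ?thesis using seg_card_pos[OF finB x, of u] by simp
  qed
  obtain b where b: "b \<in> B" using B by blast
  obtain c where c: "c \<in> B" "c \<noteq> b" "dvd_pair P (b - c)"
  proof -
    have "{x\<in>B. dvd_pair P (x - b)} \<noteq> {b}"
      using seg[OF d b] p_ge_2 unfolding class_card_def by (metis One_nat_def card_1_singleton_iff numeral_2_eq_2 not_less_eq_eq order_refl)
    moreover have "b \<in> {x\<in>B. dvd_pair P (x - b)}" using b by simp
    ultimately obtain c where "c \<in> B" "c \<noteq> b" "dvd_pair P (c - b)" by blast
    then show thesis using that dvd_pair_minus_commute by blast
  qed
  obtain x where x: "prim x" "D1 B x" using peq_pair_D1[OF redB b c(1) c(2)[symmetric] c(3)] by blast
  obtain e where e: "e \<in> B" "seg_card B x e \<noteq> 1"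
  proof -
    obtain e f where ef: "e \<in> B" "f \<in> B" "e \<noteq> f" "dvd_pair P (e - f)" "P\<^sup>2 dvd wedge (e - f) x"
      using x(2) unfolding D1_def by blast
    have "seg_card B x f \<noteq> 1"
    proof
      assume "seg_card B x f = 1"
      then have "e = f"
        using card_le_one_eq[OF finB, of "\<lambda>y. dvd_pair P (y - f) \<and> P\<^sup>2 dvd wedge (y - f) x" e f] ef
        by (simp add: seg_card_def wedge_def)
      with ef(3) show False by blast
    qed
    with ef(2) show thesis by (rule that)
  qed
  have nz1A: "\<not> z1 A x" using seg[OF x(1) _ e(1)] e(2) by blast
  then have z1Bx: "z1 B x" using tpairD(8)[OF tp x(1)] by blast
  \<comment> \<open>A lift \<open>t\<close> failing for \<open>A\<close> would be equidistributed
    for \<open>B\<close>, where lines along \<open>x\<close> have \<open>p\<close> points and thus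
    cosets of \<open>t\<close> one. This contradicts the segment of \<open>e\<close> having more
    than one point.\<close>
  have "full A x"
    unfolding full_def
  proof (intro allI impI, rule ccontr)
    fix t assume t: "prim t \<and> P dvd wedge t x" "\<not> z2 A t"
    then have zB: "z2 B t" using tpairD(9)[OF tp] by blast
    have pt: "prim t" "P dvd wedge t x" using t by blast+
    have "p * coset_card B t e = p"
      unfolding z2_line_card[OF finB pt(1) zB, symmetric] line_card_par[OF x(1) pt, symmetric]
      by (rule lineB[OF x(1) z1Bx])
    then have "coset_card B t e = 1" using p_ge_2 by simp
    then have "seg_card B t e = 1"
      using seg_le_coset[OF finB, of t e] seg_card_pos[OF finB e(1), of t] by simp
    then show False using seg_card_par[OF x(1) pt, of B e] e(2) by simp
  qed
  moreover have "\<not> P dvd wedge d x" using nz1A z1_par[OF x(1) d(1)] d(2) by blast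
  ultimately have "good A" using card d x(1) unfolding good_def by blast
  with bad show False by blast
qed

text \<open>The complement serves as spectrum. It satisfies \<open>z1\<close> in all directions and
  so has one point per class, which makes its differences primitive. If \<open>B\<close> satisfied
  \<open>z2\<close> at such a difference, each of the corresponding cosets would contain one point
  of \<open>B\<close> only.\<close>

lemma tpair_p2_spectral:
  assumes tp: "tpair A B" and A: "A \<subseteq> grid" and card: "card A = p\<^sup>2"
    and no: "\<And>u. prim u \<Longrightarrow> \<not> z1 A u"
  shows "spectral (p\<^sup>2) A"
proof -
  have finA: "finite A" and finB: "finite B" and neA: "A \<noteq> {}" using tpairD[OF tp] by auto
  have "p\<^sup>2 * card B = p ^ 4" unfolding card[symmetric] by (rule tpairD(7)[OF tp])
  also have "p ^ 4 = p\<^sup>2 * p\<^sup>2" by (simp flip: power_add)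
  finally have cB: "card B = p\<^sup>2" using p_ge_2 unfolding mult_cancel1 by auto
  have all: "z1 B u" if "prim u" for u using no[OF that] tpairD(8)[OF tp that] by blast
  have cls: "class_card B c = 1" for c
    using all_z1_class_card[OF finB all, of c] cB p_ge_2 by simp
  have "fourier A (b - c) = 0" if bc: "b \<in> B" "c \<in> B" "b \<noteq> c" for b c
  proof -
    have pr: "prim (b - c)"
    proof (unfold prim_def, rule notI)
      assume "dvd_pair P (b - c)"
      then have "b = c"
        using card_le_one_eq[OF finB, of "\<lambda>x. dvd_pair P (x - c)" b c] cls[of c] bc
        by (simp add: class_card_def)
      with bc(3) show False by blast
    qed
    have "z2 A (b - c)"
    proof (rule ccontr)
      assume "\<not> z2 A (b - c)"
      then have z: "z2 B (b - c)" using tpairD(9)[OF tp pr] by blast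
      have "p\<^sup>2 * coset_card B (b - c) c = p\<^sup>2"
        using z1_z2_coset_card[OF finB pr all[OF pr] z] cB by simp
      then have "coset_card B (b - c) c = 1" using p_ge_2 by simp
      then have "b = c"
        using card_le_one_eq[OF finB, of "\<lambda>x. P\<^sup>2 dvd wedge (x - c) (b - c)" b c] bc(1,2)
        unfolding coset_card_def by (simp add: wedge_self) (simp add: wedge_def)
      with bc(3) show False by blast
    qed
    then show ?thesis using fourier_zero_iff_z2[OF finA pr] by blast
  qed
  then show ?thesis unfolding spectral_iff[OF A neA] using finB cB card by (intro exI[of _ B]) auto
qed

section \<open>The two implications, by the size of the set\<close>

lemma spectral_imp_tile:
  assumes A: "A \<subseteq> grid" "A \<noteq> {}" and sp: "spectral (p\<^sup>2) A"
  shows "tile (Zn_sq (p\<^sup>2)) A"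
proof -
  have red: "reduced A" by (rule reduced_grid[OF A(1)])
  obtain S where "finite S" "card S = card A" "\<forall>s\<in>S. \<forall>t\<in>S. s \<noteq> t \<longrightarrow> fourier A (s - t) = 0"
    using sp unfolding spectral_iff[OF A] by blast
  then have S: "spair A S" by (intro spair_from_fourier[OF red A(2)]) auto
  have "card A \<noteq> 0" using spairD(3,6)[OF S] by simp
  then consider "card A = 1" | "card A > 1" by linarith
  then show ?thesis
  proof cases
    case 1
    then have "good A" unfolding good_def by blast
    then show ?thesis using good_spectral_tile[OF A] by blast
  next
    case 2
    have "p \<le> card A" using spair_p_dvd[OF S 2] 2 by (simp add: dvd_imp_le)
    then consider (a) "card A = p" | (b) "p < card A" "card A < p\<^sup>2" | (c) "card A = p\<^sup>2"
      | (d) "p\<^sup>2 < card A" "card A < p ^ 3" | (e) "card A = p ^ 3" | (f) "card A > p ^ 3"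
      by linarith
    then have "good A \<or> tile (Zn_sq (p\<^sup>2)) A"
    proof cases
      case a
      obtain u where "prim u" "z1 A u \<or> z2 A u" using spair_dvd_card[OF S 2] .
      then have "good A" using a unfolding good_def by blast
      then show ?thesis ..
    next
      case b
      then show ?thesis using spair_small[OF S] by blast
    next
      case c
      then show ?thesis using spair_p2[OF S c] spair_p2_tile[OF S A(1) c] by blast
    next
      case d
      then show ?thesis using spair_mid[OF S] by blast
    next
      case e
      then show ?thesis using spair_p3[OF S] by blast
    next
      case f
      then show ?thesis using spair_large[OF S] unfolding good_def by blast
    qed
    then show ?thesis using good_spectral_tile[OF A] by blast
  qed
qed

lemma tile_imp_spectral:
  assumes A: "A \<subseteq> grid" "A \<noteq> {}" and t: "tile (Zn_sq (p\<^sup>2)) A"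
  shows "spectral (p\<^sup>2) A"
proof -
  obtain B where B: "tpair A B" using tile_tpair[OF A(1) t] by blast
  have "card A dvd p ^ 4" using tpairD(7)[OF B] by (metis dvd_triv_left)
  then obtain k where k: "k \<le> 4" "card A = p ^ k" using divides_primepow_nat[OF prime_p] by blast
  then consider "k = 0" | "k = 1" | "k = 2" | "k = 3" | "k = 4" by linarith
  then have "good A \<or> spectral (p\<^sup>2) A"
  proof cases
    case 1
    then show ?thesis using k unfolding good_def by simp
  next
    case 2
    then have c: "card A = p" using k by simp
    then have "card A \<noteq> 1" using p_ge_2 by simp
    then obtain u where "prim u" "z1 A u \<or> z2 A u" by (rule all_z_exhaust[OF B])
    then have "good A" using c unfolding good_def by blast
    then show ?thesis ..
  next
    case 3
    then have c: "card A = p\<^sup>2" using k by simp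
    then show ?thesis using tpair_p2[OF B c] tpair_p2_spectral[OF B A(1) c] by blast
  next
    case 4
    then show ?thesis using tpair_p3[OF B] k by blast
  next
    case 5
    then show ?thesis using k unfolding good_def by simp
  qed
  then show ?thesis using good_spectral_tile[OF A] by blast
qed

end

theorem theorem1:
  fixes p :: nat and A :: "(int \<times> int) set"
  assumes "prime p"
    and "A \<subseteq> carrier (Zn_sq (p\<^sup>2))"
    and "A \<noteq> {}"
  shows "spectral (p\<^sup>2) A \<longleftrightarrow> tile (Zn_sq (p\<^sup>2)) A"
proof -
  interpret prime_square p by unfold_locales (fact assms(1))
  have "A \<subseteq> grid" using assms(2) unfolding carrier_grid .
  then show ?thesis using spectral_imp_tile tile_imp_spectral assms(3) by blast
qed

end
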